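(* Let $I\subseteq\mathbb R$ be an open interval containing $0$, let $\psi_0\in L^2(\mathbb R)$, and let $\psi\in C_IL^2_x\cap L^4_{I,\mathrm{loc}}C_x$ be the strong solution on $I$ of $i\psi_t=-\psi_{xx}+\delta(x)|\psi|^2\psi$ satisfying $\psi(0)=\psi_0$, where $\delta$ is the Dirac mass at $x=0$. Then $$\int_I|\psi(t,0)|^4\,dt\le\bigl\|e^{it\partial_x^2}\psi_0\bigr\|_{L^4_IC_x}^4 .$$
   Context: $e^{it\partial_x^2}$ is the free Schrödinger group on $\mathbb R$, i.e. the Fourier multiplier $e^{-it\xi^2}$. $C_x$ denotes the bounded continuous functions $\mathbb R\to\mathbb C$ with the sup norm. $C_IL^2_x$ denotes bounded continuous functions $I\to L^2(\mathbb R)$ with the sup norm, $L^4_IC_x=L^4(I;C_x)$, so $\|u\|_{L^4_IC_x}^4=\int_I\sup_{x\in\mathbb R}|u(t,x)|^4\,dt$, and $L^4_{I,\mathrm{loc}}C_x$ denotes functions in $L^4_JC_x$ for every compact subinterval $J\subseteq I$. Strong solution: $\psi\in C_IL^2_x\cap L^4_{I,\mathrm{loc}}C_x$ is a strong solution of the equation on $I$ if for some $t_0\in I$ (equivalently, every $t_0\in I$) and all $t\in I$, $$\psi(t)=e^{i(t-t_0)\partial_x^2}\psi(t_0)-i\int_{t_0}^te^{i(t-s)\partial_x^2}\bigl[|\psi(s,0)|^2\psi(s,0)\,\delta\bigr]\,ds .$$ Integrals of the form $\int e^{-is\partial_x^2}f(s)\,ds$ with $f$ measure-valued are understood as elements of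 $L^2(\mathbb R)$ by duality: their pairing with $\varphi\in L^2(\mathbb R)$ is $\int\bigl[\int_{\mathbb R}\overline{(e^{is\partial_x^2}\varphi)(x)}\,df(s)(x)\bigr]ds$, using that $e^{is\partial_x^2}\varphi$ is, for a.e. $s$, a bounded continuous function. Since $\psi(t)\in C_x$ for a.e. $t\in I$, the value $\psi(t,0)$ is meaningful for a.e. $t\in I$. *)

theory Defs
  imports "HOL-Analysis.Analysis" "HOL-Probability.Giry_Monad"
begin

text \<open>
  Elements of \<open>L\<^sup>2(\<real>)\<close> are represented by Lebesgue measurable functions, and equality in
  \<open>L\<^sup>2\<close> is equality almost everywhere. Operators below that return a function are only
  determined up to null sets; they are always used through notions invariant under such changes.
  The complete measure \<open>lebesgue\<close> is used throughout (also in time), so that measurability is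
  invariant under changes on null sets.
\<close>

definition L2_norm_sq :: "(real \<Rightarrow> complex) \<Rightarrow> ennreal" where
  "L2_norm_sq f = (\<integral>\<^sup>+ x. ennreal ((cmod (f x))\<^sup>2) \<partial>lebesgue)"

definition L2 :: "(real \<Rightarrow> complex) set" where
  "L2 = {f. f \<in> borel_measurable lebesgue \<and> L2_norm_sq f < \<infinity>}"

text \<open>
  The Fourier transform on \<open>L\<^sup>2(\<real>)\<close>, as the \<open>L\<^sup>2\<close> limit for \<open>R \<longlonglongrightarrow> \<infinity>\<close> of
  \<open>\<integral>\<^sub>-\<^sub>R\<^sup>R exp (- i x \<xi>) f(x) dx\<close>. No normalising constant is needed, since it is only used to
  define Fourier multipliers.
\<close>

definition fourier_trunc :: "real \<Rightarrow> (real \<Rightarrow> complex) \<Rightarrow> real \<Rightarrow> complex" where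
  "fourier_trunc R f \<xi> = (LINT x:{-R..R}|lebesgue. cis (- (x * \<xi>)) * f x)"

definition fourier_L2 :: "(real \<Rightarrow> complex) \<Rightarrow> (real \<Rightarrow> complex)" where
  "fourier_L2 f = (SOME g. g \<in> L2 \<and>
     ((\<lambda>R. L2_norm_sq (\<lambda>\<xi>. g \<xi> - fourier_trunc R f \<xi>)) \<longlongrightarrow> 0) at_top)"

text \<open>The free group \<open>exp (i t \<partial>\<^sub>x\<^sup>2)\<close>: the Fourier multiplier with symbol \<open>exp (- i t \<xi>\<^sup>2)\<close>.\<close>

definition schrodinger_group :: "real \<Rightarrow> (real \<Rightarrow> complex) \<Rightarrow> (real \<Rightarrow> complex)" where
  "schrodinger_group t f = (SOME h. h \<in> L2 \<and>
     (AE \<xi> in lebesgue. fourier_L2 h \<xi> = cis (- (t * \<xi>\<^sup>2)) * fourier_L2 f \<xi>))"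

text \<open>
  A class modulo null sets belongs to \<open>C\<^sub>x\<close> if it has a bounded continuous representative, which
  is then unique; pointwise values such as \<open>\<psi>(t,0)\<close> refer to that representative.
\<close>

definition in_Cx :: "(real \<Rightarrow> complex) \<Rightarrow> bool" where
  "in_Cx f \<longleftrightarrow> (\<exists>g :: real \<Rightarrow>\<^sub>C complex. AE x in lebesgue. f x = apply_bcontfun g x)"

definition Cx_rep :: "(real \<Rightarrow> complex) \<Rightarrow> (real \<Rightarrow>\<^sub>C complex)" where
  "Cx_rep f = (SOME g. AE x in lebesgue. f x = apply_bcontfun g x)"

definition Cx_value :: "(real \<Rightarrow> complex) \<Rightarrow> real \<Rightarrow> complex" where
  "Cx_value f x = apply_bcontfun (Cx_rep f) x"

definition Cx_norm :: "(real \<Rightarrow> complex) \<Rightarrow> ennreal" where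
  "Cx_norm f = (if in_Cx f then ennreal (norm (Cx_rep f)) else \<infinity>)"

text \<open>The fourth power of the norm of \<open>L\<^sup>4(J; C\<^sub>x)\<close>.\<close>

definition L4Cx_norm_pow4 :: "real set \<Rightarrow> (real \<Rightarrow> real \<Rightarrow> complex) \<Rightarrow> ennreal" where
  "L4Cx_norm_pow4 J u = (\<integral>\<^sup>+ t. (Cx_norm (u t))^4 \<partial>lebesgue_on J)"

text \<open>
  \<open>C\<^sub>x\<close> is not separable, so the strong measurability required in a Bochner space is spelled
  out: almost everywhere convergence of a sequence of simple functions.
\<close>

definition strongly_measurable_Cx :: "real set \<Rightarrow> (real \<Rightarrow> real \<Rightarrow> complex) \<Rightarrow> bool" where
  "strongly_measurable_Cx J u \<longleftrightarrow>
     (AE t in lebesgue_on J. in_Cx (u t)) \<and>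
     (\<exists>S :: nat \<Rightarrow> real \<Rightarrow> (real \<Rightarrow>\<^sub>C complex).
        (\<forall>n. simple_function (lebesgue_on J) (S n)) \<and>
        (AE t in lebesgue_on J. (\<lambda>n. S n t) \<longlonglongrightarrow> Cx_rep (u t)))"

definition L4Cx :: "real set \<Rightarrow> (real \<Rightarrow> real \<Rightarrow> complex) set" where
  "L4Cx J = {u. strongly_measurable_Cx J u \<and> L4Cx_norm_pow4 J u < \<infinity>}"

definition L4Cx_loc :: "real set \<Rightarrow> (real \<Rightarrow> real \<Rightarrow> complex) set" where
  "L4Cx_loc I = {u. \<forall>a b. a \<le> b \<and> {a..b} \<subseteq> I \<longrightarrow> u \<in> L4Cx {a..b}}"

definition C_L2 :: "real set \<Rightarrow> (real \<Rightarrow> real \<Rightarrow> complex) set" where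
  "C_L2 I = {u. (\<forall>t\<in>I. u t \<in> L2) \<and>
     (\<forall>t\<in>I. ((\<lambda>s. L2_norm_sq (\<lambda>x. u s x - u t x)) \<longlongrightarrow> 0) (at t within I)) \<and>
     (\<exists>M<\<infinity>. \<forall>t\<in>I. L2_norm_sq (u t) \<le> M)}"

text \<open>
  \<open>h = \<integral>\<^sub>a\<^sup>b exp (i (t - s) \<partial>\<^sub>x\<^sup>2) [c(s) \<mu>] ds\<close> as an element of \<open>L\<^sup>2(\<real>)\<close>, for a finite Borel
  measure \<open>\<mu>\<close> and a scalar function \<open>c\<close>, defined by duality: the pairing with \<open>\<phi> \<in> L\<^sup>2\<close> is
  \<open>\<integral>\<^sub>a\<^sup>b [\<integral> cnj ((exp (i (s - t) \<partial>\<^sub>x\<^sup>2) \<phi>)(x)) c(s) d\<mu>(x)] ds\<close>. The integral over \<open>s\<close> is oriented,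
  i.e. \<open>b < a\<close> is allowed.
\<close>

definition has_duality_integral ::
  "real \<Rightarrow> real \<Rightarrow> real \<Rightarrow> (real \<Rightarrow> complex) \<Rightarrow> real measure \<Rightarrow> (real \<Rightarrow> complex) \<Rightarrow> bool" where
  "has_duality_integral t a b c \<mu> h \<longleftrightarrow> h \<in> L2 \<and>
     (\<forall>\<phi>\<in>L2.
        let p = (\<lambda>s. LINT x|\<mu>. cnj (Cx_value (schrodinger_group (s - t) \<phi>) x) * c s) in
        interval_lebesgue_integrable lebesgue (ereal a) (ereal b) p \<and>
        (LINT x|lebesgue. h x * cnj (\<phi> x)) = (LINT s=ereal a..ereal b|lebesgue. p s))"

abbreviation dirac0 :: "real measure" where
  "dirac0 \<equiv> return borel 0"

text \<open>Strong solutions on \<open>I\<close> of \<open>i \<psi>\<^sub>t = - \<psi>\<^sub>x\<^sub>x + \<delta>(x) |\<psi>|\<^sup>2 \<psi>\<close>.\<close>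

definition strong_solution :: "real set \<Rightarrow> (real \<Rightarrow> real \<Rightarrow> complex) \<Rightarrow> bool" where
  "strong_solution I \<psi> \<longleftrightarrow> \<psi> \<in> C_L2 I \<and> \<psi> \<in> L4Cx_loc I \<and>
     (\<exists>t0\<in>I. \<forall>t\<in>I. \<exists>D.
        has_duality_integral t t0 t
          (\<lambda>s. of_real ((cmod (Cx_value (\<psi> s) 0))\<^sup>2) * Cx_value (\<psi> s) 0) dirac0 D \<and>
        (AE x in lebesgue. \<psi> t x = schrodinger_group (t - t0) (\<psi> t0) x - \<i> * D x))"

end

theory Submission
  imports Defs "HOL-Probability.Probability"
begin

text \<open>
  Write \<open>q(t) = \<psi>(t,0)\<close>, \<open>F = |q|\<^sup>2 q\<close>, and let \<open>f(t)\<close> be the value at \<open>x = 0\<close> of the free evolution of \<open>\<psi>0\<close>.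
  Formally, the Duhamel formula at \<open>x = 0\<close> reads
  \<open>q(t) = f(t) - i \<integral>\<^sub>0\<^sup>t (4 \<pi> i (t - s))\<^sup>-\<^sup>1\<^sup>/\<^sup>2 F(s) ds\<close>. Multiply by the conjugate of \<open>F(t)\<close>, integrate over
  \<open>t\<close> in \<open>[0,T]\<close> and take real parts. The left side becomes \<open>\<integral> |q|\<^sup>4\<close>. The double integral on the right has
  nonpositive real part: for \<open>\<tau> > 0\<close> one has \<open>-i (i\<tau>)\<^sup>-\<^sup>1\<^sup>/\<^sup>2 = - (-i\<tau>)\<^sup>-\<^sup>1\<^sup>/\<^sup>2\<close>, and \<open>(-i\<tau>)\<^sup>-\<^sup>1\<^sup>/\<^sup>2\<close> is a
  positive multiple of \<open>\<integral> exp (i \<tau> \<xi>\<^sup>2) d\<xi>\<close>, a superposition of characters and hence a positive definite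
  Hermitian kernel; the integral over \<open>s < t\<close> of such a kernel against \<open>F(s) cnj (F(t))\<close> has half the
  real part of the full double integral. Therefore \<open>\<integral> |q|\<^sup>4 \<le> \<integral> |f| |q|\<^sup>3\<close>. The left side is finite on compact
  intervals, so Young's inequality absorbs the powers of \<open>q\<close> and leaves \<open>\<integral> |q|\<^sup>4 \<le> \<integral> |f|\<^sup>4\<close>.
  Negative times follow by complex conjugation and time reversal, and compact intervals exhaust \<open>I\<close>.

  Three points need work. First, values at \<open>x = 0\<close> are replaced by averages against the heat kernel at a
  small time \<open>\<epsilon>\<close>. These are inner products in \<open>L\<^sup>2\<close>, and the free group moves the heat kernel at the complex
  time \<open>z\<close> to the heat kernel at the time \<open>z + i t\<close> (\<open>schrodinger_group_heat_kernel\<close>), so that testing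
  the Duhamel formula produces the regularised kernel \<open>(4 \<pi> (\<epsilon> + i (t - s)))\<^sup>-\<^sup>1\<^sup>/\<^sup>2\<close>.

  Secondly, the identity that gave the sign fails for this kernel. The defect has the size of the square root
  of a Cauchy density of width \<open>\<epsilon>\<close> (\<open>duhamel_kernel_error\<close>). Its \<open>L\<^sup>2\<close> norm stays bounded but does not tend
  to zero, which is the scale invariance of the problem; its mass concentrates on the diagonal, and
  therefore its quadratic form at \<open>|q|\<^sup>3\<close> does tend to zero (\<open>kernel_error_tendsto_0\<close>).

  Thirdly, the Fourier transform and the free group on \<open>L\<^sup>2\<close> are given by choice among functions with a
  prescribed property, so existence and uniqueness have to be supplied. Existence of the \<open>L\<^sup>2\<close> limit
  is Bessel's inequality together with completeness; injectivity and the inversion formula follow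
  from the multiplication formula \<open>\<integral> (F f) k = \<integral> f (F k)\<close>, tested with modulated Gaussians, which are total
  because a measure is determined by its characteristic function.
\<close>

section \<open>Fourier integrals of integrable functions\<close>

lemma sigma_finite_lebesgue: "sigma_finite_measure (lebesgue :: real measure)"
proof
  obtain A :: "real set set" where A: "countable A" "A \<subseteq> sets lborel" "\<Union>A = space lborel"
      "\<forall>a\<in>A. emeasure lborel a \<noteq> \<infinity>"
    using lborel.sigma_finite_countable by metis
  then show "\<exists>A::real set set. countable A \<and> A \<subseteq> sets lebesgue \<and> \<Union>A = space lebesgue \<and>
      (\<forall>a\<in>A. emeasure lebesgue a \<noteq> \<infinity>)"
    by (intro exI[of _ A]) (auto simp: subset_iff)
qed

interpretation leb: sigma_finite_measure "lebesgue :: real measure"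
  by (rule sigma_finite_lebesgue)

interpretation leb_pair: pair_sigma_finite "lebesgue :: real measure" "lebesgue :: real measure" ..

text \<open>
  Elements of \<open>L2\<close> are Lebesgue measurable while explicit kernels are Borel measurable; this lemma and the next
  three let both occur in one product measurability goal.
\<close>

lemma borel_imp_leb: "f \<in> measurable borel M \<Longrightarrow> f \<in> measurable (lebesgue :: real measure) M"
  by (rule measurable_completion) simp

lemma leb_id [measurable (raw)]: "(\<lambda>x. x) \<in> borel_measurable (lebesgue :: real measure)"
  by (rule borel_imp_leb) simp

lemma leb_fst [measurable (raw)]: "fst \<in> borel_measurable ((lebesgue :: real measure) \<Otimes>\<^sub>M N)"
  using measurable_compose[OF measurable_fst leb_id] .

lemma leb_snd [measurable (raw)]: "snd \<in> borel_measurable (N \<Otimes>\<^sub>M (lebesgue :: real measure))"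
  using measurable_compose[OF measurable_snd leb_id] .

lemma borel_measurable_cis [measurable (raw)]:
  "f \<in> borel_measurable M \<Longrightarrow> (\<lambda>x. cis (f x)) \<in> borel_measurable M"
  unfolding cis_conv_exp by measurable

text \<open>
  The integral of \<open>fourier_trunc\<close> over the whole line, for integrable functions.
\<close>

definition fourier_integral :: "(real \<Rightarrow> complex) \<Rightarrow> real \<Rightarrow> complex" where
  "fourier_integral f \<xi> = (LINT x|lebesgue. cis (- (x * \<xi>)) * f x)"

lemma fourier_integral_measurable [measurable]:
  assumes [measurable]: "f \<in> borel_measurable lebesgue"
  shows "fourier_integral f \<in> borel_measurable lebesgue"
  unfolding fourier_integral_def
  by (rule leb.borel_measurable_lebesgue_integral) (simp add: split_beta')

lemma integrable_cis_mult:
  fixes f :: "'a \<Rightarrow> complex"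
  assumes "integrable M f" and [measurable]: "g \<in> borel_measurable M"
  shows "integrable M (\<lambda>x. cis (g x) * f x)"
proof (rule Bochner_Integration.integrable_bound[OF assms(1)])
  show "(\<lambda>x. cis (g x) * f x) \<in> borel_measurable M" using assms by measurable
qed (simp add: norm_mult)

lemma fourier_integral_bound:
  assumes "integrable lebesgue f"
  shows "cmod (fourier_integral f \<xi>) \<le> (LINT x|lebesgue. cmod (f x))"
  using integral_norm_bound[of lebesgue "\<lambda>x. cis (- (x * \<xi>)) * f x"]
  by (simp add: fourier_integral_def norm_mult)

text \<open>
  The multiplication formula: both sides are the double integral of \<open>cis (- x \<xi>) f(x) g(\<xi>)\<close>. Together
  with the transforms of Gaussians it carries the whole theory on \<open>L\<^sup>2\<close> below.
\<close>

lemma fourier_integral_mult_swap: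
  assumes f: "integrable lebesgue f" and g: "integrable lebesgue g"
  shows "(LINT \<xi>|lebesgue. fourier_integral f \<xi> * g \<xi>) = (LINT x|lebesgue. f x * fourier_integral g x)"
proof -
  have [measurable]: "f \<in> borel_measurable lebesgue" "g \<in> borel_measurable lebesgue"
    using f g by auto
  have int: "integrable (lebesgue \<Otimes>\<^sub>M lebesgue) (\<lambda>(x, \<xi>). cis (- (x * \<xi>)) * f x * g \<xi>)"
  proof (rule leb_pair.Fubini_integrable)
    show "(\<lambda>(x, \<xi>). cis (- (x * \<xi>)) * f x * g \<xi>) \<in> borel_measurable (lebesgue \<Otimes>\<^sub>M lebesgue)"
      by measurable
    show "integrable lebesgue (\<lambda>x. LINT y|lebesgue. cmod (case (x, y) of (x, \<xi>) \<Rightarrow> cis (- (x * \<xi>)) * f x * g \<xi>))"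
      using f by (simp add: norm_mult)
    show "AE x in lebesgue. integrable lebesgue (\<lambda>y. case (x, y) of (x, \<xi>) \<Rightarrow> cis (- (x * \<xi>)) * f x * g \<xi>)"
    proof (rule AE_I2)
      fix x
      have "integrable lebesgue (\<lambda>y. f x * (cis (- (x * y)) * g y))"
        by (intro integrable_mult_right integrable_cis_mult g) measurable
      then show "integrable lebesgue (\<lambda>y. case (x, y) of (x, \<xi>) \<Rightarrow> cis (- (x * \<xi>)) * f x * g \<xi>)"
        by (simp add: mult_ac)
    qed
  qed
  have "(LINT \<xi>|lebesgue. fourier_integral f \<xi> * g \<xi>) = (LINT \<xi>|lebesgue. (LINT x|lebesgue. cis (- (x * \<xi>)) * f x * g \<xi>))"
    by (simp add: fourier_integral_def)
  also have "\<dots> = (LINT x|lebesgue. (LINT \<xi>|lebesgue. cis (- (x * \<xi>)) * f x * g \<xi>))"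
    by (rule leb_pair.Fubini_integral[OF int])
  also have "\<dots> = (LINT x|lebesgue. f x * fourier_integral g x)"
    unfolding fourier_integral_def integral_mult_right_zero[symmetric]
    by (intro Bochner_Integration.integral_cong refl) (simp add: mult_ac)
  finally show ?thesis .
qed

lemma integral_std_normal_cis:
  "(LINT x|lborel. cis (t * x) * of_real (std_normal_density x)) = of_real (exp (- t\<^sup>2 / 2))"
proof -
  have "char std_normal_distribution t = (LINT x|lborel. std_normal_density x *\<^sub>R iexp (t * x))"
    unfolding char_def by (rule integral_density) (auto simp: cis_conv_exp[symmetric])
  then show ?thesis
    by (simp add: char_std_normal_distribution cis_conv_exp scaleR_conv_of_real mult_ac)
qed

text \<open>
  Rescaling reduces this to the characteristic function of the standard normal distribution. The modulation
  by \<open>b\<close> moves the centre of the transform.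
\<close>

lemma fourier_integral_gaussian:
  assumes e: "e > 0"
  shows "fourier_integral (\<lambda>\<xi>. cis (b * \<xi>) * of_real (exp (- e * \<xi>\<^sup>2))) y = of_real (2 * pi * normal_density b (sqrt (2 * e)) y)"
proof -
  define c where "c = 1 / sqrt (2 * e)"
  have c: "c > 0" "c\<^sup>2 = 1 / (2 * e)" using e by (auto simp: c_def power_divide)
  have "fourier_integral (\<lambda>\<xi>. cis (b * \<xi>) * of_real (exp (- e * \<xi>\<^sup>2))) y
      = (LINT \<xi>|lborel. cis (- (\<xi> * y)) * (cis (b * \<xi>) * of_real (exp (- e * \<xi>\<^sup>2))))"
    unfolding fourier_integral_def by (rule integral_completion) simp
  also have "\<dots> = (LINT \<xi>|lborel. cis ((b - y) * \<xi>) * of_real (exp (- e * \<xi>\<^sup>2)))"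
    by (simp add: mult.assoc[symmetric] cis_mult algebra_simps)
  also have "\<dots> = \<bar>c\<bar> *\<^sub>R (LINT \<xi>|lborel. cis ((b - y) * (0 + c * \<xi>)) * of_real (exp (- e * (0 + c * \<xi>)\<^sup>2)))"
    using c by (intro lborel_integral_real_affine) auto
  also have "\<dots> = of_real c * (LINT \<xi>|lborel. of_real (sqrt (2 * pi)) * (cis (((b - y) * c) * \<xi>) * of_real (std_normal_density \<xi>)))"
    using c e by (simp add: power_mult_distrib std_normal_density_def scaleR_conv_of_real mult_ac)
  also have "\<dots> = of_real (c * sqrt (2 * pi) * exp (- ((b - y) * c)\<^sup>2 / 2))"
    by (simp add: integral_std_normal_cis)
  also have "c * sqrt (2 * pi) * exp (- ((b - y) * c)\<^sup>2 / 2) = 2 * pi * normal_density b (sqrt (2 * e)) y"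
  proof -
    have "sqrt (2 * pi) * sqrt (2 * pi) = 2 * pi" by simp
    moreover have "((b - y) * c)\<^sup>2 / 2 = (y - b)\<^sup>2 / (2 * (2 * e))"
      using c by (simp add: power_mult_distrib power2_commute)
    moreover have "sqrt (2 * pi * (2 * e)) = sqrt (2 * pi) * sqrt (2 * e)"
      by (rule real_sqrt_mult)
    ultimately show ?thesis
      using e unfolding normal_density_def c_def by (simp add: field_simps)
  qed
  finally show ?thesis .
qed

lemma integrable_gaussian:
  fixes e :: real
  assumes "e > 0" shows "integrable lborel (\<lambda>x. exp (- e * (x - b)\<^sup>2))"
proof -
  have "integrable lborel (\<lambda>x. sqrt (pi / e) * normal_density b (1 / sqrt (2 * e)) x)"
    using assms by (intro integrable_mult_right integrable_normal_density) auto
  moreover have "sqrt (pi / e) * normal_density b (1 / sqrt (2 * e)) x = exp (- e * (x - b)\<^sup>2)" for x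
  proof -
    have *: "(1 / sqrt (2 * e))\<^sup>2 = 1 / (2 * e)" using assms by (simp add: power_divide)
    show ?thesis unfolding normal_density_def * using assms by (simp add: field_simps)
  qed
  ultimately show ?thesis by simp
qed

lemma nn_integral_normal:
  assumes "s > 0" shows "(\<integral>\<^sup>+ x. ennreal (normal_density b s x) \<partial>lebesgue) = 1"
  unfolding nn_integral_completion
  using assms by (subst nn_integral_eq_integral) auto

section \<open>Square-integrable functions and Bessel's inequality\<close>

lemma L2_measurable [measurable_dest]: "f \<in> L2 \<Longrightarrow> f \<in> borel_measurable lebesgue"
  by (simp add: L2_def)

lemma L2_finite: "f \<in> L2 \<Longrightarrow> L2_norm_sq f < \<infinity>"
  by (simp add: L2_def)

lemma L2_norm_sq_add:
  assumes [measurable]: "f \<in> borel_measurable lebesgue" "g \<in> borel_measurable lebesgue"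
  shows "L2_norm_sq (\<lambda>x. f x + g x) \<le> 2 * L2_norm_sq f + 2 * L2_norm_sq g"
proof -
  have "L2_norm_sq (\<lambda>x. f x + g x) \<le> (\<integral>\<^sup>+ x. 2 * ennreal ((cmod (f x))\<^sup>2) + 2 * ennreal ((cmod (g x))\<^sup>2) \<partial>lebesgue)"
    unfolding L2_norm_sq_def
  proof (rule nn_integral_mono)
    fix x
    have "(cmod (f x + g x))\<^sup>2 \<le> (cmod (f x) + cmod (g x))\<^sup>2"
      by (intro power_mono norm_triangle_ineq) auto
    also have "\<dots> \<le> 2 * (cmod (f x))\<^sup>2 + 2 * (cmod (g x))\<^sup>2"
      using sum_squares_bound[of "cmod (f x)" "cmod (g x)"] by (simp add: power2_sum)
    finally have "ennreal ((cmod (f x + g x))\<^sup>2) \<le> ennreal (2 * (cmod (f x))\<^sup>2 + 2 * (cmod (g x))\<^sup>2)"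
      by (rule ennreal_leI)
    then show "ennreal ((cmod (f x + g x))\<^sup>2) \<le> 2 * ennreal ((cmod (f x))\<^sup>2) + 2 * ennreal ((cmod (g x))\<^sup>2)"
      by (simp add: ennreal_mult)
  qed
  also have "\<dots> = 2 * L2_norm_sq f + 2 * L2_norm_sq g"
    unfolding L2_norm_sq_def by (simp add: nn_integral_add nn_integral_cmult)
  finally show ?thesis .
qed

lemma L2_norm_sq_cmult:
  assumes [measurable]: "f \<in> borel_measurable lebesgue"
  shows "L2_norm_sq (\<lambda>x. c * f x) = ennreal ((cmod c)\<^sup>2) * L2_norm_sq f"
  unfolding L2_norm_sq_def
  by (simp add: norm_mult power_mult_distrib ennreal_mult nn_integral_cmult)

lemma L2_norm_sq_cong_norm:
  assumes "AE x in lebesgue. cmod (f x) = cmod (g x)"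
  shows "L2_norm_sq f = L2_norm_sq g"
  unfolding L2_norm_sq_def using assms by (intro nn_integral_cong_AE) auto

lemma L2_norm_sq_diff:
  assumes "f \<in> borel_measurable lebesgue" "g \<in> borel_measurable lebesgue"
  shows "L2_norm_sq (\<lambda>x. f x - g x) \<le> 2 * L2_norm_sq f + 2 * L2_norm_sq g"
proof -
  have "L2_norm_sq (\<lambda>x. - g x) = L2_norm_sq g"
    by (rule L2_norm_sq_cong_norm) simp
  then show ?thesis using L2_norm_sq_add[of f "\<lambda>x. - g x"] assms by simp
qed

lemma L2_diff: "f \<in> L2 \<Longrightarrow> g \<in> L2 \<Longrightarrow> (\<lambda>x. f x - g x) \<in> L2"
  unfolding L2_def using L2_norm_sq_diff[of f g]
  by (auto intro!: borel_measurable_diff elim!: order.strict_trans1 simp: ennreal_mult_less_top)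

lemma L2_add: "f \<in> L2 \<Longrightarrow> g \<in> L2 \<Longrightarrow> (\<lambda>x. f x + g x) \<in> L2"
  unfolding L2_def using L2_norm_sq_add[of f g]
  by (auto intro!: borel_measurable_add elim!: order.strict_trans1 simp: ennreal_mult_less_top)

lemma L2_dominated:
  assumes "f \<in> L2" and [measurable]: "g \<in> borel_measurable lebesgue"
    and "AE x in lebesgue. cmod (g x) \<le> cmod (f x)"
  shows "g \<in> L2"
proof -
  have "L2_norm_sq g \<le> L2_norm_sq f"
    unfolding L2_norm_sq_def using assms(3)
    by (intro nn_integral_mono_AE) (auto intro!: ennreal_leI power_mono)
  then show ?thesis using assms by (auto simp: L2_def)
qed

lemma L2_cmult: "f \<in> L2 \<Longrightarrow> (\<lambda>x. c * f x) \<in> L2"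
  unfolding L2_def by (auto simp: L2_norm_sq_cmult ennreal_mult_less_top)

lemma borel_measurable_cnj [measurable (raw)]:
  "f \<in> borel_measurable M \<Longrightarrow> (\<lambda>x. cnj (f x)) \<in> borel_measurable M"
  by (rule measurable_compose[OF _ borel_measurable_continuous_onI]) (auto intro: continuous_intros)

lemma L2_cnj: "f \<in> L2 \<Longrightarrow> (\<lambda>x. cnj (f x)) \<in> L2"
  by (rule L2_dominated[of f]) auto

lemma L2_Cauchy_Schwarz_nn:
  assumes "f \<in> L2" "g \<in> L2"
  shows "(\<integral>\<^sup>+ x. ennreal (cmod (f x * g x)) \<partial>lebesgue)\<^sup>2 \<le> L2_norm_sq f * L2_norm_sq g"
proof -
  have [measurable]: "f \<in> borel_measurable lebesgue" "g \<in> borel_measurable lebesgue"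
    using assms by auto
  show ?thesis
    using Cauchy_Schwarz_nn_integral[of "\<lambda>x. ennreal (cmod (f x))" lebesgue "\<lambda>x. ennreal (cmod (g x))"]
    by (simp add: L2_norm_sq_def ennreal_power norm_mult ennreal_mult[symmetric])
qed

lemma L2_mult_integrable:
  assumes "f \<in> L2" "g \<in> L2"
  shows "integrable lebesgue (\<lambda>x. f x * g x)"
proof (rule integrableI_bounded)
  have [measurable]: "f \<in> borel_measurable lebesgue" "g \<in> borel_measurable lebesgue"
    using assms by auto
  show "(\<lambda>x. f x * g x) \<in> borel_measurable lebesgue" by measurable
  have "L2_norm_sq f * L2_norm_sq g < \<infinity>"
    using assms by (auto simp: L2_def ennreal_mult_less_top)
  with L2_Cauchy_Schwarz_nn[OF assms]
  have "(\<integral>\<^sup>+ x. ennreal (cmod (f x * g x)) \<partial>lebesgue)\<^sup>2 < \<infinity>"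
    by (rule order.strict_trans1)
  then show "(\<integral>\<^sup>+ x. ennreal (cmod (f x * g x)) \<partial>lebesgue) < \<infinity>"
    by (auto simp: power2_eq_square ennreal_mult_less_top)
qed

lemma L2_Cauchy_Schwarz:
  assumes "f \<in> L2" "g \<in> L2"
  shows "ennreal ((cmod (LINT x|lebesgue. f x * g x))\<^sup>2) \<le> L2_norm_sq f * L2_norm_sq g"
proof -
  have "ennreal ((cmod (LINT x|lebesgue. f x * g x))\<^sup>2) = (ennreal (cmod (LINT x|lebesgue. f x * g x)))\<^sup>2"
    by (simp add: ennreal_power)
  also have "\<dots> \<le> (\<integral>\<^sup>+ x. ennreal (cmod (f x * g x)) \<partial>lebesgue)\<^sup>2"
    by (intro power_mono integral_norm_bound_ennreal L2_mult_integrable assms) auto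
  also have "\<dots> \<le> L2_norm_sq f * L2_norm_sq g" by (rule L2_Cauchy_Schwarz_nn[OF assms])
  finally show ?thesis .
qed

lemma integrable_lebesgue_gaussian:
  fixes e :: real
  assumes "e > 0" shows "integrable lebesgue (\<lambda>x. of_real (exp (- e * (x - b)\<^sup>2)) :: complex)"
  using integrable_gaussian[OF assms, of b]
  by (subst integrable_completion) (auto intro: integrable_of_real)

lemma normal_density_commute: "normal_density x s y = normal_density y s x"
  by (simp add: normal_density_def power2_commute)

text \<open>
  With the weight \<open>exp (- e \<xi>\<^sup>2)\<close> the integral of \<open>|F f|\<^sup>2\<close> can be rewritten by two applications of the
  multiplication formula as a double integral of \<open>f(x) cnj (f(y))\<close> against \<open>2 \<pi>\<close> times a Gaussian probability
  density in \<open>x - y\<close>. The arithmetic-geometric mean inequality and the total mass 1 give the bound.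
\<close>

lemma bessel_gaussian:
  assumes f: "f \<in> L2" "integrable lebesgue f" and e: "e > 0"
  shows "(\<integral>\<^sup>+ \<xi>. ennreal ((cmod (fourier_integral f \<xi>))\<^sup>2 * exp (- e * \<xi>\<^sup>2)) \<partial>lebesgue) \<le> ennreal (2 * pi) * L2_norm_sq f"
proof -
  have [measurable]: "f \<in> borel_measurable lebesgue" using f by auto
  define k where "k \<xi> = cnj (fourier_integral f \<xi>) * of_real (exp (- e * \<xi>\<^sup>2))" for \<xi>
  let ?g = "\<lambda>\<xi>. of_real (exp (- e * \<xi>\<^sup>2)) :: complex"
  let ?N = "\<lambda>x y. normal_density x (sqrt (2 * e)) y"
  let ?A = "\<lambda>x y. ennreal pi * (ennreal ((cmod (f x))\<^sup>2) * ennreal (?N x y))"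
  let ?B = "\<lambda>x y. ennreal pi * (ennreal ((cmod (f y))\<^sup>2) * ennreal (?N x y))"
  have gi: "integrable lebesgue ?g" using integrable_lebesgue_gaussian[OF e, of 0] by simp
  have [measurable]: "k \<in> borel_measurable lebesgue" unfolding k_def by measurable
  have k: "integrable lebesgue k"
  proof (rule Bochner_Integration.integrable_bound)
    show "integrable lebesgue (\<lambda>\<xi>. of_real (LINT x|lebesgue. cmod (f x)) * ?g \<xi>)"
      by (intro integrable_mult_right gi)
    show "AE \<xi> in lebesgue. cmod (k \<xi>) \<le> cmod (of_real (LINT x|lebesgue. cmod (f x)) * ?g \<xi>)"
    proof (rule AE_I2)
      fix \<xi>
      have "cmod (fourier_integral f \<xi>) * exp (- e * \<xi>\<^sup>2) \<le> (LINT x|lebesgue. cmod (f x)) * exp (- e * \<xi>\<^sup>2)"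
        by (intro mult_right_mono fourier_integral_bound f) auto
      then show "cmod (k \<xi>) \<le> cmod (of_real (LINT x|lebesgue. cmod (f x)) * ?g \<xi>)"
        by (simp add: k_def norm_mult)
    qed
  qed measurable
  have ftk: "cnj (fourier_integral k x) = (LINT y|lebesgue. f y * of_real (2 * pi * ?N x y))" for x
  proof -
    have "cnj (fourier_integral k x) = (LINT \<xi>|lebesgue. fourier_integral f \<xi> * (cis (x * \<xi>) * ?g \<xi>))"
      unfolding fourier_integral_def[of k] Bochner_Integration.integral_cnj[symmetric]
      by (intro Bochner_Integration.integral_cong refl) (simp add: k_def cis_cnj mult_ac)
    also have "\<dots> = (LINT y|lebesgue. f y * fourier_integral (\<lambda>\<xi>. cis (x * \<xi>) * ?g \<xi>) y)"
      by (rule fourier_integral_mult_swap[OF f(2)]) (intro integrable_cis_mult gi, measurable)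
    finally show ?thesis by (simp only: fourier_integral_gaussian[OF e])
  qed
  have "integrable lebesgue (\<lambda>\<xi>. fourier_integral f \<xi> * k \<xi>)"
  proof (rule Bochner_Integration.integrable_bound)
    show "integrable lebesgue (\<lambda>\<xi>. of_real (LINT x|lebesgue. cmod (f x)) * k \<xi>)"
      by (intro integrable_mult_right k)
    show "AE \<xi> in lebesgue. cmod (fourier_integral f \<xi> * k \<xi>) \<le> cmod (of_real (LINT x|lebesgue. cmod (f x)) * k \<xi>)"
      using fourier_integral_bound[OF f(2)] by (intro AE_I2) (auto simp: norm_mult intro!: mult_right_mono)
  qed measurable
  moreover have eq: "fourier_integral f \<xi> * k \<xi> = of_real ((cmod (fourier_integral f \<xi>))\<^sup>2 * exp (- e * \<xi>\<^sup>2))" for \<xi>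
    by (simp add: k_def mult.assoc[symmetric] complex_norm_square[symmetric])
  ultimately have int: "integrable lebesgue (\<lambda>\<xi>. (cmod (fourier_integral f \<xi>))\<^sup>2 * exp (- e * \<xi>\<^sup>2))"
    by (simp only: eq complex_of_real_integrable_eq)
  have "(\<integral>\<^sup>+ \<xi>. ennreal ((cmod (fourier_integral f \<xi>))\<^sup>2 * exp (- e * \<xi>\<^sup>2)) \<partial>lebesgue)
      = ennreal (LINT \<xi>|lebesgue. (cmod (fourier_integral f \<xi>))\<^sup>2 * exp (- e * \<xi>\<^sup>2))"
    by (rule nn_integral_eq_integral[OF int]) auto
  also have "\<dots> = ennreal (cmod (LINT \<xi>|lebesgue. fourier_integral f \<xi> * k \<xi>))"
    by (simp only: eq integral_complex_of_real norm_of_real) (simp add: integral_nonneg_AE)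
  also have "\<dots> = ennreal (cmod (LINT x|lebesgue. f x * fourier_integral k x))"
    by (simp add: fourier_integral_mult_swap[OF f(2) k])
  also have "\<dots> \<le> (\<integral>\<^sup>+ x. ennreal (cmod (f x * fourier_integral k x)) \<partial>lebesgue)"
  proof (rule integral_norm_bound_ennreal)
    show "integrable lebesgue (\<lambda>x. f x * fourier_integral k x)"
    proof (rule Bochner_Integration.integrable_bound)
      show "integrable lebesgue (\<lambda>x. of_real (LINT x|lebesgue. cmod (k x)) * f x)"
        by (intro integrable_mult_right f)
      show "AE x in lebesgue. cmod (f x * fourier_integral k x) \<le> cmod (of_real (LINT x|lebesgue. cmod (k x)) * f x)"
        using fourier_integral_bound[OF k] by (intro AE_I2) (auto simp: norm_mult mult.commute intro!: mult_left_mono)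
    qed measurable
  qed
  also have "\<dots> \<le> (\<integral>\<^sup>+ x. (\<integral>\<^sup>+ y. ?A x y +
        ?B x y \<partial>lebesgue) \<partial>lebesgue)"
  proof (rule nn_integral_mono)
    fix x
    have i: "integrable lebesgue (\<lambda>y. f y * of_real (2 * pi * ?N x y))"
    proof (rule Bochner_Integration.integrable_bound[OF integrable_mult_right[OF f(2)]])
      show "AE y in lebesgue. cmod (f y * of_real (2 * pi * ?N x y)) \<le> cmod (of_real (2 * pi / sqrt (2 * pi * (2 * e))) * f y)"
      proof (rule AE_I2)
        fix y
        have "?N x y \<le> 1 / sqrt (2 * pi * (2 * e))"
          using e by (simp add: normal_density_def divide_right_mono)
        then have "cmod (f y) * (2 * pi * ?N x y) \<le> cmod (f y) * (2 * pi * (1 / sqrt (2 * pi * (2 * e))))"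
          by (intro mult_left_mono) auto
        then show "cmod (f y * of_real (2 * pi * ?N x y)) \<le> cmod (of_real (2 * pi / sqrt (2 * pi * (2 * e))) * f y)"
          using e by (simp only: norm_mult norm_of_real) (simp add: mult_ac abs_mult)
      qed
    qed (unfold normal_density_def, measurable)
    have "cmod (fourier_integral k x) = cmod (cnj (fourier_integral k x))" by simp
    then have "ennreal (cmod (fourier_integral k x)) \<le> (\<integral>\<^sup>+ y. ennreal (cmod (f y * of_real (2 * pi * ?N x y))) \<partial>lebesgue)"
      unfolding ftk by (simp only: integral_norm_bound_ennreal[OF i])
    then have "ennreal (cmod (f x * fourier_integral k x)) \<le> ennreal (cmod (f x)) * (\<integral>\<^sup>+ y. ennreal (cmod (f y * of_real (2 * pi * ?N x y))) \<partial>lebesgue)"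
      by (simp add: norm_mult ennreal_mult mult_left_mono)
    also have "\<dots> = (\<integral>\<^sup>+ y. ennreal (cmod (f x)) * ennreal (cmod (f y * of_real (2 * pi * ?N x y))) \<partial>lebesgue)"
      by (rule nn_integral_cmult[symmetric]) (unfold normal_density_def, measurable)
    also have "\<dots> \<le> (\<integral>\<^sup>+ y. ?A x y +
        ?B x y \<partial>lebesgue)"
    proof (rule nn_integral_mono)
      fix y
      have "cmod (f x) * cmod (f y * of_real (2 * pi * ?N x y)) = pi * ?N x y * (2 * cmod (f x) * cmod (f y))"
        by (simp add: norm_mult)
      also have "\<dots> \<le> pi * ?N x y * ((cmod (f x))\<^sup>2 + (cmod (f y))\<^sup>2)"
        by (intro mult_left_mono sum_squares_bound) auto
      also have "\<dots> = pi * ((cmod (f x))\<^sup>2 * ?N x y) + pi * ((cmod (f y))\<^sup>2 * ?N x y)"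
        by (simp add: algebra_simps)
      finally have "ennreal (cmod (f x) * cmod (f y * of_real (2 * pi * ?N x y))) \<le>
          ennreal (pi * ((cmod (f x))\<^sup>2 * ?N x y) + pi * ((cmod (f y))\<^sup>2 * ?N x y))"
        by (rule ennreal_leI)
      then show "ennreal (cmod (f x)) * ennreal (cmod (f y * of_real (2 * pi * ?N x y))) \<le>
          ?A x y + ?B x y"
        by (simp add: ennreal_mult)
    qed
    finally show "ennreal (cmod (f x * fourier_integral k x)) \<le> (\<integral>\<^sup>+ y. ?A x y +
        ?B x y \<partial>lebesgue)" .
  qed
  also have "\<dots> = (\<integral>\<^sup>+ x. (\<integral>\<^sup>+ y. ?A x y \<partial>lebesgue) \<partial>lebesgue)
      + (\<integral>\<^sup>+ x. (\<integral>\<^sup>+ y. ?B x y \<partial>lebesgue) \<partial>lebesgue)"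
  proof -
    have "(\<integral>\<^sup>+ y. ?A x y +
        ?B x y \<partial>lebesgue) =
       (\<integral>\<^sup>+ y. ?A x y \<partial>lebesgue) +
       (\<integral>\<^sup>+ y. ?B x y \<partial>lebesgue)" for x
      by (rule nn_integral_add) (unfold normal_density_def, measurable)
    then show ?thesis
      by (simp only:) (rule nn_integral_add; unfold normal_density_def; measurable)
  qed
  also have "(\<integral>\<^sup>+ x. (\<integral>\<^sup>+ y. ?B x y \<partial>lebesgue) \<partial>lebesgue)
     = (\<integral>\<^sup>+ y. (\<integral>\<^sup>+ x. ?B x y \<partial>lebesgue) \<partial>lebesgue)"
    by (rule leb_pair.Fubini'[symmetric]) (unfold normal_density_def, measurable)
  also have "\<dots> = (\<integral>\<^sup>+ y. (\<integral>\<^sup>+ x. ennreal pi * (ennreal ((cmod (f y))\<^sup>2) * ennreal (?N y x)) \<partial>lebesgue) \<partial>lebesgue)"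
    by (simp only: normal_density_commute)
  also have "(\<integral>\<^sup>+ x. (\<integral>\<^sup>+ y. ?A x y \<partial>lebesgue) \<partial>lebesgue) + \<dots>
     = ennreal pi * L2_norm_sq f + ennreal pi * L2_norm_sq f"
  proof -
    have "(\<integral>\<^sup>+ y. ?A x y \<partial>lebesgue) = ennreal pi * ennreal ((cmod (f x))\<^sup>2)" for x
    proof -
      have m: "(\<lambda>y. ennreal (?N x y)) \<in> borel_measurable lebesgue"
        by (intro borel_imp_leb) measurable
      show ?thesis
        using e by (simp add: mult.assoc[symmetric] nn_integral_cmult[OF m] nn_integral_normal)
    qed
    then show ?thesis
      by (simp add: L2_norm_sq_def nn_integral_cmult)
  qed
  also have "\<dots> = ennreal (2 * pi) * L2_norm_sq f"
    by (simp add: distrib_right[symmetric] flip: ennreal_plus)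
  finally show ?thesis .
qed

text \<open>
  Fatou's lemma removes the Gaussian weight.
\<close>

lemma bessel:
  assumes f: "f \<in> L2" "integrable lebesgue f"
  shows "L2_norm_sq (fourier_integral f) \<le> ennreal (2 * pi) * L2_norm_sq f"
proof -
  have [measurable]: "f \<in> borel_measurable lebesgue" using f by auto
  have "L2_norm_sq (fourier_integral f) = (\<integral>\<^sup>+ \<xi>. liminf (\<lambda>n. ennreal ((cmod (fourier_integral f \<xi>))\<^sup>2 * exp (- (1 / Suc n) * \<xi>\<^sup>2))) \<partial>lebesgue)"
    unfolding L2_norm_sq_def
  proof (rule nn_integral_cong)
    fix \<xi>
    have "(\<lambda>n. (cmod (fourier_integral f \<xi>))\<^sup>2 * exp (- (1 / Suc n) * \<xi>\<^sup>2)) \<longlonglongrightarrow> (cmod (fourier_integral f \<xi>))\<^sup>2 * exp (- 0 * \<xi>\<^sup>2)"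
      by (intro tendsto_intros LIMSEQ_Suc[OF lim_1_over_n])
    then have "(\<lambda>n. ennreal ((cmod (fourier_integral f \<xi>))\<^sup>2 * exp (- (1 / Suc n) * \<xi>\<^sup>2))) \<longlonglongrightarrow> ennreal ((cmod (fourier_integral f \<xi>))\<^sup>2)"
      by (intro tendsto_ennrealI) simp
    from lim_imp_Liminf[OF _ this]
    show "ennreal ((cmod (fourier_integral f \<xi>))\<^sup>2) = liminf (\<lambda>n. ennreal ((cmod (fourier_integral f \<xi>))\<^sup>2 * exp (- (1 / Suc n) * \<xi>\<^sup>2)))"
      by simp
  qed
  also have "\<dots> \<le> liminf (\<lambda>n. \<integral>\<^sup>+ \<xi>. ennreal ((cmod (fourier_integral f \<xi>))\<^sup>2 * exp (- (1 / Suc n) * \<xi>\<^sup>2)) \<partial>lebesgue)"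
    by (rule nn_integral_liminf) measurable
  also have "\<dots> \<le> liminf (\<lambda>n. ennreal (2 * pi) * L2_norm_sq f)"
    by (intro Liminf_mono always_eventually allI bessel_gaussian f) simp
  finally show ?thesis by (simp add: Liminf_const)
qed

section \<open>The Fourier transform of square-integrable functions\<close>

text \<open>
  The Riesz-Fischer argument for a rapidly Cauchy sequence. The rate \<open>8\<^sup>-\<^sup>n\<close> leaves room for the weights \<open>2\<^sup>n\<close>
  below, which force pointwise geometric convergence almost everywhere; Fatou's lemma then bounds the distance
  to the limit.
\<close>

lemma L2_complete:
  fixes h :: "nat \<Rightarrow> real \<Rightarrow> complex"
  assumes h: "\<And>n. h n \<in> L2"
    and d: "\<And>n m. n \<le> m \<Longrightarrow> L2_norm_sq (\<lambda>x. h m x - h n x) \<le> ennreal ((1 / 8) ^ n)"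
  shows "\<exists>g\<in>L2. \<forall>n. L2_norm_sq (\<lambda>x. g x - h n x) \<le> ennreal ((1 / 8) ^ n)"
proof -
  have [measurable]: "h n \<in> borel_measurable lebesgue" for n using h by auto
  define S where "S x = (\<Sum>n. ennreal (2 ^ n * (cmod (h (Suc n) x - h n x))\<^sup>2))" for x
  have "(\<integral>\<^sup>+ x. S x \<partial>lebesgue) = (\<Sum>n. \<integral>\<^sup>+ x. ennreal (2 ^ n * (cmod (h (Suc n) x - h n x))\<^sup>2) \<partial>lebesgue)"
    unfolding S_def by (rule nn_integral_suminf) measurable
  also have "\<dots> = (\<Sum>n. ennreal (2 ^ n) * L2_norm_sq (\<lambda>x. h (Suc n) x - h n x))"
    by (simp add: L2_norm_sq_def ennreal_mult nn_integral_cmult)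
  also have "\<dots> \<le> (\<Sum>n. ennreal (2 ^ n) * ennreal ((1 / 8) ^ n))"
    by (intro suminf_le mult_left_mono d summableI) auto
  also have "\<dots> = (\<Sum>n. ennreal ((1 / 4) ^ n))"
    by (simp add: ennreal_mult[symmetric] power_mult_distrib[symmetric])
  also have "\<dots> = ennreal (\<Sum>n. (1 / 4) ^ n)"
    by (rule suminf_ennreal2) (auto intro: summable_geometric)
  finally have "(\<integral>\<^sup>+ x. S x \<partial>lebesgue) \<noteq> \<infinity>"
    by (auto simp: top_unique)
  moreover have "S \<in> borel_measurable lebesgue" unfolding S_def by measurable
  ultimately have "AE x in lebesgue. S x \<noteq> \<infinity>" by (intro nn_integral_PInf_AE)
  then have conv: "AE x in lebesgue. convergent (\<lambda>n. h n x)"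
  proof eventually_elim
    fix x assume "S x \<noteq> \<infinity>"
    then obtain C where C: "C \<ge> 0" "S x = ennreal C" by (cases "S x") auto
    have le: "2 ^ n * (cmod (h (Suc n) x - h n x))\<^sup>2 \<le> C" for n
    proof -
      have "ennreal (2 ^ n * (cmod (h (Suc n) x - h n x))\<^sup>2)
          = (\<Sum>i\<in>{n}. ennreal (2 ^ i * (cmod (h (Suc i) x - h i x))\<^sup>2))" by simp
      also have "\<dots> \<le> S x" unfolding S_def by (rule sum_le_suminf) auto
      finally have "ennreal (2 ^ n * (cmod (h (Suc n) x - h n x))\<^sup>2) \<le> ennreal C" by (simp only: C)
      then show ?thesis using C(1) by (simp only: ennreal_le_iff)
    qed
    have "summable (\<lambda>n. h (Suc n) x - h n x)"
    proof (rule summable_comparison_test')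
      show "summable (\<lambda>n. sqrt C * (1 / sqrt 2) ^ n)"
        by (intro summable_mult summable_geometric) simp
      show "norm (h (Suc n) x - h n x) \<le> sqrt C * (1 / sqrt 2) ^ n" for n
      proof (rule power2_le_imp_le)
        have "((1 / sqrt 2) ^ n)\<^sup>2 = ((1 / sqrt 2 :: real)\<^sup>2) ^ n"
          by (simp only: power_mult[symmetric] mult.commute)
        also have "(1 / sqrt 2 :: real)\<^sup>2 = 1 / 2" by (simp add: power_divide)
        finally have "(sqrt C * (1 / sqrt 2) ^ n)\<^sup>2 = C * (1 / 2) ^ n"
          using C by (simp only: power_mult_distrib real_sqrt_pow2)
        then show "(norm (h (Suc n) x - h n x))\<^sup>2 \<le> (sqrt C * (1 / sqrt 2) ^ n)\<^sup>2"
          using le[of n] by (simp only:) (simp add: field_simps)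
      qed (use C in auto)
    qed
    then have "convergent (\<lambda>n. \<Sum>i<n. h (Suc i) x - h i x)" by (simp add: summable_iff_convergent)
    moreover have "(\<lambda>n. \<Sum>i<n. h (Suc i) x - h i x) = (\<lambda>n. h n x - h 0 x)"
      by (rule ext) (rule sum_lessThan_telescope)
    ultimately have "convergent (\<lambda>n. (h n x - h 0 x) + h 0 x)"
      by (intro convergent_add convergent_const) simp
    then show "convergent (\<lambda>n. h n x)" by simp
  qed
  define g where "g x = lim (\<lambda>n. h n x)" for x
  have [measurable]: "g \<in> borel_measurable lebesgue" unfolding g_def by (rule borel_measurable_lim_metric) simp
  have bound: "L2_norm_sq (\<lambda>x. g x - h n x) \<le> liminf (\<lambda>m. L2_norm_sq (\<lambda>x. h m x - h n x))" for n
  proof -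
    have "L2_norm_sq (\<lambda>x. g x - h n x) = (\<integral>\<^sup>+ x. liminf (\<lambda>m. ennreal ((cmod (h m x - h n x))\<^sup>2)) \<partial>lebesgue)"
      unfolding L2_norm_sq_def
    proof (rule nn_integral_cong_AE)
      show "AE x in lebesgue. ennreal ((cmod (g x - h n x))\<^sup>2) = liminf (\<lambda>m. ennreal ((cmod (h m x - h n x))\<^sup>2))"
        using conv
      proof eventually_elim
        fix x assume "convergent (\<lambda>n. h n x)"
        then have "(\<lambda>m. h m x) \<longlonglongrightarrow> g x" unfolding g_def by (rule convergent_LIMSEQ_iff[THEN iffD1])
        then have "(\<lambda>m. ennreal ((cmod (h m x - h n x))\<^sup>2)) \<longlonglongrightarrow> ennreal ((cmod (g x - h n x))\<^sup>2)"
          by (intro tendsto_intros tendsto_ennrealI)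
        from lim_imp_Liminf[OF _ this]
        show "ennreal ((cmod (g x - h n x))\<^sup>2) = liminf (\<lambda>m. ennreal ((cmod (h m x - h n x))\<^sup>2))" by simp
      qed
    qed
    also have "\<dots> \<le> liminf (\<lambda>m. L2_norm_sq (\<lambda>x. h m x - h n x))"
      unfolding L2_norm_sq_def by (rule nn_integral_liminf) measurable
    finally show ?thesis .
  qed
  have le: "L2_norm_sq (\<lambda>x. g x - h n x) \<le> ennreal ((1 / 8) ^ n)" for n
  proof -
    have "liminf (\<lambda>m. L2_norm_sq (\<lambda>x. h m x - h n x)) \<le> liminf (\<lambda>m. ennreal ((1 / 8) ^ n))"
      by (rule Liminf_mono) (use d in \<open>auto simp: eventually_sequentially\<close>)
    then show ?thesis using bound[of n] by (simp add: Liminf_const)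
  qed
  have "(\<lambda>x. g x - h 0 x) \<in> L2"
    using le[of 0] by (auto simp: L2_def intro: order.strict_trans1)
  from L2_add[OF this h[of 0]] have "g \<in> L2" by simp
  with le show ?thesis by blast
qed

lemma L2_cutoff: "f \<in> L2 \<Longrightarrow> (\<lambda>x. indicator {-R..R} x * f x) \<in> L2"
  by (rule L2_dominated[of f]) (auto split: split_indicator)

lemma L2_bounded_interval: "(indicator {a..b} :: real \<Rightarrow> complex) \<in> L2"
proof -
  have "L2_norm_sq (indicator {a..b}) = (\<integral>\<^sup>+ x. indicator {a..b} x \<partial>lebesgue)"
    unfolding L2_norm_sq_def by (intro nn_integral_cong) (auto split: split_indicator)
  also have "\<dots> < \<infinity>" by (cases "a \<le> b") auto
  finally show ?thesis by (simp add: L2_def)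
qed

lemma L2_cutoff_integrable:
  assumes "f \<in> L2" shows "integrable lebesgue (\<lambda>x. indicator {-R..R} x * f x)"
  by (rule L2_mult_integrable[OF L2_bounded_interval assms])

lemma fourier_trunc_eq_fourier_integral: "fourier_trunc R f = fourier_integral (\<lambda>x. indicator {-R..R} x * f x)"
  unfolding fourier_trunc_def fourier_integral_def set_lebesgue_integral_def
  by (intro ext Bochner_Integration.integral_cong) (auto split: split_indicator)

lemma fourier_integral_diff:
  assumes "integrable lebesgue f" "integrable lebesgue g"
  shows "fourier_integral (\<lambda>x. f x - g x) \<xi> = fourier_integral f \<xi> - fourier_integral g \<xi>"
  unfolding fourier_integral_def right_diff_distrib
  by (rule Bochner_Integration.integral_diff) (intro integrable_cis_mult assms; measurable)+

lemma L2_tail_tendsto: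
  assumes f: "f \<in> L2"
  shows "((\<lambda>R. L2_norm_sq (\<lambda>x. f x - indicator {-R..R} x * f x)) \<longlongrightarrow> 0) at_top"
proof (rule tendsto_at_topI_sequentially)
  fix X :: "nat \<Rightarrow> real" assume X: "filterlim X at_top sequentially"
  have [measurable]: "f \<in> borel_measurable lebesgue" using f by auto
  have "(\<lambda>n. \<integral>\<^sup>+ x. ennreal ((cmod (f x - indicator {-X n..X n} x * f x))\<^sup>2) \<partial>lebesgue)
      \<longlonglongrightarrow> (\<integral>\<^sup>+ x. 0 \<partial>(lebesgue :: real measure))"
  proof (rule nn_integral_dominated_convergence[where w = "\<lambda>x. ennreal ((cmod (f x))\<^sup>2)"])
    show "(\<integral>\<^sup>+ x. ennreal ((cmod (f x))\<^sup>2) \<partial>lebesgue) < \<infinity>" using f by (simp add: L2_def L2_norm_sq_def)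
    show "AE x in lebesgue. (\<lambda>n. ennreal ((cmod (f x - indicator {-X n..X n} x * f x))\<^sup>2)) \<longlonglongrightarrow> 0"
    proof (rule AE_I2)
      fix x
      have "eventually (\<lambda>n. \<bar>x\<bar> \<le> X n) sequentially" using X by (auto simp: filterlim_at_top)
      then have "eventually (\<lambda>n. ennreal ((cmod (f x - indicator {-X n..X n} x * f x))\<^sup>2) = 0) sequentially"
        by eventually_elim (auto split: split_indicator)
      then show "(\<lambda>n. ennreal ((cmod (f x - indicator {-X n..X n} x * f x))\<^sup>2)) \<longlonglongrightarrow> 0"
        by (rule tendsto_eventually)
    qed
  qed (auto split: split_indicator)
  then show "(\<lambda>n. L2_norm_sq (\<lambda>x. f x - indicator {-X n..X n} x * f x)) \<longlonglongrightarrow> 0"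
    by (simp add: L2_norm_sq_def)
qed

lemma fourier_trunc_L2:
  assumes "f \<in> L2" shows "fourier_trunc R f \<in> L2"
proof -
  have "L2_norm_sq (fourier_integral (\<lambda>x. indicator {-R..R} x * f x))
      \<le> ennreal (2 * pi) * L2_norm_sq (\<lambda>x. indicator {-R..R} x * f x)"
    by (rule bessel[OF L2_cutoff L2_cutoff_integrable]) (rule assms)+
  also have "\<dots> < \<infinity>"
    using L2_finite[OF L2_cutoff[OF assms, of R]] by (auto simp: ennreal_mult_less_top)
  finally have "L2_norm_sq (fourier_integral (\<lambda>x. indicator {-R..R} x * f x)) < \<infinity>" .
  moreover have "(\<lambda>x. indicator {-R..R} x * f x) \<in> borel_measurable lebesgue"
    using L2_cutoff[OF assms] by auto
  ultimately show ?thesis unfolding fourier_trunc_eq_fourier_integral by (simp add: L2_def fourier_integral_measurable)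
qed

lemma fourier_trunc_diff_le:
  assumes f: "f \<in> L2" and ab: "a \<le> b"
  shows "L2_norm_sq (\<lambda>\<xi>. fourier_trunc b f \<xi> - fourier_trunc a f \<xi>)
    \<le> ennreal (2 * pi) * L2_norm_sq (\<lambda>x. f x - indicator {-a..a} x * f x)"
proof -
  let ?d = "\<lambda>x. indicator {-b..b} x * f x - indicator {-a..a} x * f x"
  have "fourier_trunc b f \<xi> - fourier_trunc a f \<xi> = fourier_integral ?d \<xi>" for \<xi>
    unfolding fourier_trunc_eq_fourier_integral by (rule fourier_integral_diff[symmetric]) (rule L2_cutoff_integrable[OF f])+
  then have "L2_norm_sq (\<lambda>\<xi>. fourier_trunc b f \<xi> - fourier_trunc a f \<xi>) = L2_norm_sq (fourier_integral ?d)"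
    by simp
  also have "\<dots> \<le> ennreal (2 * pi) * L2_norm_sq ?d"
    by (intro bessel L2_diff L2_cutoff Bochner_Integration.integrable_diff L2_cutoff_integrable f)
  also have "L2_norm_sq ?d \<le> L2_norm_sq (\<lambda>x. f x - indicator {-a..a} x * f x)"
    unfolding L2_norm_sq_def using ab
    by (intro nn_integral_mono) (auto split: split_indicator intro!: ennreal_leI power_mono)
  finally show ?thesis by (simp add: mult_left_mono)
qed

lemma L2_norm_sq_commute: "L2_norm_sq (\<lambda>x. f x - g x) = L2_norm_sq (\<lambda>x. g x - f x)"
  by (rule L2_norm_sq_cong_norm) (simp add: norm_minus_commute)

text \<open>
  By Bessel's inequality the truncated transforms are Cauchy at the rate of the tails of \<open>f\<close>; they
  converge along a sequence of radii with rapidly decreasing tails, and the same estimate passes to all radii.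
\<close>

lemma fourier_L2_exists:
  assumes f: "f \<in> L2"
  shows "\<exists>g. g \<in> L2 \<and> ((\<lambda>R. L2_norm_sq (\<lambda>\<xi>. g \<xi> - fourier_trunc R f \<xi>)) \<longlongrightarrow> 0) at_top"
proof -
  define T where "T R = ennreal (2 * pi) * L2_norm_sq (\<lambda>x. f x - indicator {-R..R} x * f x)" for R
  have T0: "(T \<longlongrightarrow> 0) at_top"
    unfolding T_def using ennreal_tendsto_cmult[OF _ L2_tail_tendsto[OF f], of "ennreal (2 * pi)"] by simp
  have "\<exists>N. T N \<le> ennreal ((1 / 8) ^ n)" for n
  proof -
    have "eventually (\<lambda>R. T R < ennreal ((1 / 8) ^ n)) at_top"
      by (rule order_tendstoD(2)[OF T0]) simp
    then show ?thesis by (auto simp: eventually_at_top_linorder intro: less_imp_le)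
  qed
  then obtain N where N: "\<And>n. T (N n) \<le> ennreal ((1 / 8) ^ n)" by metis
  have close: "L2_norm_sq (\<lambda>\<xi>. fourier_trunc (N m) f \<xi> - fourier_trunc (N n) f \<xi>) \<le> ennreal ((1 / 8) ^ n)"
    if "n \<le> m" for n m
  proof (cases "N n \<le> N m")
    case True
    from fourier_trunc_diff_le[OF f this] N[of n] show ?thesis by (auto simp: T_def)
  next
    case False
    then have "N m \<le> N n" by simp
    have "L2_norm_sq (\<lambda>\<xi>. fourier_trunc (N m) f \<xi> - fourier_trunc (N n) f \<xi>) \<le> T (N m)"
      unfolding T_def L2_norm_sq_commute[of "fourier_trunc (N m) f"]
      by (rule fourier_trunc_diff_le[OF f \<open>N m \<le> N n\<close>])
    also have "\<dots> \<le> ennreal ((1 / 8) ^ m)" by (rule N)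
    also have "\<dots> \<le> ennreal ((1 / 8) ^ n)" by (intro ennreal_leI power_decreasing that) auto
    finally show ?thesis .
  qed
  obtain g where g: "g \<in> L2" "\<And>n. L2_norm_sq (\<lambda>x. g x - fourier_trunc (N n) f x) \<le> ennreal ((1 / 8) ^ n)"
    using L2_complete[of "\<lambda>n. fourier_trunc (N n) f", OF fourier_trunc_L2[OF f] close] by blast
  have "((\<lambda>R. L2_norm_sq (\<lambda>\<xi>. g \<xi> - fourier_trunc R f \<xi>)) \<longlongrightarrow> 0) at_top"
  proof (rule order_tendstoI)
    fix e :: ennreal assume "0 < e"
    have "(\<lambda>n. ennreal (4 * (1 / 8) ^ n)) \<longlonglongrightarrow> ennreal (4 * 0)"
      by (intro tendsto_ennrealI tendsto_mult tendsto_const LIMSEQ_power_zero) simp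
    then have "eventually (\<lambda>n. ennreal (4 * (1 / 8) ^ n) < e) sequentially"
      using \<open>0 < e\<close> by (intro order_tendstoD) auto
    then obtain n where n: "ennreal (4 * (1 / 8) ^ n) < e" by (auto simp: eventually_sequentially)
    show "eventually (\<lambda>R. L2_norm_sq (\<lambda>\<xi>. g \<xi> - fourier_trunc R f \<xi>) < e) at_top"
    proof (rule eventually_at_top_linorderI)
      fix R assume R: "N n \<le> R"
      have "L2_norm_sq (\<lambda>\<xi>. g \<xi> - fourier_trunc R f \<xi>)
          = L2_norm_sq (\<lambda>\<xi>. (g \<xi> - fourier_trunc (N n) f \<xi>) - (fourier_trunc R f \<xi> - fourier_trunc (N n) f \<xi>))"
        by simp
      also have "\<dots> \<le> 2 * L2_norm_sq (\<lambda>\<xi>. g \<xi> - fourier_trunc (N n) f \<xi>)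
          + 2 * L2_norm_sq (\<lambda>\<xi>. fourier_trunc R f \<xi> - fourier_trunc (N n) f \<xi>)"
        by (rule L2_norm_sq_diff; intro L2_measurable L2_diff g fourier_trunc_L2 f)
      also have "\<dots> \<le> 2 * ennreal ((1 / 8) ^ n) + 2 * ennreal ((1 / 8) ^ n)"
        using fourier_trunc_diff_le[OF f R] N[of n]
        by (intro add_mono mult_left_mono g) (auto simp: T_def)
      also have "\<dots> = ennreal (4 * (1 / 8) ^ n)"
        by (simp add: ennreal_mult distrib_right[symmetric])
      finally show "L2_norm_sq (\<lambda>\<xi>. g \<xi> - fourier_trunc R f \<xi>) < e" using n by simp
    qed
  qed simp
  with g show ?thesis by blast
qed

lemma fourier_L2:
  assumes "f \<in> L2"
  shows fourier_L2_in_L2: "fourier_L2 f \<in> L2"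
    and fourier_L2_tendsto: "((\<lambda>R. L2_norm_sq (\<lambda>\<xi>. fourier_L2 f \<xi> - fourier_trunc R f \<xi>)) \<longlongrightarrow> 0) at_top"
  using someI_ex[OF fourier_L2_exists[OF assms]] unfolding fourier_L2_def by auto

text \<open>
  Norm convergence in \<open>L\<^sup>2\<close> implies weak convergence.
\<close>

lemma L2_integral_tendsto:
  fixes u' :: "nat \<Rightarrow> real \<Rightarrow> complex"
  assumes u: "u \<in> L2" "\<And>n. u' n \<in> L2" and k: "k \<in> L2"
    and lim: "(\<lambda>n. L2_norm_sq (\<lambda>x. u x - u' n x)) \<longlonglongrightarrow> 0"
  shows "(\<lambda>n. LINT x|lebesgue. u' n x * k x) \<longlonglongrightarrow> (LINT x|lebesgue. u x * k x)"
proof -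
  let ?D = "\<lambda>n. (LINT x|lebesgue. u x * k x) - (LINT x|lebesgue. u' n x * k x)"
  have le: "ennreal ((cmod (?D n))\<^sup>2) \<le> L2_norm_sq (\<lambda>x. u x - u' n x) * L2_norm_sq k" for n
  proof -
    have "?D n = (LINT x|lebesgue. (u x - u' n x) * k x)"
      unfolding left_diff_distrib
      by (rule Bochner_Integration.integral_diff[symmetric]; rule L2_mult_integrable; rule u k)
    then show ?thesis using L2_Cauchy_Schwarz[OF L2_diff[OF u(1) u(2)[of n]] k] by simp
  qed
  have "(\<lambda>n. L2_norm_sq (\<lambda>x. u x - u' n x) * L2_norm_sq k) \<longlonglongrightarrow> 0 * L2_norm_sq k"
    by (rule tendsto_mult_ennreal[OF lim tendsto_const]) (use L2_finite[OF k] in auto)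
  then have "(\<lambda>n. L2_norm_sq (\<lambda>x. u x - u' n x) * L2_norm_sq k) \<longlonglongrightarrow> 0" by simp
  then have "(\<lambda>n. ennreal ((cmod (?D n))\<^sup>2)) \<longlonglongrightarrow> 0"
    by (rule tendsto_sandwich[OF _ _ tendsto_const, rotated 2]) (auto intro!: always_eventually le)
  then have "(\<lambda>n. ennreal ((cmod (?D n))\<^sup>2)) \<longlonglongrightarrow> ennreal 0" by simp
  then have "(\<lambda>n. (cmod (?D n))\<^sup>2) \<longlonglongrightarrow> 0"
    by (subst (asm) tendsto_ennreal_iff) (auto intro!: always_eventually)
  then have "(\<lambda>n. sqrt ((cmod (?D n))\<^sup>2)) \<longlonglongrightarrow> sqrt 0" by (rule tendsto_real_sqrt)
  then have "?D \<longlonglongrightarrow> 0" by (simp add: tendsto_norm_zero_iff)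
  then have "(\<lambda>n. (LINT x|lebesgue. u x * k x) - ?D n) \<longlonglongrightarrow> (LINT x|lebesgue. u x * k x) - 0"
    by (intro tendsto_diff tendsto_const)
  then show ?thesis by simp
qed

lemma fourier_integral_L2:
  assumes "k \<in> L2" "integrable lebesgue k"
  shows "fourier_integral k \<in> L2"
proof -
  have "L2_norm_sq (fourier_integral k) < \<infinity>"
    using bessel[OF assms] L2_finite[OF assms(1)]
    by (auto elim!: order.strict_trans1 simp: ennreal_mult_less_top)
  then show ?thesis using assms by (auto simp: L2_def intro: fourier_integral_measurable)
qed

text \<open>
  Both sides are limits of the multiplication formula for the truncations of \<open>f\<close>, by weak convergence.
\<close>

lemma fourier_L2_mult_swap:
  assumes f: "f \<in> L2" and k: "k \<in> L2" "integrable lebesgue k"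
  shows "(LINT \<xi>|lebesgue. fourier_L2 f \<xi> * k \<xi>) = (LINT x|lebesgue. f x * fourier_integral k x)"
proof (rule LIMSEQ_unique)
  have "(\<lambda>n. L2_norm_sq (\<lambda>x. f x - indicator {- real n..real n} x * f x)) \<longlonglongrightarrow> 0"
    using filterlim_compose[OF L2_tail_tendsto[OF f] filterlim_real_sequentially] .
  from L2_integral_tendsto[OF f L2_cutoff[OF f] fourier_integral_L2[OF k] this]
  show "(\<lambda>n. LINT x|lebesgue. indicator {- real n..real n} x * f x * fourier_integral k x) \<longlonglongrightarrow> (LINT x|lebesgue. f x * fourier_integral k x)" .
  have "(\<lambda>n. L2_norm_sq (\<lambda>\<xi>. fourier_L2 f \<xi> - fourier_trunc (real n) f \<xi>)) \<longlonglongrightarrow> 0"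
    using filterlim_compose[OF fourier_L2_tendsto[OF f] filterlim_real_sequentially] .
  from L2_integral_tendsto[OF fourier_L2_in_L2[OF f] fourier_trunc_L2[OF f] k(1) this]
  show "(\<lambda>n. LINT x|lebesgue. indicator {- real n..real n} x * f x * fourier_integral k x) \<longlonglongrightarrow> (LINT \<xi>|lebesgue. fourier_L2 f \<xi> * k \<xi>)"
    unfolding fourier_trunc_eq_fourier_integral using fourier_integral_mult_swap[OF L2_cutoff_integrable[OF f] k(2)] by simp
qed

section \<open>Injectivity and inversion\<close>

text \<open>
  The positive and the negative part of \<open>v\<close> have the same Fourier transform, in particular the same mass. Unless
  both vanish, they normalise to probability densities with equal characteristic functions, which agree by
  Levy's uniqueness theorem.
\<close>

lemma fourier_zero_real:
  fixes v :: "real \<Rightarrow> real"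
  assumes v: "integrable lebesgue v"
    and z: "\<And>b. (LINT x|lebesgue. cis (b * x) * of_real (v x)) = 0"
  shows "AE x in lebesgue. v x = 0"
proof -
  from v have "v \<in> borel_measurable lebesgue" by auto
  then obtain w where w [measurable]: "w \<in> borel_measurable lborel" and vw: "AE x in lborel. v x = w x"
    using completion_ex_borel_measurable_real by blast
  have vw': "AE x in lebesgue. v x = w x" using vw by (rule AE_completion)
  have wm: "w \<in> borel_measurable lebesgue" using w by (intro borel_imp_leb) simp
  have wi: "integrable lborel w"
    using integrable_cong_AE[OF \<open>v \<in> _\<close> wm vw'] v integrable_completion[OF w] by simp
  have wz: "(LINT x|lborel. cis (b * x) * of_real (w x)) = 0" for b
  proof -
    have "(LINT x|lborel. cis (b * x) * of_real (w x)) = (LINT x|lebesgue. cis (b * x) * of_real (w x))"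
      by (rule integral_completion[symmetric]) measurable
    also have "\<dots> = (LINT x|lebesgue. cis (b * x) * of_real (v x))"
      using vw' wm \<open>v \<in> _\<close> by (intro integral_cong_AE) auto
    finally show ?thesis using z by simp
  qed
  define p where "p x = max 0 (w x)" for x
  define n where "n x = max 0 (- w x)" for x
  have [measurable]: "p \<in> borel_measurable borel" "n \<in> borel_measurable borel"
    using w unfolding p_def n_def by auto
  have pn: "p x \<ge> 0" "n x \<ge> 0" "w x = p x - n x" for x by (auto simp: p_def n_def)
  have pi: "integrable lborel p" and ni: "integrable lborel n"
    unfolding p_def n_def using wi by (auto intro!: integrable_max)
  have eqc: "(LINT x|lborel. cis (b * x) * of_real (p x)) = (LINT x|lborel. cis (b * x) * of_real (n x))" for b
  proof -
    have "(LINT x|lborel. cis (b * x) * of_real (p x)) - (LINT x|lborel. cis (b * x) * of_real (n x))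
       = (LINT x|lborel. cis (b * x) * of_real (p x) - cis (b * x) * of_real (n x))"
      by (rule Bochner_Integration.integral_diff[symmetric])
         (intro integrable_cis_mult integrable_of_real pi ni; measurable)+
    also have "\<dots> = (LINT x|lborel. cis (b * x) * of_real (w x))"
      by (simp add: pn right_diff_distrib)
    finally show ?thesis using wz by simp
  qed
  define c where "c = (LINT x|lborel. p x)"
  have "of_real c = (of_real (LINT x|lborel. n x) :: complex)"
    using eqc[of 0] by (simp add: c_def)
  then have cn: "(LINT x|lborel. n x) = c" by simp
  have "c \<ge> 0" unfolding c_def by (rule Bochner_Integration.integral_nonneg) (simp add: pn)
  have "AE x in lborel. p x = n x"
  proof (cases "c = 0")
    case True
    have "AE x in lborel. p x = 0" "AE x in lborel. n x = 0"
      using integral_nonneg_eq_0_iff_AE[OF pi] integral_nonneg_eq_0_iff_AE[OF ni] True cn pn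
      by (auto simp: c_def)
    then show ?thesis by eventually_elim simp
  next
    case False
    with \<open>c \<ge> 0\<close> have c: "c > 0" by simp
    define M where "M q = density lborel (\<lambda>x. ennreal (q x / c))" for q :: "real \<Rightarrow> real"
    have dist: "real_distribution (M q)"
      if q: "integrable lborel q" "(LINT x|lborel. q x) = c" "\<And>x. q x \<ge> 0" for q
    proof -
      have [measurable]: "q \<in> borel_measurable lborel" using q by auto
      have "emeasure (M q) (space (M q)) = (\<integral>\<^sup>+ x. ennreal (q x / c) \<partial>lborel)"
        by (simp add: M_def emeasure_density)
      also have "\<dots> = ennreal (LINT x|lborel. q x / c)"
        using q c by (intro nn_integral_eq_integral) auto
      also have "\<dots> = 1" using q c by simp
      finally have "prob_space (M q)" by (rule prob_spaceI)
      then show ?thesis by (simp add: real_distribution_def real_distribution_axioms_def M_def)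
    qed
    have ch: "char (M q) t = (1 / of_real c) * (LINT x|lborel. cis (t * x) * of_real (q x))"
      if q: "integrable lborel q" "\<And>x. q x \<ge> 0" for q t
    proof -
      have [measurable]: "q \<in> borel_measurable lborel" using q by auto
      have "char (M q) t = (LINT x|lborel. (q x / c) *\<^sub>R iexp (t * x))"
        unfolding char_def M_def using q c
        by (intro integral_density) (auto simp: cis_conv_exp[symmetric])
      also have "\<dots> = (LINT x|lborel. (1 / of_real c) * (cis (t * x) * of_real (q x)))"
        by (simp add: cis_conv_exp scaleR_conv_of_real mult_ac)
      finally show ?thesis by (simp only: integral_mult_right_zero)
    qed
    have "M p = M n"
      using pi ni pn cn by (intro Levy_uniqueness dist ext) (auto simp: c_def ch eqc)
    then have "AE x in lborel. ennreal (p x / c) = ennreal (n x / c)"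
      unfolding M_def by (intro sigma_finite_measure.density_unique[OF sigma_finite_lborel]) auto
    then show ?thesis using c pn by (auto elim!: eventually_mono simp: divide_right_mono)
  qed
  then have "AE x in lborel. v x = 0" using vw by eventually_elim (simp add: pn)
  then show ?thesis by (rule AE_completion)
qed

lemma fourier_zero:
  fixes v :: "real \<Rightarrow> complex"
  assumes v: "integrable lebesgue v"
    and z: "\<And>b. (LINT x|lebesgue. cis (b * x) * v x) = 0"
  shows "AE x in lebesgue. v x = 0"
proof -
  have zc: "(LINT x|lebesgue. cis (b * x) * cnj (v x)) = 0" for b
  proof -
    have "(LINT x|lebesgue. cis (b * x) * cnj (v x)) = (LINT x|lebesgue. cnj (cis (- b * x) * v x))"
      by (simp add: cis_cnj)
    also have "\<dots> = cnj (LINT x|lebesgue. cis (- b * x) * v x)" by (rule Bochner_Integration.integral_cnj)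
    finally show ?thesis by (simp only: z complex_cnj_zero)
  qed
  have i: "integrable lebesgue (\<lambda>x. cis (b * x) * v x)" "integrable lebesgue (\<lambda>x. cis (b * x) * cnj (v x))" for b
    by (intro integrable_cis_mult integrable_cnj v; measurable)+
  have re: "AE x in lebesgue. Re (v x) = 0"
  proof (rule fourier_zero_real)
    show "integrable lebesgue (\<lambda>x. Re (v x))" using v by auto
    fix b
    have "(LINT x|lebesgue. cis (b * x) * of_real (Re (v x)))
      = (LINT x|lebesgue. (1 / 2) * (cis (b * x) * v x + cis (b * x) * cnj (v x)))"
      by (intro Bochner_Integration.integral_cong refl) (simp add: distrib_left[symmetric] complex_add_cnj)
    also have "\<dots> = 0"
      using i[of b] by (simp only: integral_mult_right_zero Bochner_Integration.integral_add z zc) simp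
    finally show "(LINT x|lebesgue. cis (b * x) * of_real (Re (v x))) = 0" .
  qed
  have im: "AE x in lebesgue. Im (v x) = 0"
  proof (rule fourier_zero_real)
    show "integrable lebesgue (\<lambda>x. Im (v x))" using v by auto
    fix b
    have "(LINT x|lebesgue. cis (b * x) * of_real (Im (v x)))
      = (LINT x|lebesgue. (1 / (2 * \<i>)) * (cis (b * x) * v x - cis (b * x) * cnj (v x)))"
    proof (intro Bochner_Integration.integral_cong refl)
      fix x
      have "v x - cnj (v x) = 2 * \<i> * of_real (Im (v x))" by (simp add: complex_eq_iff)
      then show "cis (b * x) * of_real (Im (v x)) = (1 / (2 * \<i>)) * (cis (b * x) * v x - cis (b * x) * cnj (v x))"
        by (simp add: right_diff_distrib[symmetric] mult.left_commute[of "cis (b * x)" \<i>])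
    qed
    also have "\<dots> = 0"
      using i[of b] by (simp only: integral_mult_right_zero Bochner_Integration.integral_diff z zc) simp
    finally show "(LINT x|lebesgue. cis (b * x) * of_real (Im (v x))) = 0" .
  qed
  from re im show ?thesis by eventually_elim (simp add: complex_eq_iff)
qed

definition modgauss :: "real \<Rightarrow> real \<Rightarrow> complex" where
  "modgauss b x = cis (b * x) * of_real (exp (- (1 / 2) * x\<^sup>2))"

text \<open>
  All explicit functions below are dominated by Gaussians, and this puts them in \<open>L\<^sup>1\<close> and \<open>L\<^sup>2\<close>.
\<close>

lemma L2_gaussian:
  fixes e :: real
  assumes "e > 0" and [measurable]: "f \<in> borel_measurable lebesgue"
    and "\<And>x. cmod (f x) \<le> c * exp (- e * (x - b)\<^sup>2)"
  shows "f \<in> L2" and "integrable lebesgue f"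
proof -
  have "L2_norm_sq f \<le> (\<integral>\<^sup>+ x. ennreal (cmod (of_real (c\<^sup>2) * of_real (exp (- (2 * e) * (x - b)\<^sup>2)))) \<partial>lebesgue)"
    unfolding L2_norm_sq_def
  proof (intro nn_integral_mono ennreal_leI)
    fix x
    have "(cmod (f x))\<^sup>2 \<le> (c * exp (- e * (x - b)\<^sup>2))\<^sup>2"
      by (intro power_mono assms) simp
    also have "\<dots> = c\<^sup>2 * exp (- (2 * e) * (x - b)\<^sup>2)"
      by (simp add: power_mult_distrib flip: exp_of_nat_mult)
    finally show "(cmod (f x))\<^sup>2 \<le> cmod (of_real (c\<^sup>2) * of_real (exp (- (2 * e) * (x - b)\<^sup>2)))"
      by (simp add: norm_mult norm_power)
  qed
  also have "\<dots> < \<infinity>"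
  proof -
    have "integrable lebesgue (\<lambda>x. of_real (c\<^sup>2) * (of_real (exp (- (2 * e) * (x - b)\<^sup>2)) :: complex))"
      by (intro integrable_mult_right integrable_lebesgue_gaussian) (use assms in simp)
    then show ?thesis by (simp only: integrable_iff_bounded)
  qed
  finally show "f \<in> L2" using assms by (simp add: L2_def)
  show "integrable lebesgue f"
  proof (rule Bochner_Integration.integrable_bound)
    show "integrable lebesgue (\<lambda>x. of_real c * (of_real (exp (- e * (x - b)\<^sup>2)) :: complex))"
      by (intro integrable_mult_right integrable_lebesgue_gaussian assms)
    show "AE x in lebesgue. cmod (f x) \<le> cmod (of_real c * (of_real (exp (- e * (x - b)\<^sup>2)) :: complex))"
    proof (rule AE_I2)
      fix x
      have "cmod (f x) \<le> c * exp (- e * (x - b)\<^sup>2)" by (rule assms)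
      also have "\<dots> \<le> cmod (of_real c * (of_real (exp (- e * (x - b)\<^sup>2)) :: complex))"
        by (simp add: norm_mult mult_right_mono)
      finally show "cmod (f x) \<le> cmod (of_real c * (of_real (exp (- e * (x - b)\<^sup>2)) :: complex))" .
    qed
  qed simp
qed

lemma modgauss_L2: "modgauss b \<in> L2" "integrable lebesgue (modgauss b)"
proof -
  have m: "modgauss b \<in> borel_measurable lebesgue" unfolding modgauss_def by measurable
  have "cmod (modgauss b x) \<le> 1 * exp (- (1 / 2) * (x - 0)\<^sup>2)" for x by (simp add: modgauss_def norm_mult)
  from L2_gaussian[OF _ m this] show "modgauss b \<in> L2" "integrable lebesgue (modgauss b)" by simp_all
qed

lemma normal_L2:
  "(\<lambda>x. of_real (normal_density b 1 x) :: complex) \<in> L2"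
  "integrable lebesgue (\<lambda>x. of_real (normal_density b 1 x) :: complex)"
proof -
  have m: "(\<lambda>x. of_real (normal_density b 1 x) :: complex) \<in> borel_measurable lebesgue"
    unfolding normal_density_def by measurable
  have "cmod (of_real (normal_density b 1 x) :: complex) \<le> (1 / sqrt (2 * pi)) * exp (- (1 / 2) * (x - b)\<^sup>2)" for x
    by (simp add: normal_density_def norm_divide)
  from L2_gaussian[OF _ m this]
  show "(\<lambda>x. of_real (normal_density b 1 x) :: complex) \<in> L2"
    "integrable lebesgue (\<lambda>x. of_real (normal_density b 1 x) :: complex)" by simp_all
qed

lemma fourier_integral_modgauss: "fourier_integral (modgauss b) x = 2 * of_real pi * of_real (normal_density b 1 x)"
  using fourier_integral_gaussian[of "1 / 2" b x] by (simp add: modgauss_def[abs_def])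

lemma fourier_integral_normal: "fourier_integral (\<lambda>x. of_real (normal_density b 1 x)) y = modgauss (- b) y"
proof -
  have "fourier_integral (\<lambda>x. of_real (normal_density b 1 x)) y = (LINT x|lborel. cis (- (x * y)) * of_real (normal_density b 1 x))"
    unfolding fourier_integral_def by (rule integral_completion) simp
  also have "\<dots> = \<bar>1\<bar> *\<^sub>R (LINT x|lborel. cis (- ((b + 1 * x) * y)) * of_real (normal_density b 1 (b + 1 * x)))"
    by (rule lborel_integral_real_affine) simp
  also have "\<dots> = (LINT x|lborel. cis (- b * y) * (cis (- y * x) * of_real (std_normal_density x)))"
  proof -
    have "cis (- ((b + 1 * x) * y)) = cis (- b * y) * cis (- y * x)" for x
      by (simp add: cis_mult algebra_simps)
    moreover have "normal_density b 1 (b + 1 * x) = std_normal_density x" for x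
      by (simp add: normal_density_def)
    ultimately show ?thesis by (simp only: mult.assoc) simp
  qed
  also have "\<dots> = cis (- b * y) * of_real (exp (- (- y)\<^sup>2 / 2))"
    by (simp only: integral_mult_right_zero integral_std_normal_cis)
  finally show ?thesis by (simp add: modgauss_def)
qed

text \<open>
  Modulated Gaussians of a fixed width are total in \<open>L\<^sup>2\<close>: multiplying the difference by the Gaussian gives an
  integrable function whose Fourier transform vanishes.
\<close>

lemma L2_eq_modgauss:
  assumes u: "u \<in> L2" "v \<in> L2"
    and eq: "\<And>b. (LINT x|lebesgue. u x * modgauss b x) = (LINT x|lebesgue. v x * modgauss b x)"
  shows "AE x in lebesgue. u x = v x"
proof -
  let ?w = "\<lambda>x. (u x - v x) * modgauss 0 x"
  have "AE x in lebesgue. ?w x = 0"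
  proof (rule fourier_zero)
    show "integrable lebesgue ?w" by (intro L2_mult_integrable L2_diff u modgauss_L2)
    fix b
    have "(LINT x|lebesgue. cis (b * x) * ?w x) = (LINT x|lebesgue. u x * modgauss b x - v x * modgauss b x)"
      by (intro Bochner_Integration.integral_cong refl) (simp add: modgauss_def algebra_simps)
    also have "\<dots> = (LINT x|lebesgue. u x * modgauss b x) - (LINT x|lebesgue. v x * modgauss b x)"
      by (intro Bochner_Integration.integral_diff L2_mult_integrable u modgauss_L2)
    finally show "(LINT x|lebesgue. cis (b * x) * ?w x) = 0" by (simp add: eq)
  qed
  then show ?thesis by eventually_elim (simp add: modgauss_def)
qed

text \<open>
  Moving the transform onto normal densities turns them into modulated Gaussians, which are total.
\<close>

lemma fourier_L2_inj:
  assumes f: "f \<in> L2" "g \<in> L2" and eq: "AE \<xi> in lebesgue. fourier_L2 f \<xi> = fourier_L2 g \<xi>"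
  shows "AE x in lebesgue. f x = g x"
proof (rule L2_eq_modgauss[OF f])
  fix b
  let ?k = "\<lambda>x. of_real (normal_density (- b) 1 x) :: complex"
  have [measurable]: "fourier_L2 f \<in> borel_measurable lebesgue" "fourier_L2 g \<in> borel_measurable lebesgue"
     "?k \<in> borel_measurable lebesgue"
    using f fourier_L2_in_L2 normal_L2 by auto
  have "(LINT x|lebesgue. f x * fourier_integral ?k x) = (LINT \<xi>|lebesgue. fourier_L2 f \<xi> * ?k \<xi>)"
    by (rule fourier_L2_mult_swap[symmetric]; intro f normal_L2)
  also have "\<dots> = (LINT \<xi>|lebesgue. fourier_L2 g \<xi> * ?k \<xi>)"
    by (rule integral_cong_AE) (use eq in auto)
  also have "\<dots> = (LINT x|lebesgue. g x * fourier_integral ?k x)"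
    by (rule fourier_L2_mult_swap; intro f normal_L2)
  finally show "(LINT x|lebesgue. f x * modgauss b x) = (LINT x|lebesgue. g x * modgauss b x)"
    by (simp add: fourier_integral_normal)
qed

text \<open>
  The inverse transform is written through conjugation, so that reflections of the line do not enter. Testing
  with a modulated Gaussian and moving the transform across twice returns the same Gaussian.
\<close>

lemma fourier_L2_inverse:
  assumes g: "g \<in> L2"
  defines "h \<equiv> \<lambda>x. of_real (1 / (2 * pi)) * cnj (fourier_L2 (\<lambda>x. cnj (g x)) x)"
  shows "h \<in> L2" and "AE \<xi> in lebesgue. fourier_L2 h \<xi> = g \<xi>"
proof -
  show h: "h \<in> L2" unfolding h_def by (intro L2_cmult L2_cnj fourier_L2_in_L2 g)
  show "AE \<xi> in lebesgue. fourier_L2 h \<xi> = g \<xi>"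
  proof (rule L2_eq_modgauss[OF fourier_L2_in_L2[OF h] g])
    fix b
    let ?k = "\<lambda>x. of_real (normal_density b 1 x) :: complex"
    have "(LINT \<xi>|lebesgue. fourier_L2 h \<xi> * modgauss b \<xi>) = (LINT x|lebesgue. h x * fourier_integral (modgauss b) x)"
      by (rule fourier_L2_mult_swap[OF h]; rule modgauss_L2)
    also have "\<dots> = (LINT x|lebesgue. cnj (fourier_L2 (\<lambda>x. cnj (g x)) x * ?k x))"
      by (intro Bochner_Integration.integral_cong refl) (simp add: fourier_integral_modgauss h_def)
    also have "\<dots> = cnj (LINT x|lebesgue. fourier_L2 (\<lambda>x. cnj (g x)) x * ?k x)"
      by (rule Bochner_Integration.integral_cnj)
    also have "(LINT x|lebesgue. fourier_L2 (\<lambda>x. cnj (g x)) x * ?k x) = (LINT x|lebesgue. cnj (g x) * fourier_integral ?k x)"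
      by (rule fourier_L2_mult_swap[OF L2_cnj[OF g]]; rule normal_L2)
    also have "cnj \<dots> = (LINT x|lebesgue. cnj (cnj (g x) * fourier_integral ?k x))"
      by (rule Bochner_Integration.integral_cnj[symmetric])
    also have "\<dots> = (LINT x|lebesgue. g x * modgauss b x)"
      by (intro Bochner_Integration.integral_cong refl) (simp add: fourier_integral_normal modgauss_def cis_cnj)
    finally show "(LINT \<xi>|lebesgue. fourier_L2 h \<xi> * modgauss b \<xi>) = (LINT x|lebesgue. g x * modgauss b x)" .
  qed
qed

section \<open>The Gaussian integral with a complex parameter\<close>

lemma norm_LINT_le:
  fixes f :: "'a \<Rightarrow> 'b::{banach, second_countable_topology}"
  assumes "integrable M f" "integrable M g" "\<And>x. norm (f x) \<le> g x"
  shows "norm (integral\<^sup>L M f) \<le> integral\<^sup>L M g"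
  using assms by (intro order_trans[OF integral_norm_bound] integral_mono integrable_norm)

definition gauss_symbol :: "complex \<Rightarrow> real \<Rightarrow> complex" where
  "gauss_symbol z \<xi> = exp (- (z * of_real (\<xi>\<^sup>2)))"

lemma gauss_symbol_measurable [measurable]: "gauss_symbol z \<in> borel_measurable borel"
  unfolding gauss_symbol_def by measurable

lemma norm_gauss_symbol [simp]: "cmod (gauss_symbol z \<xi>) = exp (- (Re z * \<xi>\<^sup>2))"
  by (simp add: gauss_symbol_def)

lemma gauss_symbol_shift: "gauss_symbol (z + \<i> * of_real t) \<xi> = cis (- (t * \<xi>\<^sup>2)) * gauss_symbol z \<xi>"
  by (simp add: gauss_symbol_def cis_conv_exp exp_add[symmetric] algebra_simps)

lemma cnj_gauss_symbol: "cnj (gauss_symbol z \<xi>) = gauss_symbol (cnj z) \<xi>"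
  by (simp add: gauss_symbol_def exp_cnj)

lemma gauss_symbol_of_real: "gauss_symbol (of_real e) \<xi> = of_real (exp (- e * \<xi>\<^sup>2))"
  by (simp add: gauss_symbol_def flip: exp_of_real)

lemma integrable_gaussian_moment:
  fixes e :: real
  assumes e: "e > 0" shows "integrable lborel (\<lambda>\<xi>. exp (- (e * \<xi>\<^sup>2)) * \<xi> ^ k)"
proof -
  have "integrable lborel (\<lambda>x. sqrt (pi / e) * (normal_density 0 (1 / sqrt (2 * e)) x * (x - 0) ^ k))"
    by (intro integrable_mult_right integrable_normal_moment) (use e in simp)
  moreover have "sqrt (pi / e) * (normal_density 0 (1 / sqrt (2 * e)) x * (x - 0) ^ k) = exp (- (e * x\<^sup>2)) * x ^ k" for x
  proof -
    have *: "(1 / sqrt (2 * e))\<^sup>2 = 1 / (2 * e)" using e by (simp add: power_divide)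
    show ?thesis unfolding normal_density_def * using e by (simp add: field_simps)
  qed
  ultimately show ?thesis by (simp only:)
qed

lemma integrable_gauss_symbol_moment:
  assumes "Re z > 0" shows "integrable lborel (\<lambda>\<xi>. of_real (\<xi> ^ k) * gauss_symbol z \<xi>)"
  by (rule Bochner_Integration.integrable_bound[OF integrable_gaussian_moment[OF assms, of k]])
     (auto simp: norm_mult norm_power power_abs abs_mult mult.commute)

lemma integrable_gauss_symbol: "Re z > 0 \<Longrightarrow> integrable lborel (gauss_symbol z)"
  using integrable_gauss_symbol_moment[of z 0] by simp

definition gauss_integral :: "complex \<Rightarrow> complex" where
  "gauss_integral z = (LINT \<xi>|lborel. gauss_symbol z \<xi>)"

text \<open>
  The difference of the two sides is the integral of the derivative of \<open>\<xi> exp (- z \<xi>\<^sup>2)\<close>, a function that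
  tends to zero at both ends.
\<close>

lemma gauss_integral_by_parts:
  assumes z: "Re z > 0"
  shows "2 * z * (LINT \<xi>|lborel. of_real (\<xi>\<^sup>2) * gauss_symbol z \<xi>) = gauss_integral z"
proof -
  let ?f = "\<lambda>\<xi>. gauss_symbol z \<xi> - 2 * z * (of_real (\<xi>\<^sup>2) * gauss_symbol z \<xi>)"
  let ?F = "\<lambda>\<xi>. of_real \<xi> * gauss_symbol z \<xi>"
  have i2: "integrable lborel (\<lambda>\<xi>. of_real (\<xi>\<^sup>2) * gauss_symbol z \<xi>)" by (rule integrable_gauss_symbol_moment[OF z])
  have fi: "integrable lborel ?f"
    by (intro Bochner_Integration.integrable_diff integrable_mult_right i2 integrable_gauss_symbol z)
  have deriv: "(?F has_vector_derivative ?f x) (at x within S)" for x S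
  proof -
    have "((\<lambda>w. w * exp (- (z * w\<^sup>2))) has_field_derivative ?f x) (at (of_real x))"
      by (auto intro!: derivative_eq_intros simp: gauss_symbol_def power2_eq_square algebra_simps)
    from has_vector_derivative_real_field[OF this]
    have "((\<lambda>t. of_real t * exp (- (z * (of_real t)\<^sup>2))) has_vector_derivative ?f x) (at x within S)" .
    then show ?thesis by (simp add: gauss_symbol_def)
  qed
  have FTC: "(LINT \<xi>|lborel. indicator {- real n..real n} \<xi> *\<^sub>R ?f \<xi>) = ?F (real n) - ?F (- real n)" for n
  proof (rule integral_FTC_atLeastAtMost)
    show "(?F has_vector_derivative ?f x) (at x within {- real n..real n})" for x by (rule deriv)
    show "continuous_on {- real n..real n} ?f" unfolding gauss_symbol_def by (intro continuous_intros)
  qed simp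
  have "(\<lambda>n. LINT \<xi>|lborel. indicator {- real n..real n} \<xi> *\<^sub>R ?f \<xi>) \<longlonglongrightarrow> (LINT \<xi>|lborel. ?f \<xi>)"
  proof (rule integral_dominated_convergence[where w = "\<lambda>\<xi>. norm (?f \<xi>)"])
    show "AE x in lborel. (\<lambda>n. indicator {- real n..real n} x *\<^sub>R ?f x) \<longlonglongrightarrow> ?f x"
    proof (rule AE_I2, rule tendsto_eventually)
      fix x
      have "eventually (\<lambda>n. \<bar>x\<bar> \<le> real n) sequentially"
        using filterlim_real_sequentially by (auto simp: filterlim_at_top)
      then show "eventually (\<lambda>n. indicator {- real n..real n} x *\<^sub>R ?f x = ?f x) sequentially"
        by eventually_elim (auto split: split_indicator)
    qed
  qed (use fi in \<open>auto split: split_indicator intro: integrable_norm\<close>)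
  moreover have "(\<lambda>n. ?F (real n) - ?F (- real n)) \<longlonglongrightarrow> 0"
  proof (rule Lim_null_comparison)
    show "\<forall>\<^sub>F n in sequentially. norm (?F (real n) - ?F (- real n)) \<le> 2 * (real n * exp (- (Re z * (real n)\<^sup>2)))"
    proof (intro always_eventually allI)
      fix n
      have "?F (real n) - ?F (- real n) = 2 * ?F (real n)" by (simp add: gauss_symbol_def)
      then show "norm (?F (real n) - ?F (- real n)) \<le> 2 * (real n * exp (- (Re z * (real n)\<^sup>2)))"
        by (simp only: norm_mult norm_gauss_symbol) simp
    qed
    show "(\<lambda>n. 2 * (real n * exp (- (Re z * (real n)\<^sup>2)))) \<longlonglongrightarrow> 0"
    proof (rule Lim_null_comparison)
      have "(\<lambda>n. 2 / Re z * (1 / real n)) \<longlonglongrightarrow> 2 / Re z * 0"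
        by (intro tendsto_mult tendsto_const lim_1_over_n)
      then show "(\<lambda>n. 2 / Re z * (1 / real n)) \<longlonglongrightarrow> 0" by simp
      show "\<forall>\<^sub>F n in sequentially. norm (2 * (real n * exp (- (Re z * (real n)\<^sup>2)))) \<le> 2 / Re z * (1 / real n)"
      proof (rule eventually_mono[OF eventually_gt_at_top[of 0]])
        fix n :: nat assume n: "0 < n"
        have "Re z * (real n)\<^sup>2 \<le> exp (Re z * (real n)\<^sup>2)" using exp_ge_add_one_self[of "Re z * (real n)\<^sup>2"] by linarith
        then have "exp (- (Re z * (real n)\<^sup>2)) \<le> 1 / (Re z * (real n)\<^sup>2)"
          using z n by (simp add: exp_minus field_simps)
        then have "real n * exp (- (Re z * (real n)\<^sup>2)) \<le> real n * (1 / (Re z * (real n)\<^sup>2))"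
          by (intro mult_left_mono) auto
        then show "norm (2 * (real n * exp (- (Re z * (real n)\<^sup>2)))) \<le> 2 / Re z * (1 / real n)"
          using z n by (simp add: power2_eq_square)
      qed
    qed
  qed
  ultimately have "(LINT \<xi>|lborel. ?f \<xi>) = 0" unfolding FTC by (rule LIMSEQ_unique)
  moreover have "(LINT \<xi>|lborel. ?f \<xi>) = gauss_integral z - 2 * z * (LINT \<xi>|lborel. of_real (\<xi>\<^sup>2) * gauss_symbol z \<xi>)"
    unfolding gauss_integral_def integral_mult_right_zero[symmetric]
    by (intro Bochner_Integration.integral_diff integrable_mult_right i2 integrable_gauss_symbol z)
  ultimately show ?thesis by simp
qed

text \<open>
  With the fourth moment of a Gaussian as the constant \<open>C\<close>, this replaces a limit under the integral sign.
\<close>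

lemma has_vector_derivative_quadratic_bound:
  fixes f :: "real \<Rightarrow> 'a::real_normed_vector"
  assumes "\<And>h. norm (f (t + h) - f t - h *\<^sub>R D) \<le> C * h\<^sup>2"
  shows "(f has_vector_derivative D) (at t)"
  unfolding has_vector_derivative_def has_derivative_at
proof (intro conjI bounded_linear_scaleR_left)
  show "(\<lambda>h. norm (f (t + h) - f t - h *\<^sub>R D) / norm h) \<midarrow>0\<rightarrow> 0"
  proof (rule Lim_null_comparison)
    show "(\<lambda>h. C * \<bar>h\<bar>) \<midarrow>0\<rightarrow> 0" by (auto intro!: tendsto_eq_intros)
    show "\<forall>\<^sub>F h in at 0. norm (norm (f (t + h) - f t - h *\<^sub>R D) / norm h) \<le> C * \<bar>h\<bar>"
    proof (rule eventually_mono[OF eventually_neq_at_within[of 0 0 UNIV]])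
      fix h :: real assume "h \<noteq> 0"
      then show "norm (norm (f (t + h) - f t - h *\<^sub>R D) / norm h) \<le> C * \<bar>h\<bar>"
        using assms[of h] by (simp add: divide_simps power2_eq_square mult.assoc)
    qed
  qed
qed

lemma gauss_integral_deriv:
  assumes e: "e > 0"
  shows "((\<lambda>t. gauss_integral (Complex e t)) has_vector_derivative
    - \<i> * (LINT \<xi>|lborel. of_real (\<xi>\<^sup>2) * gauss_symbol (Complex e t) \<xi>)) (at t)"
proof (rule has_vector_derivative_quadratic_bound)
  fix h :: real
  let ?D = "gauss_integral (Complex e (t + h)) - gauss_integral (Complex e t) - h *\<^sub>R (- \<i> * (LINT \<xi>|lborel. of_real (\<xi>\<^sup>2) * gauss_symbol (Complex e t) \<xi>))"
  let ?d = "\<lambda>\<xi>. gauss_symbol (Complex e (t + h)) \<xi> - gauss_symbol (Complex e t) \<xi> - (- (\<i> * of_real h)) * (of_real (\<xi>\<^sup>2) * gauss_symbol (Complex e t) \<xi>)"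
  have i2: "integrable lborel (\<lambda>\<xi>. of_real (\<xi>\<^sup>2) * gauss_symbol (Complex e t) \<xi>)"
    by (rule integrable_gauss_symbol_moment) (simp add: e)
  have i: "integrable lborel (gauss_symbol (Complex e s))" for s by (rule integrable_gauss_symbol) (simp add: e)
  have sh: "gauss_symbol (Complex e (t + h)) \<xi> = cis (- (h * \<xi>\<^sup>2)) * gauss_symbol (Complex e t) \<xi>" for \<xi>
  proof -
    have "Complex e (t + h) = Complex e t + \<i> * of_real h" by (simp add: complex_eq_iff)
    then show ?thesis by (simp only: gauss_symbol_shift)
  qed
  have eq: "?D
     = (LINT \<xi>|lborel. ?d \<xi>)"
    using i i2 by (simp add: gauss_integral_def scaleR_conv_of_real)
  have "norm (LINT \<xi>|lborel. ?d \<xi>)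
      \<le> (LINT \<xi>|lborel. h\<^sup>2 / 2 * (exp (- (e * \<xi>\<^sup>2)) * \<xi> ^ 4))"
  proof (rule norm_LINT_le)
    show "integrable lborel (\<lambda>\<xi>. ?d \<xi>)"
      by (intro Bochner_Integration.integrable_diff i integrable_mult_right i2)
    show "integrable lborel (\<lambda>\<xi>. h\<^sup>2 / 2 * (exp (- (e * \<xi>\<^sup>2)) * \<xi> ^ 4))"
      by (intro integrable_mult_right integrable_gaussian_moment e)
    fix \<xi> :: real
    have "?d \<xi>
      = gauss_symbol (Complex e t) \<xi> * (iexp (- (h * \<xi>\<^sup>2)) - (\<Sum>k\<le>1. (\<i> * of_real (- (h * \<xi>\<^sup>2))) ^ k / fact k))"
      unfolding sh by (simp add: cis_conv_exp algebra_simps)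
    also have "norm \<dots> \<le> exp (- (e * \<xi>\<^sup>2)) * (\<bar>- (h * \<xi>\<^sup>2)\<bar> ^ Suc 1 / fact (Suc 1))"
      unfolding norm_mult norm_gauss_symbol using iexp_approx1[of "- (h * \<xi>\<^sup>2)" 1]
      by (intro mult_mono) simp_all
    also have "\<dots> = h\<^sup>2 / 2 * (exp (- (e * \<xi>\<^sup>2)) * \<xi> ^ 4)"
      by (simp add: power2_eq_square power4_eq_xxxx)
    finally show "norm (?d \<xi>)
      \<le> h\<^sup>2 / 2 * (exp (- (e * \<xi>\<^sup>2)) * \<xi> ^ 4)" .
  qed
  then show "norm (?D)
      \<le> (LINT \<xi>|lborel. exp (- (e * \<xi>\<^sup>2)) * \<xi> ^ 4) / 2 * h\<^sup>2"
    unfolding eq by (simp add: mult.commute)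
qed

lemma gauss_integral_real:
  assumes "e > 0" shows "gauss_integral (of_real e) = of_real (sqrt (pi / e))"
proof -
  have "gauss_integral (of_real e) = fourier_integral (\<lambda>\<xi>. cis (0 * \<xi>) * of_real (exp (- e * \<xi>\<^sup>2))) 0"
    unfolding fourier_integral_def gauss_integral_def gauss_symbol_of_real
    by (subst integral_completion) (simp_all)
  also have "\<dots> = of_real (2 * pi * normal_density 0 (sqrt (2 * e)) 0)" by (rule fourier_integral_gaussian[OF assms])
  also have "2 * pi * normal_density 0 (sqrt (2 * e)) 0 = sqrt (pi / e)"
  proof -
    have "sqrt (2 * pi * (2 * e)) = 2 * (sqrt pi * sqrt e)"
      by (simp add: real_sqrt_mult[symmetric]) (metis real_sqrt_four real_sqrt_mult mult.assoc)
    then show ?thesis using assms by (simp add: normal_density_def real_sqrt_divide field_simps)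
  qed
  finally show ?thesis .
qed

text \<open>
  Along the vertical line through \<open>z\<close>, integration by parts shows that \<open>G(z)\<^sup>2 z\<close> has derivative zero, where \<open>G\<close>
  is the Gaussian integral; on the positive axis its value is \<open>\<pi>\<close>. Squaring keeps the branch of the square
  root out of the argument.
\<close>

lemma gauss_integral_square:
  assumes z: "Re z > 0" shows "(gauss_integral z)\<^sup>2 = of_real pi / z"
proof -
  let ?e = "Re z"
  define P where "P t = (gauss_integral (Complex ?e t))\<^sup>2 * Complex ?e t" for t
  obtain c where "\<And>t. t \<in> UNIV \<Longrightarrow> P t = c"
  proof (rule has_vector_derivative_zero_constant[OF convex_UNIV])
    fix t :: real
    let ?M = "LINT \<xi>|lborel. of_real (\<xi>\<^sup>2) * gauss_symbol (Complex ?e t) \<xi>"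
    let ?c = "gauss_integral (Complex ?e t)"
    have bp: "2 * Complex ?e t * ?M = ?c" by (rule gauss_integral_by_parts) (simp add: z)
    have dC: "((\<lambda>t. Complex ?e t) has_vector_derivative \<i>) (at t)"
      by (auto simp: has_vector_derivative_complex_iff)
    have "(P has_vector_derivative (?c * ?c * \<i> + (?c * (- \<i> * ?M) + - \<i> * ?M * ?c) * Complex ?e t)) (at t)"
      unfolding P_def power2_eq_square[of "gauss_integral _"]
      by (intro has_vector_derivative_mult gauss_integral_deriv dC z)
    moreover have "?c * ?c * \<i> + (?c * (- \<i> * ?M) + - \<i> * ?M * ?c) * Complex ?e t = \<i> * ?c * (?c - 2 * Complex ?e t * ?M)"
      by (simp add: algebra_simps)
    ultimately show "(P has_vector_derivative 0) (at t within UNIV)" using bp by simp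
  qed blast
  then have "P (Im z) = P 0" by auto
  moreover have "P 0 = of_real pi"
  proof -
    have "Complex ?e 0 = of_real ?e" by (simp add: complex_eq_iff)
    moreover have "(sqrt (pi / ?e))\<^sup>2 * ?e = pi" using z by simp
    ultimately show ?thesis using z by (simp only: P_def gauss_integral_real of_real_power[symmetric] of_real_mult[symmetric])
  qed
  ultimately have "(gauss_integral z)\<^sup>2 * z = of_real pi" by (simp add: P_def)
  moreover have "z \<noteq> 0" using z by auto
  ultimately show ?thesis by (simp add: field_simps)
qed

section \<open>The free group acting on heat kernels\<close>

lemma gauss_symbol_L2:
  assumes "Re z > 0" shows "gauss_symbol z \<in> L2" "integrable lebesgue (gauss_symbol z)"
proof -
  have m: "gauss_symbol z \<in> borel_measurable lebesgue" by (intro borel_imp_leb) simp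
  have "cmod (gauss_symbol z x) \<le> 1 * exp (- Re z * (x - 0)\<^sup>2)" for x by simp
  from L2_gaussian[OF assms m this] show "gauss_symbol z \<in> L2" "integrable lebesgue (gauss_symbol z)" .
qed

lemma fourier_integral_gauss_symbol_lborel: "fourier_integral (gauss_symbol z) x = (LINT \<xi>|lborel. cis (- (\<xi> * x)) * gauss_symbol z \<xi>)"
  unfolding fourier_integral_def by (rule integral_completion) simp

lemma fourier_integral_gauss_symbol_even: "fourier_integral (gauss_symbol z) (- x) = fourier_integral (gauss_symbol z) x"
proof -
  have "fourier_integral (gauss_symbol z) (- x) = \<bar>-1\<bar> *\<^sub>R (LINT \<xi>|lborel. cis (- ((0 + -1 * \<xi>) * (- x))) * gauss_symbol z (0 + -1 * \<xi>))"
    unfolding fourier_integral_gauss_symbol_lborel by (rule lborel_integral_real_affine) simp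
  also have "\<dots> = fourier_integral (gauss_symbol z) x" unfolding fourier_integral_gauss_symbol_lborel by (simp add: gauss_symbol_def)
  finally show ?thesis .
qed

lemma cnj_fourier_integral_gauss_symbol: "cnj (fourier_integral (gauss_symbol z) x) = fourier_integral (gauss_symbol (cnj z)) x"
proof -
  have "cnj (fourier_integral (gauss_symbol z) x) = (LINT \<xi>|lebesgue. cnj (cis (- (\<xi> * x)) * gauss_symbol z \<xi>))"
    unfolding fourier_integral_def by (rule Bochner_Integration.integral_cnj[symmetric])
  also have "\<dots> = fourier_integral (gauss_symbol (cnj z)) (- x)"
    unfolding fourier_integral_def by (intro Bochner_Integration.integral_cong refl) (simp add: cnj_gauss_symbol cis_cnj)
  finally show ?thesis by (simp only: fourier_integral_gauss_symbol_even)
qed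

text \<open>
  The truncated transforms, and hence the choice in the definition, depend only on the class modulo null sets.
\<close>

lemma fourier_L2_cong:
  assumes [measurable]: "f \<in> borel_measurable lebesgue" "g \<in> borel_measurable lebesgue"
    and eq: "AE x in lebesgue. f x = g x"
  shows "fourier_L2 f = fourier_L2 g"
proof -
  have "fourier_trunc R f \<xi> = fourier_trunc R g \<xi>" for R \<xi>
    unfolding fourier_trunc_def set_lebesgue_integral_def
    by (rule integral_cong_AE) (use eq in auto)
  then have "fourier_trunc R f = fourier_trunc R g" for R by (intro ext)
  then show ?thesis unfolding fourier_L2_def by simp
qed

text \<open>
  On \<open>L\<^sup>1 \<inter> L\<^sup>2\<close> the two transforms agree because they satisfy the same multiplication formula against a total
  family.
\<close>

lemma fourier_L2_eq_fourier_integral: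
  assumes k: "k \<in> L2" "integrable lebesgue k"
  shows "AE \<xi> in lebesgue. fourier_L2 k \<xi> = fourier_integral k \<xi>"
  by (rule L2_eq_modgauss[OF fourier_L2_in_L2[OF k(1)] fourier_integral_L2[OF k]])
     (simp only: fourier_L2_mult_swap[OF k(1) modgauss_L2] fourier_integral_mult_swap[OF k(2) modgauss_L2(2)])

lemma continuous_on_fourier_integral:
  assumes f: "integrable lebesgue f"
  shows "continuous_on UNIV (fourier_integral f)"
  unfolding continuous_on_sequentially comp_def
proof (intro allI ballI impI, elim conjE)
  fix X :: "nat \<Rightarrow> real" and \<xi> assume X: "X \<longlonglongrightarrow> \<xi>"
  show "(\<lambda>n. fourier_integral f (X n)) \<longlonglongrightarrow> fourier_integral f \<xi>"
    unfolding fourier_integral_def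
  proof (rule integral_dominated_convergence[where w = "\<lambda>x. cmod (f x)"])
    show "AE x in lebesgue. (\<lambda>n. cis (- (x * X n)) * f x) \<longlonglongrightarrow> cis (- (x * \<xi>)) * f x"
      by (intro AE_I2 tendsto_intros X)
  qed (use f in \<open>auto simp: norm_mult intro!: borel_measurable_times borel_measurable_cis\<close>)
qed

text \<open>
  The inversion formula provides the function whose existence the definition of the group presupposes.
\<close>

lemma schrodinger_group:
  assumes f: "f \<in> L2"
  shows schrodinger_group_L2: "schrodinger_group t f \<in> L2"
    and fourier_schrodinger: "AE \<xi> in lebesgue. fourier_L2 (schrodinger_group t f) \<xi> = cis (- (t * \<xi>\<^sup>2)) * fourier_L2 f \<xi>"
proof -
  have m: "fourier_L2 f \<in> borel_measurable lebesgue" using fourier_L2_in_L2[OF f] by auto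
  have "(\<lambda>\<xi>. cis (- (t * \<xi>\<^sup>2)) * fourier_L2 f \<xi>) \<in> L2"
    by (rule L2_dominated[OF fourier_L2_in_L2[OF f]])
       (use m in \<open>auto simp: norm_mult intro!: borel_measurable_times borel_measurable_cis\<close>)
  from fourier_L2_inverse[OF this]
  have "\<exists>h. h \<in> L2 \<and> (AE \<xi> in lebesgue. fourier_L2 h \<xi> = cis (- (t * \<xi>\<^sup>2)) * fourier_L2 f \<xi>)" by blast
  from someI_ex[OF this] show "schrodinger_group t f \<in> L2"
    "AE \<xi> in lebesgue. fourier_L2 (schrodinger_group t f) \<xi> = cis (- (t * \<xi>\<^sup>2)) * fourier_L2 f \<xi>"
    unfolding schrodinger_group_def by auto
qed

text \<open>
  The heat kernel \<open>(4 \<pi> z)\<^sup>-\<^sup>1\<^sup>/\<^sup>2 exp (- x\<^sup>2 / (4 z))\<close> at the complex time \<open>z\<close>, given by its Fourier representation because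
  only its transform, its continuity, its values at real \<open>z\<close> and the square of its value at the origin are used.
\<close>

definition heat_kernel :: "complex \<Rightarrow> real \<Rightarrow> complex" where
  "heat_kernel z x = of_real (1 / (2 * pi)) * fourier_integral (gauss_symbol z) x"

lemma heat_kernel_L2: "Re z > 0 \<Longrightarrow> heat_kernel z \<in> L2"
  unfolding heat_kernel_def[abs_def] by (intro L2_cmult fourier_integral_L2 gauss_symbol_L2)

lemma heat_kernel_measurable: "heat_kernel z \<in> borel_measurable lebesgue"
proof -
  have "gauss_symbol z \<in> borel_measurable lebesgue" by (intro borel_imp_leb) simp
  then show ?thesis unfolding heat_kernel_def[abs_def] by (intro borel_measurable_times fourier_integral_measurable) auto
qed

lemma cnj_heat_kernel: "cnj (heat_kernel z x) = heat_kernel (cnj z) x"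
  by (simp add: heat_kernel_def cnj_fourier_integral_gauss_symbol)

lemma heat_kernel_0: "heat_kernel z 0 = gauss_integral z / (2 * of_real pi)"
  by (simp add: heat_kernel_def fourier_integral_gauss_symbol_lborel gauss_integral_def)

lemma heat_kernel_real:
  assumes "e > 0" shows "heat_kernel (of_real e) x = of_real (normal_density 0 (sqrt (2 * e)) x)"
proof -
  have "fourier_integral (gauss_symbol (of_real e)) x = fourier_integral (\<lambda>\<xi>. cis (0 * \<xi>) * of_real (exp (- e * \<xi>\<^sup>2))) x"
    by (simp add: fourier_integral_def gauss_symbol_of_real)
  then show ?thesis by (simp only: heat_kernel_def fourier_integral_gaussian[OF assms]) simp
qed

lemma continuous_heat_kernel: "Re z > 0 \<Longrightarrow> continuous_on UNIV (heat_kernel z)"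
  unfolding heat_kernel_def[abs_def] by (intro continuous_intros continuous_on_fourier_integral gauss_symbol_L2)

lemma bounded_heat_kernel: "Re z > 0 \<Longrightarrow> bounded (range (heat_kernel z))"
proof -
  assume z: "Re z > 0"
  show ?thesis unfolding bounded_iff heat_kernel_def
    by (intro exI[of _ "1 / (2 * pi) * (LINT x|lebesgue. cmod (gauss_symbol z x))"])
       (use fourier_integral_bound[OF gauss_symbol_L2(2)[OF z]] in \<open>auto simp: norm_mult norm_divide divide_right_mono\<close>)
qed

text \<open>
  The inversion formula applied to the symbol gives a function that is almost everywhere the heat kernel, by
  evenness of the symbol.
\<close>

lemma fourier_heat_kernel:
  assumes z: "Re z > 0"
  shows "AE \<xi> in lebesgue. fourier_L2 (heat_kernel z) \<xi> = gauss_symbol z \<xi>"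
proof -
  let ?h = "\<lambda>x. of_real (1 / (2 * pi)) * cnj (fourier_L2 (\<lambda>x. cnj (gauss_symbol z x)) x)"
  have z': "Re (cnj z) > 0" using z by simp
  have "AE x in lebesgue. fourier_L2 (gauss_symbol (cnj z)) x = fourier_integral (gauss_symbol (cnj z)) x"
    by (rule fourier_L2_eq_fourier_integral; rule gauss_symbol_L2[OF z'])
  then have "AE x in lebesgue. ?h x = heat_kernel z x"
    by eventually_elim (simp add: cnj_gauss_symbol heat_kernel_def cnj_fourier_integral_gauss_symbol)
  moreover have "?h \<in> L2" "AE \<xi> in lebesgue. fourier_L2 ?h \<xi> = gauss_symbol z \<xi>"
    by (rule fourier_L2_inverse[OF gauss_symbol_L2(1)[OF z]])+
  ultimately show ?thesis
    using fourier_L2_cong[of ?h "heat_kernel z"] L2_measurable[of ?h] heat_kernel_measurable by simp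
qed

text \<open>
  The free group multiplies the symbol \<open>exp (- z \<xi>\<^sup>2)\<close> by \<open>exp (- i t \<xi>\<^sup>2)\<close>, that is, it adds \<open>i t\<close> to the complex
  time.
\<close>

lemma schrodinger_group_heat_kernel:
  assumes z: "Re z > 0"
  shows "AE x in lebesgue. schrodinger_group t (heat_kernel z) x = heat_kernel (z + \<i> * of_real t) x"
proof (rule fourier_L2_inj)
  have z': "Re (z + \<i> * of_real t) > 0" using z by simp
  show "schrodinger_group t (heat_kernel z) \<in> L2" "heat_kernel (z + \<i> * of_real t) \<in> L2"
    using z z' by (intro schrodinger_group_L2 heat_kernel_L2; simp)+
  show "AE \<xi> in lebesgue. fourier_L2 (schrodinger_group t (heat_kernel z)) \<xi> = fourier_L2 (heat_kernel (z + \<i> * of_real t)) \<xi>"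
    using fourier_schrodinger[OF heat_kernel_L2[OF z], of t] fourier_heat_kernel[OF z] fourier_heat_kernel[OF z']
    by eventually_elim (simp add: gauss_symbol_shift)
qed

lemma integral_mult_heat_kernel:
  assumes u: "u \<in> L2" and z: "Re z > 0"
  shows "(LINT x|lebesgue. u x * heat_kernel z x) = of_real (1 / (2 * pi)) * (LINT \<xi>|lebesgue. fourier_L2 u \<xi> * gauss_symbol z \<xi>)"
proof -
  have "(LINT x|lebesgue. u x * heat_kernel z x) = (LINT x|lebesgue. of_real (1 / (2 * pi)) * (u x * fourier_integral (gauss_symbol z) x))"
    by (intro Bochner_Integration.integral_cong refl) (simp add: heat_kernel_def)
  also have "\<dots> = of_real (1 / (2 * pi)) * (LINT x|lebesgue. u x * fourier_integral (gauss_symbol z) x)"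
    by (rule integral_mult_right_zero)
  finally show ?thesis by (simp only: fourier_L2_mult_swap[OF u gauss_symbol_L2[OF z]])
qed

text \<open>
  By the multiplication formula both sides integrate the transform of \<open>f\<close> against
  \<open>exp (- i t \<xi>\<^sup>2) exp (- z \<xi>\<^sup>2)\<close>; the pairing is bilinear, so the sign of \<open>t\<close> is kept. For general \<open>f\<close> this
  gives explicit access to \<open>schrodinger_group t f\<close>.
\<close>

lemma schrodinger_group_adjoint:
  assumes f: "f \<in> L2" and z: "Re z > 0"
  shows "(LINT x|lebesgue. schrodinger_group t f x * heat_kernel z x) = (LINT x|lebesgue. f x * heat_kernel (z + \<i> * of_real t) x)"
proof -
  have z': "Re (z + \<i> * of_real t) > 0" using z by simp
  have [measurable]: "fourier_L2 (schrodinger_group t f) \<in> borel_measurable lebesgue"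
    "fourier_L2 f \<in> borel_measurable lebesgue" "\<And>z. gauss_symbol z \<in> borel_measurable lebesgue"
    using L2_measurable[OF fourier_L2_in_L2] schrodinger_group_L2[OF f] f by (auto intro: borel_imp_leb)
  have "(LINT \<xi>|lebesgue. fourier_L2 (schrodinger_group t f) \<xi> * gauss_symbol z \<xi>)
      = (LINT \<xi>|lebesgue. fourier_L2 f \<xi> * gauss_symbol (z + \<i> * of_real t) \<xi>)"
    by (rule integral_cong_AE, measurable)
       (use fourier_schrodinger[OF f, of t] in \<open>eventually_elim, simp add: gauss_symbol_shift mult_ac\<close>)
  then show ?thesis
    by (simp only: integral_mult_heat_kernel[OF schrodinger_group_L2[OF f] z] integral_mult_heat_kernel[OF f z'])
qed

section \<open>Values of continuous representatives\<close>

text \<open>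
  The set where two continuous functions differ is open, so it is empty as soon as it is a null set.
\<close>

lemma AE_eq_continuous_imp_eq:
  fixes f g :: "real \<Rightarrow> complex"
  assumes "continuous_on UNIV f" "continuous_on UNIV g" and eq: "AE x in lebesgue. f x = g x"
  shows "f = g"
proof -
  let ?S = "{x. f x \<noteq> g x}"
  have "open ?S" using assms by (intro open_Collect_neq)
  moreover have "negligible ?S"
    using eq by (simp add: negligible_iff_null_sets completion.AE_iff_null_sets)
  ultimately have "?S = {}" using open_not_negligible by blast
  then show ?thesis by auto
qed

lemma Cx_rep:
  assumes "in_Cx f" shows "AE x in lebesgue. f x = apply_bcontfun (Cx_rep f) x"
  using someI_ex[OF assms[unfolded in_Cx_def]] unfolding Cx_rep_def .

lemma Cx_value_eq:
  assumes g: "continuous_on UNIV g" "bounded (range g)" and eq: "AE x in lebesgue. f x = g x"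
  shows "Cx_value f = g"
proof -
  have "apply_bcontfun (Bcontfun g) = g" using g by (intro Bcontfun_inverse) (simp add: bcontfun_def)
  then have "in_Cx f" unfolding in_Cx_def using eq by metis
  from Cx_rep[OF this] eq have "AE x in lebesgue. apply_bcontfun (Cx_rep f) x = g x"
    by eventually_elim simp
  then show ?thesis unfolding Cx_value_def[abs_def] using g(1)
    by (intro AE_eq_continuous_imp_eq) auto
qed

lemma Cx_value_schrodinger_heat_kernel:
  assumes z: "Re z > 0"
  shows "Cx_value (schrodinger_group t (heat_kernel z)) = heat_kernel (z + \<i> * of_real t)"
  by (rule Cx_value_eq[OF continuous_heat_kernel bounded_heat_kernel schrodinger_group_heat_kernel[OF z]]) (use z in simp_all)

text \<open>
  At a positive real time the heat kernel is a probability density, so its averages are bounded by the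
  supremum norm. If the function is not in \<open>C\<^sub>x\<close>, the right side is infinite.
\<close>

lemma norm_integral_heat_kernel_le_Cx_norm:
  assumes u: "u \<in> L2" and e: "e > 0"
  shows "ennreal (cmod (LINT x|lebesgue. u x * heat_kernel (of_real e) x)) \<le> Cx_norm u"
proof (cases "in_Cx u")
  case True
  let ?N = "normal_density 0 (sqrt (2 * e))"
  have "ennreal (cmod (LINT x|lebesgue. u x * heat_kernel (of_real e) x)) \<le> (\<integral>\<^sup>+ x. ennreal (cmod (u x * heat_kernel (of_real e) x)) \<partial>lebesgue)"
    by (intro integral_norm_bound_ennreal L2_mult_integrable u heat_kernel_L2) (use e in simp)
  also have "\<dots> \<le> (\<integral>\<^sup>+ x. ennreal (norm (Cx_rep u)) * ennreal (?N x) \<partial>lebesgue)"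
    by (rule nn_integral_mono_AE, use Cx_rep[OF True] in eventually_elim)
       (auto simp: heat_kernel_real[OF e] norm_mult ennreal_mult norm_bounded intro!: mult_right_mono)
  also have "\<dots> = ennreal (norm (Cx_rep u))"
    using e by (subst nn_integral_cmult) (auto simp: nn_integral_normal intro: borel_imp_leb)
  finally show ?thesis using True by (simp add: Cx_norm_def)
qed (simp add: Cx_norm_def)

text \<open>
  The heat kernels are an approximate identity; rescaling to a fixed normal density makes dominated convergence
  applicable.
\<close>

lemma integral_heat_kernel_tendsto_Cx_value:
  assumes u: "u \<in> borel_measurable lebesgue" "in_Cx u"
  shows "(\<lambda>n. LINT x|lebesgue. u x * heat_kernel (of_real (1 / Suc n)) x) \<longlonglongrightarrow> Cx_value u 0"
proof -
  let ?g = "apply_bcontfun (Cx_rep u)"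
  have gc: "continuous_on UNIV ?g" by simp
  have [measurable]: "?g \<in> borel_measurable borel" by (intro borel_measurable_continuous_onI gc)
  define s where "s n = sqrt (2 * (1 / Suc n))" for n :: nat
  have s: "s n > 0" for n by (simp add: s_def)
  have s0: "s \<longlonglongrightarrow> 0"
  proof -
    have "(\<lambda>n. sqrt (2 * (1 / real (Suc n)))) \<longlonglongrightarrow> sqrt (2 * 0)"
      by (intro tendsto_intros LIMSEQ_Suc[OF lim_1_over_n])
    then show ?thesis unfolding s_def[abs_def] by simp
  qed
  have eq: "(LINT x|lebesgue. u x * heat_kernel (of_real (1 / Suc n)) x)
      = (LINT y|lborel. ?g (s n * y) * of_real (std_normal_density y))" for n
  proof -
    have "(LINT x|lebesgue. u x * heat_kernel (of_real (1 / Suc n)) x)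
        = (LINT x|lebesgue. ?g x * of_real (normal_density 0 (s n) x))"
    proof (rule integral_cong_AE)
      show "AE x in lebesgue. u x * heat_kernel (of_real (1 / Suc n)) x = ?g x * of_real (normal_density 0 (s n) x)"
        using Cx_rep[OF u(2)] by eventually_elim (simp add: heat_kernel_real s_def del: of_real_divide)
      show "(\<lambda>x. ?g x * of_real (normal_density 0 (s n) x)) \<in> borel_measurable lebesgue"
        by (rule borel_imp_leb) measurable
    qed (intro borel_measurable_times u heat_kernel_measurable)
    also have "\<dots> = (LINT x|lborel. ?g x * of_real (normal_density 0 (s n) x))"
      by (rule integral_completion) measurable
    also have "\<dots> = \<bar>s n\<bar> *\<^sub>R (LINT y|lborel. ?g (0 + s n * y) * of_real (normal_density 0 (s n) (0 + s n * y)))"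
      using s[of n] by (intro lborel_integral_real_affine) simp
    also have "\<dots> = (LINT y|lborel. of_real (s n) * (?g (s n * y) * of_real (normal_density 0 (s n) (s n * y))))"
      using s[of n] by (simp add: scaleR_conv_of_real)
    also have "\<dots> = (LINT y|lborel. ?g (s n * y) * of_real (std_normal_density y))"
    proof (intro Bochner_Integration.integral_cong refl)
      fix y
      have "s n * normal_density 0 (s n) (s n * y) = std_normal_density y"
        using s[of n] by (simp add: normal_density_def power_mult_distrib real_sqrt_mult)
      from this[symmetric] show "of_real (s n) * (?g (s n * y) * of_real (normal_density 0 (s n) (s n * y))) = ?g (s n * y) * of_real (std_normal_density y)"
        by (simp add: mult_ac)
    qed
    finally show ?thesis .
  qed
  have "(\<lambda>n. LINT y|lborel. ?g (s n * y) * of_real (std_normal_density y)) \<longlonglongrightarrow> (LINT y|lborel. ?g 0 * of_real (std_normal_density y))"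
  proof (rule integral_dominated_convergence[where w = "\<lambda>y. norm (Cx_rep u) * std_normal_density y"])
    show "AE y in lborel. (\<lambda>n. ?g (s n * y) * of_real (std_normal_density y)) \<longlonglongrightarrow> ?g 0 * of_real (std_normal_density y)"
    proof (rule AE_I2)
      fix y
      have "(\<lambda>n. s n * y) \<longlonglongrightarrow> 0 * y" by (intro tendsto_intros s0)
      then have "(\<lambda>n. s n * y) \<longlonglongrightarrow> 0" by simp
      from continuous_on_tendsto_compose[OF gc this] show "(\<lambda>n. ?g (s n * y) * of_real (std_normal_density y)) \<longlonglongrightarrow> ?g 0 * of_real (std_normal_density y)"
        by (intro tendsto_intros) auto
    qed
    show "AE y in lborel. norm (?g (s n * y) * of_real (std_normal_density y)) \<le> norm (Cx_rep u) * std_normal_density y" for n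
      by (intro AE_I2) (auto simp: norm_mult norm_bounded intro!: mult_right_mono)
  qed (auto intro!: integrable_mult_right)
  moreover have "(LINT y|lborel. ?g 0 * of_real (std_normal_density y)) = ?g 0"
  proof -
    have "(LINT y|lborel. (of_real (std_normal_density y) :: complex)) = 1"
      by (subst integral_complex_of_real) simp
    then show ?thesis by (simp only: integral_mult_right_zero) simp
  qed
  ultimately show ?thesis unfolding eq Cx_value_def by simp
qed

section \<open>The Duhamel formula tested with heat kernels\<close>

text \<open>
  The oriented integral over \<open>a..b\<close> becomes an integral over the line against the signed weight
  \<open>1(s < b) - 1(s < a)\<close>. These weights add up along consecutive intervals whatever the order of the end points.
\<close>

lemma oriented_integral:
  fixes f :: "real \<Rightarrow> complex"
  assumes f: "interval_lebesgue_integrable lebesgue (ereal a) (ereal b) f"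
  shows "integrable lebesgue (\<lambda>s. (of_bool (s < b) - of_bool (s < a)) * f s)"
    and "(LINT s=ereal a..ereal b|lebesgue. f s) = (LINT s|lebesgue. (of_bool (s < b) - of_bool (s < a)) * f s)"
proof -
  have *: "integrable lebesgue (\<lambda>s. indicator {a..<b} s *\<^sub>R g s) \<and>
      (LINT s|lebesgue. indicator {a..<b} s *\<^sub>R g s) = (LINT s:einterval (ereal a) (ereal b)|lebesgue. g s)"
    if g: "set_integrable lebesgue (einterval (ereal a) (ereal b)) g" and ab: "a \<le> b" for a b and g :: "real \<Rightarrow> complex"
  proof (cases "a = b")
    case True
    then show ?thesis by (simp add: set_lebesgue_integral_def einterval_def)
  next
    case False
    with ab have ab: "a < b" by simp
    have i: "integrable lebesgue (\<lambda>s. indicator {a} s *\<^sub>R g a)" by simp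
    have z: "(LINT s|lebesgue. indicator {a} s *\<^sub>R g a) = 0" by simp
    have e: "indicator {a..<b} s *\<^sub>R g s = indicator (einterval (ereal a) (ereal b)) s *\<^sub>R g s + indicator {a} s *\<^sub>R g a" for s
      using ab by (auto simp: einterval_def split: split_indicator)
    show ?thesis
      using g i unfolding e set_integrable_def set_lebesgue_integral_def by (simp add: z)
  qed
  have "integrable lebesgue (\<lambda>s. (of_bool (s < b) - of_bool (s < a)) * f s) \<and>
    (LINT s=ereal a..ereal b|lebesgue. f s) = (LINT s|lebesgue. (of_bool (s < b) - of_bool (s < a)) * f s)"
  proof (cases "a \<le> b")
    case True
    then have "(of_bool (s < b) - of_bool (s < a)) * f s = indicator {a..<b} s *\<^sub>R f s" for s
      by (auto split: split_indicator)
    then show ?thesis using *[of a b f] f True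
      by (simp add: interval_lebesgue_integrable_def interval_lebesgue_integral_def)
  next
    case False
    then have "(of_bool (s < b) - of_bool (s < a)) * f s = - (indicator {b..<a} s *\<^sub>R f s)" for s
      by (auto split: split_indicator)
    then show ?thesis using *[of b a f] f False
      by (simp add: interval_lebesgue_integrable_def interval_lebesgue_integral_def)
  qed
  then show "integrable lebesgue (\<lambda>s. (of_bool (s < b) - of_bool (s < a)) * f s)"
    "(LINT s=ereal a..ereal b|lebesgue. f s) = (LINT s|lebesgue. (of_bool (s < b) - of_bool (s < a)) * f s)"
    by auto
qed

text \<open>
  The duality pairing of the Duhamel integral with a heat kernel, where every term is explicit.
\<close>

lemma duality_integral_heat_kernel:
  assumes D: "has_duality_integral t a b c dirac0 D" and z: "Re z > 0"
  shows "integrable lebesgue (\<lambda>s. (of_bool (s < b) - of_bool (s < a)) * (heat_kernel (z + \<i> * of_real (t - s)) 0 * c s))"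
    and "(LINT x|lebesgue. D x * heat_kernel z x) = (LINT s|lebesgue. (of_bool (s < b) - of_bool (s < a)) * (heat_kernel (z + \<i> * of_real (t - s)) 0 * c s))"
proof -
  have z': "Re (cnj z) > 0" using z by simp
  \<comment> \<open>Testing with the heat kernel at \<open>cnj z\<close> makes the conjugate of the test function the heat kernel at \<open>z\<close>.\<close>
  have p: "(LINT x|dirac0. cnj (Cx_value (schrodinger_group (s - t) (heat_kernel (cnj z))) x) * c s) = heat_kernel (z + \<i> * of_real (t - s)) 0 * c s" for s
  proof -
    have "heat_kernel (cnj z + \<i> * of_real (s - t)) \<in> borel_measurable borel"
      by (intro borel_measurable_continuous_onI continuous_heat_kernel) (use z in simp)
    then have "(LINT x|dirac0. cnj (heat_kernel (cnj z + \<i> * of_real (s - t)) x) * c s) = cnj (heat_kernel (cnj z + \<i> * of_real (s - t)) 0) * c s"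
      by (intro integral_return) (auto intro!: borel_measurable_cnj borel_measurable_times)
    also have "\<dots> = heat_kernel (z + \<i> * of_real (t - s)) 0 * c s"
      by (simp add: cnj_heat_kernel algebra_simps)
    finally show ?thesis by (simp only: Cx_value_schrodinger_heat_kernel[OF z'])
  qed
  from D heat_kernel_L2[OF z'] have "interval_lebesgue_integrable lebesgue (ereal a) (ereal b) (\<lambda>s. heat_kernel (z + \<i> * of_real (t - s)) 0 * c s)"
    and "(LINT x|lebesgue. D x * cnj (heat_kernel (cnj z) x)) = (LINT s=ereal a..ereal b|lebesgue. (heat_kernel (z + \<i> * of_real (t - s)) 0 * c s))"
    unfolding has_duality_integral_def Let_def p[symmetric] by blast+
  then show "integrable lebesgue (\<lambda>s. (of_bool (s < b) - of_bool (s < a)) * (heat_kernel (z + \<i> * of_real (t - s)) 0 * c s))"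
    "(LINT x|lebesgue. D x * heat_kernel z x) = (LINT s|lebesgue. (of_bool (s < b) - of_bool (s < a)) * (heat_kernel (z + \<i> * of_real (t - s)) 0 * c s))"
    using oriented_integral by (simp_all add: cnj_heat_kernel)
qed

definition cubic :: "complex \<Rightarrow> complex" where
  "cubic w = of_real ((cmod w)\<^sup>2) * w"

text \<open>
  A strong solution satisfies the Duhamel formula from some base time \<open>t0\<close>. Testing it at time \<open>t\<close> with the heat
  kernel at \<open>e\<close>, and at time \<open>0\<close> with the heat kernel at \<open>e + i t\<close>, produces the same two terms at \<open>t0\<close>: the pairing
  with \<open>\<psi> t0\<close> and the kernel inside the time integral. Subtraction moves the base time to \<open>0\<close>.
\<close>

lemma duhamel_formula_heat_kernel:
  assumes I: "0 \<in> I" and \<psi>0: "\<psi>0 \<in> L2" and sol: "strong_solution I \<psi>"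
    and init: "AE x in lebesgue. \<psi> 0 x = \<psi>0 x" and e: "e > 0" and t: "t \<in> I"
  defines "K \<equiv> \<lambda>s. heat_kernel (of_real e + \<i> * of_real (t - s)) 0 * cubic (Cx_value (\<psi> s) 0)"
  shows "integrable lebesgue (\<lambda>s. (of_bool (s < t) - of_bool (s < 0)) * K s)"
    and "(LINT x|lebesgue. \<psi> t x * heat_kernel (of_real e) x) =
      (LINT x|lebesgue. \<psi>0 x * heat_kernel (of_real e + \<i> * of_real t) x)
      - \<i> * (LINT s|lebesgue. (of_bool (s < t) - of_bool (s < 0)) * K s)"
proof -
  from sol have CL2: "\<psi> r \<in> L2" if "r \<in> I" for r using that by (auto simp: strong_solution_def C_L2_def)
  from sol obtain t0 where t0: "t0 \<in> I" and ex: "\<forall>t\<in>I. \<exists>D. has_duality_integral t t0 t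
          (\<lambda>s. cubic (Cx_value (\<psi> s) 0)) dirac0 D \<and>
        (AE x in lebesgue. \<psi> t x = schrodinger_group (t - t0) (\<psi> t0) x - \<i> * D x)"
    unfolding strong_solution_def cubic_def by blast
  define J where "J r s = (of_bool (s < r) - of_bool (s < t0)) * K s" for r s
  \<comment> \<open>Used for \<open>r = t\<close> and \<open>r = 0\<close>; the right side depends on \<open>r\<close> only through the weight in \<open>J r\<close>.\<close>
  have main: "integrable lebesgue (J r) \<and> (LINT x|lebesgue. \<psi> r x * heat_kernel (of_real e + \<i> * of_real (t - r)) x) =
      (LINT x|lebesgue. \<psi> t0 x * heat_kernel (of_real e + \<i> * of_real (t - t0)) x) - \<i> * (LINT s|lebesgue. J r s)" if r: "r \<in> I" for r
  proof -
    from ex r obtain D where D: "has_duality_integral r t0 r (\<lambda>s. cubic (Cx_value (\<psi> s) 0)) dirac0 D"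
      and AE: "AE x in lebesgue. \<psi> r x = schrodinger_group (r - t0) (\<psi> t0) x - \<i> * D x" by blast
    let ?z = "of_real e + \<i> * of_real (t - r)"
    have z: "Re ?z > 0" using e by simp
    have shift: "?z + \<i> * of_real (r - s) = of_real e + \<i> * of_real (t - s)" for s
      by (simp add: algebra_simps)
    have D2: "D \<in> L2" using D by (simp add: has_duality_integral_def)
    have S2: "schrodinger_group (r - t0) (\<psi> t0) \<in> L2" by (intro schrodinger_group_L2 CL2 t0)
    have "(LINT x|lebesgue. \<psi> r x * heat_kernel ?z x) = (LINT x|lebesgue. schrodinger_group (r - t0) (\<psi> t0) x * heat_kernel ?z x - \<i> * (D x * heat_kernel ?z x))"
    proof (rule integral_cong_AE)
      show "AE x in lebesgue. \<psi> r x * heat_kernel ?z x = schrodinger_group (r - t0) (\<psi> t0) x * heat_kernel ?z x - \<i> * (D x * heat_kernel ?z x)"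
        using AE by eventually_elim (simp only: left_diff_distrib mult.assoc)
    qed (intro borel_measurable_times borel_measurable_diff borel_measurable_const L2_measurable heat_kernel_L2 z S2 D2 CL2 r)+
    also have "\<dots> = (LINT x|lebesgue. schrodinger_group (r - t0) (\<psi> t0) x * heat_kernel ?z x) - \<i> * (LINT x|lebesgue. D x * heat_kernel ?z x)"
      unfolding integral_mult_right_zero[symmetric]
      by (intro Bochner_Integration.integral_diff integrable_mult_right L2_mult_integrable heat_kernel_L2 z S2 D2)
    also have "(LINT x|lebesgue. schrodinger_group (r - t0) (\<psi> t0) x * heat_kernel ?z x) = (LINT x|lebesgue. \<psi> t0 x * heat_kernel (?z + \<i> * of_real (r - t0)) x)"
      by (rule schrodinger_group_adjoint[OF CL2[OF t0] z])
    also have "(LINT x|lebesgue. D x * heat_kernel ?z x) = (LINT s|lebesgue. J r s)"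
      unfolding duality_integral_heat_kernel(2)[OF D z] shift J_def K_def ..
    finally show ?thesis
      using duality_integral_heat_kernel(1)[OF D z] unfolding shift J_def K_def by simp
  qed
  have J: "(of_bool (s < t) - of_bool (s < 0)) * K s = J t s - J 0 s" for s
    by (simp add: J_def algebra_simps)
  show "integrable lebesgue (\<lambda>s. (of_bool (s < t) - of_bool (s < 0)) * K s)"
    unfolding J using main[OF t] main[OF I] by auto
  have "(LINT x|lebesgue. \<psi> 0 x * heat_kernel (of_real e + \<i> * of_real (t - 0)) x) = (LINT x|lebesgue. \<psi>0 x * heat_kernel (of_real e + \<i> * of_real t) x)"
  proof (rule integral_cong_AE)
    show "AE x in lebesgue. \<psi> 0 x * heat_kernel (of_real e + \<i> * of_real (t - 0)) x = \<psi>0 x * heat_kernel (of_real e + \<i> * of_real t) x"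
      using init by eventually_elim simp
  qed (intro borel_measurable_times heat_kernel_measurable L2_measurable CL2 I \<psi>0)+
  then show "(LINT x|lebesgue. \<psi> t x * heat_kernel (of_real e) x) =
      (LINT x|lebesgue. \<psi>0 x * heat_kernel (of_real e + \<i> * of_real t) x)
      - \<i> * (LINT s|lebesgue. (of_bool (s < t) - of_bool (s < 0)) * K s)"
    unfolding J using main[OF t] main[OF I]
    by (simp add: Bochner_Integration.integral_diff algebra_simps)
qed

section \<open>The error form\<close>

text \<open>
  One half of the density of a Cauchy distribution of width \<open>e\<close>.
\<close>

definition cauchy :: "real \<Rightarrow> real \<Rightarrow> real" where
  "cauchy e \<tau> = e / (2 * pi * (e\<^sup>2 + \<tau>\<^sup>2))"

lemma cauchy_measurable [measurable]: "cauchy e \<in> borel_measurable borel"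
  unfolding cauchy_def by measurable

lemma cauchy_nonneg: "e > 0 \<Longrightarrow> 0 \<le> cauchy e \<tau>"
  by (simp add: cauchy_def)

lemma nn_integral_cauchy_half:
  assumes e: "e > 0"
  shows "(\<integral>\<^sup>+ x. ennreal (of_bool (0 < x) * cauchy e x) \<partial>lborel) \<le> 1"
proof -
  have "(\<integral>\<^sup>+ x. ennreal (of_bool (0 < x) * cauchy e x) \<partial>lborel) \<le> (\<integral>\<^sup>+ x. ennreal (cauchy e x) * indicator {0..} x \<partial>lborel)"
    by (intro nn_integral_mono) (auto split: split_indicator)
  also have "\<dots> = (1 / (2 * pi)) * (pi / 2) - (1 / (2 * pi)) * arctan (0 / e)"
  proof (rule nn_integral_FTC_atLeast)
    fix x :: real
    have "((\<lambda>x. 1 / (2 * pi) * arctan (x / e)) has_real_derivative 1 / (2 * pi) * (inverse (1 + (x / e)\<^sup>2) * (1 / e))) (at x)"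
      using e by (auto intro!: derivative_eq_intros)
    moreover have "1 / (2 * pi) * (inverse (1 + (x / e)\<^sup>2) * (1 / e)) = cauchy e x"
    proof -
      have "e\<^sup>2 + x\<^sup>2 > 0" using e by (simp add: add_pos_nonneg)
      moreover have "1 + (x / e)\<^sup>2 = (e\<^sup>2 + x\<^sup>2) / e\<^sup>2" using e by (simp add: field_simps power2_eq_square)
      ultimately show ?thesis using e by (simp add: cauchy_def field_simps power2_eq_square)
    qed
    ultimately show "((\<lambda>x. 1 / (2 * pi) * arctan (x / e)) has_real_derivative cauchy e x) (at x)" by simp
    have "filterlim (\<lambda>x. x / e) at_top at_top"
      using e filterlim_tendsto_pos_mult_at_top[OF tendsto_const[of "1 / e"] _ filterlim_ident] by simp
    from tendsto_mult[OF tendsto_const[of "1 / (2 * pi)"] filterlim_compose[OF tendsto_arctan_at_top this]]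
    show "((\<lambda>x. 1 / (2 * pi) * arctan (x / e)) \<longlongrightarrow> 1 / (2 * pi) * (pi / 2)) at_top" .
  qed (use e in \<open>auto simp: cauchy_nonneg\<close>)
  also have "\<dots> \<le> 1" by simp
  finally show ?thesis .
qed

lemma nn_integral_cauchy_shift:
  assumes e: "e > 0"
  shows "(\<integral>\<^sup>+ t. ennreal (of_bool (s < t) * cauchy e (t - s)) \<partial>lebesgue) \<le> 1"
    and "(\<integral>\<^sup>+ s. ennreal (of_bool (s < t) * cauchy e (t - s)) \<partial>lebesgue) \<le> 1"
proof -
  have "(\<integral>\<^sup>+ t. ennreal (of_bool (s < t) * cauchy e (t - s)) \<partial>lborel) = (\<integral>\<^sup>+ x. ennreal (of_bool (0 < x) * cauchy e x) \<partial>lborel)"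
    by (subst nn_integral_real_affine[where c = 1 and t = s]) simp_all
  then show "(\<integral>\<^sup>+ t. ennreal (of_bool (s < t) * cauchy e (t - s)) \<partial>lebesgue) \<le> 1"
    unfolding nn_integral_completion by (simp only: nn_integral_cauchy_half[OF e])
  have "(\<integral>\<^sup>+ s. ennreal (of_bool (s < t) * cauchy e (t - s)) \<partial>lborel) = (\<integral>\<^sup>+ x. ennreal (of_bool (0 < x) * cauchy e x) \<partial>lborel)"
    by (subst nn_integral_real_affine[where c = "-1" and t = t]) simp_all
  then show "(\<integral>\<^sup>+ s. ennreal (of_bool (s < t) * cauchy e (t - s)) \<partial>lebesgue) \<le> 1"
    unfolding nn_integral_completion by (simp only: nn_integral_cauchy_half[OF e])
qed

text \<open>
  The product is split as \<open>(x\<^sup>2 y\<^sup>2) (x y R)\<close>; the free parameter \<open>l\<close> balances the two squares. This is a pointwise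
  form of Young's convolution inequality for the exponents 4/3, 2 and 4/3.
\<close>

lemma cubic_pointwise_bound:
  fixes x y R l :: real
  assumes "l > 0"
  shows "x ^ 3 * y ^ 3 * R \<le> l * (x ^ 4 * y ^ 4) + (1 / l) * ((x ^ 4 + y ^ 4) * R\<^sup>2)"
proof -
  have "0 \<le> (sqrt l * (x\<^sup>2 * y\<^sup>2) - (1 / sqrt l) * (x * y * R))\<^sup>2" by simp
  also have "\<dots> = (sqrt l)\<^sup>2 * (x ^ 4 * y ^ 4) + (1 / (sqrt l)\<^sup>2) * (x\<^sup>2 * y\<^sup>2 * R\<^sup>2) - 2 * (sqrt l * (1 / sqrt l)) * (x ^ 3 * y ^ 3 * R)"
    by (simp add: power2_eq_square power3_eq_cube power4_eq_xxxx algebra_simps)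
  also have "\<dots> = l * (x ^ 4 * y ^ 4) + (1 / l) * (x\<^sup>2 * y\<^sup>2 * R\<^sup>2) - 2 * (x ^ 3 * y ^ 3 * R)"
    using assms by simp
  finally have 1: "2 * (x ^ 3 * y ^ 3 * R) \<le> l * (x ^ 4 * y ^ 4) + (1 / l) * (x\<^sup>2 * y\<^sup>2 * R\<^sup>2)" by simp
  have "2 * (x\<^sup>2 * y\<^sup>2) \<le> x ^ 4 + y ^ 4"
    using sum_squares_bound[of "x\<^sup>2" "y\<^sup>2"] by (simp add: power_mult[symmetric] flip: power_mult)
  then have "2 * (x\<^sup>2 * y\<^sup>2) * R\<^sup>2 \<le> (x ^ 4 + y ^ 4) * R\<^sup>2" by (intro mult_right_mono) auto
  then have "(1 / l) * (2 * (x\<^sup>2 * y\<^sup>2) * R\<^sup>2) \<le> (1 / l) * ((x ^ 4 + y ^ 4) * R\<^sup>2)"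
    using assms by (intro mult_left_mono) auto
  moreover have "0 \<le> l * (x ^ 4 * y ^ 4)" "0 \<le> (1 / l) * ((x ^ 4 + y ^ 4) * R\<^sup>2)" using assms by auto
  moreover have "(1 / l) * (2 * (x\<^sup>2 * y\<^sup>2) * R\<^sup>2) = 2 * ((1 / l) * (x\<^sup>2 * y\<^sup>2 * R\<^sup>2))" by simp
  ultimately show ?thesis using 1 by linarith
qed

lemma sqrt_cauchy_le:
  assumes "e > 0" "0 < d" "d \<le> \<tau>"
  shows "sqrt (cauchy e \<tau>) \<le> sqrt e / d"
proof -
  have "cauchy e \<tau> \<le> e / d\<^sup>2"
    unfolding cauchy_def
  proof (rule divide_left_mono)
    have "d\<^sup>2 \<le> \<tau>\<^sup>2" using assms by (intro power_mono) auto
    also have "\<dots> \<le> 1 * (e\<^sup>2 + \<tau>\<^sup>2)" by simp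
    also have "\<dots> \<le> 2 * pi * (e\<^sup>2 + \<tau>\<^sup>2)" using pi_gt3 by (intro mult_right_mono) auto
    finally show "d\<^sup>2 \<le> 2 * pi * (e\<^sup>2 + \<tau>\<^sup>2)" .
    show "0 < 2 * pi * (e\<^sup>2 + \<tau>\<^sup>2) * d\<^sup>2" using assms by (auto intro!: mult_pos_pos add_pos_nonneg)
  qed (use assms in auto)
  then have "sqrt (cauchy e \<tau>) \<le> sqrt (e / d\<^sup>2)" by (rule real_sqrt_le_mono)
  also have "\<dots> = sqrt e / d" using assms by (simp add: real_sqrt_divide)
  finally show ?thesis .
qed

text \<open>
  Let \<open>Z k\<close> be the set of pairs where \<open>q\<close> exceeds \<open>k\<close> at one of the two times or the times are closer than
  \<open>1 / (k + 1)\<close>. On \<open>Z k\<close> the pointwise bound with parameter \<open>l\<close> gives \<open>l\<close> times the integral of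
  \<open>q(s)\<^sup>4 q(t)\<^sup>4\<close> over \<open>Z k\<close>, plus a multiple of \<open>1 / l\<close>, since the Cauchy kernels have bounded mass uniformly in the
  width. Off \<open>Z k\<close> everything is bounded by a constant times the square root of the width. As \<open>k\<close> grows the sets \<open>Z k\<close>
  shrink to the diagonal, a null set. The choices are made in the order \<open>l\<close>, \<open>k\<close>, \<open>n\<close>.
\<close>

lemma kernel_error_tendsto_0:
  fixes q :: "real \<Rightarrow> real"
  assumes q [measurable]: "q \<in> borel_measurable lebesgue" and q0: "\<And>t. 0 \<le> q t"
    and supp: "\<And>t. t \<notin> {0..T} \<Longrightarrow> q t = 0"
    and fin: "(\<integral>\<^sup>+ t. ennreal (q t ^ 4) \<partial>lebesgue) < \<infinity>"
  shows "(\<lambda>n. \<integral>\<^sup>+ p. ennreal (of_bool (fst p < snd p) * sqrt (cauchy (1 / Suc n) (snd p - fst p)) * (q (fst p) ^ 3 * q (snd p) ^ 3))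
    \<partial>(lebesgue \<Otimes>\<^sub>M lebesgue)) \<longlonglongrightarrow> 0"
    (is "?E \<longlonglongrightarrow> 0")
proof -
  let ?P = "lebesgue \<Otimes>\<^sub>M lebesgue :: (real \<times> real) measure"
  define a where "a = enn2real (\<integral>\<^sup>+ t. ennreal (q t ^ 4) \<partial>lebesgue)"
  have a: "(\<integral>\<^sup>+ t. ennreal (q t ^ 4) \<partial>lebesgue) = ennreal a" "0 \<le> a"
    using fin by (auto simp: a_def)
  define Z where "Z k p \<longleftrightarrow> real k < q (fst p) \<or> real k < q (snd p) \<or> snd p - fst p < 1 / Suc k" for k :: nat and p
  have [measurable]: "Measurable.pred ?P (Z k)" for k unfolding Z_def by measurable
  let ?W = "\<lambda>k p. ennreal (of_bool (fst p < snd p \<and> Z k p) * (q (fst p) ^ 4 * q (snd p) ^ 4))"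
  define w where "w k = (\<integral>\<^sup>+ p. ?W k p \<partial>?P)" for k
  have Qfin: "(\<integral>\<^sup>+ p. ennreal (q (fst p) ^ 4 * q (snd p) ^ 4) \<partial>?P) = ennreal (a * a)"
  proof -
    have "(\<integral>\<^sup>+ p. ennreal (q (fst p) ^ 4 * q (snd p) ^ 4) \<partial>?P) = (\<integral>\<^sup>+ s. \<integral>\<^sup>+ t. ennreal (q s ^ 4) * ennreal (q t ^ 4) \<partial>lebesgue \<partial>lebesgue)"
      by (subst leb.nn_integral_fst[symmetric]) (simp_all add: ennreal_mult q0)
    also have "\<dots> = (\<integral>\<^sup>+ s. ennreal (q s ^ 4) * ennreal a \<partial>lebesgue)"
      by (subst nn_integral_cmult) (simp_all add: a)
    also have "\<dots> = ennreal (a * a)"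
      by (subst nn_integral_multc) (simp_all add: a ennreal_mult)
    finally show ?thesis .
  qed
  have w_lim: "w \<longlonglongrightarrow> 0"
  proof -
    have "(\<lambda>k. \<integral>\<^sup>+ p. ?W k p \<partial>?P) \<longlonglongrightarrow> (\<integral>\<^sup>+ p. 0 \<partial>?P)"
    proof (rule nn_integral_dominated_convergence[where w = "\<lambda>p. ennreal (q (fst p) ^ 4 * q (snd p) ^ 4)"])
      show "AE p in ?P. (\<lambda>k. ?W k p) \<longlonglongrightarrow> 0"
      proof (rule AE_I2)
        fix p :: "real \<times> real"
        have "eventually (\<lambda>k. \<not> (fst p < snd p \<and> Z k p)) sequentially"
        proof (cases "fst p < snd p")
          case True
          have "eventually (\<lambda>k. q (fst p) \<le> real k) sequentially" "eventually (\<lambda>k. q (snd p) \<le> real k) sequentially"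
            using filterlim_real_sequentially by (auto simp: filterlim_at_top)
          moreover have "eventually (\<lambda>k. 1 / real (Suc k) < snd p - fst p) sequentially"
            using True by (intro order_tendstoD(2)[OF LIMSEQ_Suc[OF lim_1_over_n]]) simp
          ultimately show ?thesis by eventually_elim (auto simp: Z_def)
        qed simp
        then have "eventually (\<lambda>k. ?W k p = 0) sequentially"
          by eventually_elim simp
        then show "(\<lambda>k. ?W k p) \<longlonglongrightarrow> 0"
          by (rule tendsto_eventually)
      qed
      show "AE p in ?P. ?W k p \<le> ennreal (q (fst p) ^ 4 * q (snd p) ^ 4)" for k
        by (intro AE_I2 ennreal_leI) (auto simp: q0)
      show "(\<integral>\<^sup>+ p. ennreal (q (fst p) ^ 4 * q (snd p) ^ 4) \<partial>?P) < \<infinity>" by (simp add: Qfin)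
    qed measurable
    then show ?thesis by (simp add: w_def[abs_def])
  qed
  have bound: "?E n \<le> ennreal l * w k + ennreal ((1 / l) * (2 * a)) + ennreal (real k ^ 6 * real (Suc k) * sqrt (1 / Suc n) * (T\<^sup>2))"
    if l: "l > 0" for n k l
  proof -
    let ?e = "1 / real (Suc n)"
    have e: "?e > 0" by simp
    let ?f1 = "\<lambda>p. ennreal l * ?W k p"
    let ?c = "\<lambda>p. ennreal (of_bool (fst p < snd p) * cauchy ?e (snd p - fst p))"
    let ?f2 = "\<lambda>p. ennreal (1 / l) * (ennreal (q (fst p) ^ 4) * ?c p)"
    let ?f3 = "\<lambda>p. ennreal (1 / l) * (ennreal (q (snd p) ^ 4) * ?c p)"
    let ?f4 = "\<lambda>p. ennreal (real k ^ 6 * real (Suc k) * sqrt ?e) * (indicator {0..T} (fst p) * indicator {0..T} (snd p))"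
    have pw: "ennreal (of_bool (fst p < snd p) * sqrt (cauchy ?e (snd p - fst p)) * (q (fst p) ^ 3 * q (snd p) ^ 3))
      \<le> ?f1 p + ?f2 p + ?f3 p + ?f4 p" for p
    proof (cases "fst p < snd p \<and> fst p \<in> {0..T} \<and> snd p \<in> {0..T}")
      case False
      then have "of_bool (fst p < snd p) * sqrt (cauchy ?e (snd p - fst p)) * (q (fst p) ^ 3 * q (snd p) ^ 3) = 0"
        using supp[of "fst p"] supp[of "snd p"] by auto
      then show ?thesis by (simp only: ennreal_0 zero_le)
    next
      case True
      let ?x = "q (fst p)" and ?y = "q (snd p)" and ?R = "sqrt (cauchy ?e (snd p - fst p))"
      have R0: "0 \<le> ?R" using cauchy_nonneg[OF e] by simp
      have R2: "?R\<^sup>2 = cauchy ?e (snd p - fst p)" using cauchy_nonneg[OF e] by simp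
      show ?thesis
      proof (cases "Z k p")
        case Zt: True
        have "?x ^ 3 * ?y ^ 3 * ?R \<le> l * (?x ^ 4 * ?y ^ 4) + (1 / l) * ((?x ^ 4 + ?y ^ 4) * ?R\<^sup>2)"
          by (rule cubic_pointwise_bound[OF l])
        also have "\<dots> = l * (?x ^ 4 * ?y ^ 4) + (1 / l) * (?x ^ 4 * ?R\<^sup>2) + (1 / l) * (?y ^ 4 * ?R\<^sup>2)"
          by (simp add: algebra_simps)
        finally have "ennreal (?x ^ 3 * ?y ^ 3 * ?R) \<le> ennreal (l * (?x ^ 4 * ?y ^ 4) + (1 / l) * (?x ^ 4 * ?R\<^sup>2) + (1 / l) * (?y ^ 4 * ?R\<^sup>2))"
          by (rule ennreal_leI)
        also have "\<dots> = ennreal (l * (?x ^ 4 * ?y ^ 4)) + ennreal ((1 / l) * (?x ^ 4 * ?R\<^sup>2)) + ennreal ((1 / l) * (?y ^ 4 * ?R\<^sup>2))"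
          using l q0 by (subst ennreal_plus; (subst ennreal_plus)?) auto
        also have "\<dots> = ?f1 p + ?f2 p + ?f3 p"
          using True Zt l q0 R2 by (simp add: ennreal_mult[symmetric] cauchy_nonneg[OF e])
        finally have "ennreal (?x ^ 3 * ?y ^ 3 * ?R) \<le> ?f1 p + ?f2 p + ?f3 p + ?f4 p"
          by (rule order_trans) simp
        then show ?thesis using True by (simp add: mult.commute)
      next
        case Zf: False
        then have xy: "?x \<le> real k" "?y \<le> real k" "1 / real (Suc k) \<le> snd p - fst p"
          by (auto simp: Z_def)
        have "?R \<le> sqrt ?e / (1 / real (Suc k))"
          by (rule sqrt_cauchy_le[OF e _ xy(3)]) simp
        also have "\<dots> = real (Suc k) * sqrt ?e" by simp
        finally have "?x ^ 3 * ?y ^ 3 * ?R \<le> real k ^ 3 * real k ^ 3 * (real (Suc k) * sqrt ?e)"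
          using xy q0 R0 by (intro mult_mono power_mono) auto
        also have "\<dots> = real k ^ 6 * real (Suc k) * sqrt ?e"
          by (simp add: power_add[symmetric] mult.assoc)
        finally have "ennreal (?x ^ 3 * ?y ^ 3 * ?R) \<le> ennreal (real k ^ 6 * real (Suc k) * sqrt ?e)"
          by (rule ennreal_leI)
        also have "\<dots> = ?f4 p" using True by simp
        finally have "ennreal (?x ^ 3 * ?y ^ 3 * ?R) \<le> ?f1 p + ?f2 p + ?f3 p + ?f4 p"
          by (rule order_trans) simp
        then show ?thesis using True by (simp add: mult.commute)
      qed
    qed
    have m: "?f1 \<in> borel_measurable ?P" "?f2 \<in> borel_measurable ?P" "?f3 \<in> borel_measurable ?P" "?f4 \<in> borel_measurable ?P"
      by measurable
    have "?E n \<le> (\<integral>\<^sup>+ p. ?f1 p + ?f2 p + ?f3 p + ?f4 p \<partial>?P)"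
      by (intro nn_integral_mono pw)
    also have "\<dots> = (\<integral>\<^sup>+ p. ?f1 p \<partial>?P) + (\<integral>\<^sup>+ p. ?f2 p \<partial>?P) + (\<integral>\<^sup>+ p. ?f3 p \<partial>?P) + (\<integral>\<^sup>+ p. ?f4 p \<partial>?P)"
      by (simp only: nn_integral_add borel_measurable_add m)
    also have "(\<integral>\<^sup>+ p. ?f1 p \<partial>?P) = ennreal l * w k"
      unfolding w_def by (rule nn_integral_cmult) measurable
    also have "(\<integral>\<^sup>+ p. ?f2 p \<partial>?P) \<le> ennreal (1 / l * a)"
    proof -
      have "(\<integral>\<^sup>+ p. ?f2 p \<partial>?P) = ennreal (1 / l) * (\<integral>\<^sup>+ p. ennreal (q (fst p) ^ 4) * ?c p \<partial>?P)"
        by (rule nn_integral_cmult) measurable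
      also have "(\<integral>\<^sup>+ p. ennreal (q (fst p) ^ 4) * ?c p \<partial>?P)
          = (\<integral>\<^sup>+ s. \<integral>\<^sup>+ t. ennreal (q s ^ 4) * ennreal (of_bool (s < t) * cauchy ?e (t - s)) \<partial>lebesgue \<partial>lebesgue)"
        by (subst leb.nn_integral_fst[symmetric]) simp_all
      also have "\<dots> = (\<integral>\<^sup>+ s. ennreal (q s ^ 4) * (\<integral>\<^sup>+ t. ennreal (of_bool (s < t) * cauchy ?e (t - s)) \<partial>lebesgue) \<partial>lebesgue)"
        by (intro nn_integral_cong nn_integral_cmult) measurable
      also have "\<dots> \<le> (\<integral>\<^sup>+ s. ennreal (q s ^ 4) * 1 \<partial>lebesgue)"
        by (intro nn_integral_mono mult_left_mono nn_integral_cauchy_shift e) auto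
      finally show ?thesis using l a by (simp add: mult_left_mono flip: ennreal_mult)
    qed
    also have "(\<integral>\<^sup>+ p. ?f3 p \<partial>?P) \<le> ennreal (1 / l * a)"
    proof -
      have "(\<integral>\<^sup>+ p. ?f3 p \<partial>?P) = ennreal (1 / l) * (\<integral>\<^sup>+ p. ennreal (q (snd p) ^ 4) * ?c p \<partial>?P)"
        by (rule nn_integral_cmult) measurable
      also have "(\<integral>\<^sup>+ p. ennreal (q (snd p) ^ 4) * ?c p \<partial>?P)
          = (\<integral>\<^sup>+ t. \<integral>\<^sup>+ s. ennreal (q t ^ 4) * ennreal (of_bool (s < t) * cauchy ?e (t - s)) \<partial>lebesgue \<partial>lebesgue)"
        by (subst leb_pair.nn_integral_snd[symmetric]) simp_all
      also have "\<dots> = (\<integral>\<^sup>+ t. ennreal (q t ^ 4) * (\<integral>\<^sup>+ s. ennreal (of_bool (s < t) * cauchy ?e (t - s)) \<partial>lebesgue) \<partial>lebesgue)"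
        by (intro nn_integral_cong nn_integral_cmult) measurable
      also have "\<dots> \<le> (\<integral>\<^sup>+ t. ennreal (q t ^ 4) * 1 \<partial>lebesgue)"
        by (intro nn_integral_mono mult_left_mono nn_integral_cauchy_shift e) auto
      finally show ?thesis using l a by (simp add: mult_left_mono flip: ennreal_mult)
    qed
    also have "(\<integral>\<^sup>+ p. ?f4 p \<partial>?P) \<le> ennreal (real k ^ 6 * real (Suc k) * sqrt ?e * (T\<^sup>2))"
    proof -
      have "(\<integral>\<^sup>+ p. ?f4 p \<partial>?P) = ennreal (real k ^ 6 * real (Suc k) * sqrt ?e) * (\<integral>\<^sup>+ p. indicator {0..T} (fst p) * indicator {0..T} (snd p) \<partial>?P)"
        by (rule nn_integral_cmult) measurable
      also have "(\<integral>\<^sup>+ p. indicator {0..T} (fst p) * indicator {0..T} (snd p) \<partial>?P)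
          = (\<integral>\<^sup>+ s. \<integral>\<^sup>+ t. indicator {0..T} s * indicator {0..T} t \<partial>lebesgue \<partial>lebesgue)"
        by (subst leb.nn_integral_fst[symmetric]) simp_all
      also have "\<dots> = (\<integral>\<^sup>+ s. indicator {0..T} s * emeasure lebesgue {0..T} \<partial>lebesgue)"
        by (intro nn_integral_cong) (simp add: nn_integral_cmult)
      also have "\<dots> = emeasure lebesgue {0..T} * emeasure lebesgue {0..T}"
        by (simp add: nn_integral_multc)
      also have "\<dots> \<le> ennreal (T\<^sup>2)"
        by (cases "0 \<le> T") (auto simp: power2_eq_square ennreal_mult)
      finally show ?thesis by (simp add: ennreal_mult mult_left_mono)
    qed
    finally have "?E n \<le> ennreal l * w k + ennreal (1 / l * a) + ennreal (1 / l * a) + ennreal (real k ^ 6 * real (Suc k) * sqrt ?e * (T\<^sup>2))"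
      by (simp add: add_mono)
    also have "ennreal l * w k + ennreal (1 / l * a) + ennreal (1 / l * a) = ennreal l * w k + ennreal ((1 / l) * (2 * a))"
      using l a by (simp add: add.assoc flip: ennreal_plus)
    finally show ?thesis .
  qed
  show ?thesis
  proof (rule order_tendstoI)
    fix c :: ennreal assume "0 < c"
    then obtain c' where c': "0 < c'" "c' < c" using dense by blast
    then obtain d where d: "c' = ennreal d" "0 < d" by (cases c') (auto simp: top_unique)
    \<comment> \<open>The summand 1 keeps \<open>l\<close> positive when \<open>a = 0\<close>.\<close>
    define l where "l = (2 * a + 1) * 4 / d"
    have l: "l > 0" using d a by (simp add: l_def)
    have al: "(1 / l) * (2 * a) \<le> d / 4" using d a by (simp add: l_def field_simps)
    have "(\<lambda>k. ennreal l * w k) \<longlonglongrightarrow> ennreal l * 0"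
      by (rule ennreal_tendsto_cmult[OF _ w_lim]) simp
    then have "eventually (\<lambda>k. ennreal l * w k < ennreal (d / 4)) sequentially"
      by (rule order_tendstoD(2)) (use d in simp)
    then obtain k where k: "ennreal l * w k < ennreal (d / 4)" by (auto simp: eventually_sequentially)
    have "(\<lambda>n. real k ^ 6 * real (Suc k) * sqrt (1 / Suc n) * (T\<^sup>2)) \<longlonglongrightarrow> real k ^ 6 * real (Suc k) * sqrt 0 * (T\<^sup>2)"
      by (intro tendsto_intros LIMSEQ_Suc[OF lim_1_over_n])
    then have "eventually (\<lambda>n. real k ^ 6 * real (Suc k) * sqrt (1 / Suc n) * (T\<^sup>2) < d / 4) sequentially"
      by (rule order_tendstoD(2)) (use d in simp)
    then show "eventually (\<lambda>n. ?E n < c) sequentially"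
    proof eventually_elim
      fix n assume n: "real k ^ 6 * real (Suc k) * sqrt (1 / Suc n) * (T\<^sup>2) < d / 4"
      have "?E n \<le> ennreal l * w k + ennreal ((1 / l) * (2 * a)) + ennreal (real k ^ 6 * real (Suc k) * sqrt (1 / Suc n) * (T\<^sup>2))"
        by (rule bound[OF l])
      also have "\<dots> \<le> ennreal (d / 4) + ennreal (d / 4) + ennreal (d / 4)"
        using k al n by (intro add_mono ennreal_leI) auto
      also have "\<dots> \<le> ennreal d" using d by (simp flip: ennreal_plus)
      also have "\<dots> < c" using c' d by simp
      finally show "?E n < c" .
    qed
  qed simp
qed

section \<open>Dissipativity of the Duhamel kernel\<close>

text \<open>
  The regularisation \<open>(4 \<pi> (e + i \<tau>))\<^sup>-\<^sup>1\<^sup>/\<^sup>2\<close> of the free propagator from the origin to the origin.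
\<close>

definition duhamel_kernel :: "real \<Rightarrow> real \<Rightarrow> complex" where
  "duhamel_kernel e \<tau> = heat_kernel (of_real e + \<i> * of_real \<tau>) 0"

lemma duhamel_kernel_gauss_integral: "duhamel_kernel e \<tau> = gauss_integral (Complex e \<tau>) / (2 * of_real pi)"
  by (simp add: duhamel_kernel_def heat_kernel_0 Complex_eq)

lemma cnj_duhamel_kernel: "cnj (duhamel_kernel e \<tau>) = duhamel_kernel e (- \<tau>)"
  by (simp add: duhamel_kernel_def cnj_heat_kernel)

lemma continuous_duhamel_kernel: "e > 0 \<Longrightarrow> continuous_on UNIV (duhamel_kernel e)"
proof -
  assume e: "e > 0"
  have "continuous_on UNIV (\<lambda>t. gauss_integral (Complex e t))"
    using has_vector_derivative_continuous[OF gauss_integral_deriv[OF e]] by (simp add: continuous_on_eq_continuous_at)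
  then show ?thesis unfolding duhamel_kernel_gauss_integral[abs_def] by (intro continuous_intros) auto
qed

lemma duhamel_kernel_measurable [measurable (raw)]:
  assumes "e > 0" shows "f \<in> borel_measurable M \<Longrightarrow> (\<lambda>x. duhamel_kernel e (f x)) \<in> borel_measurable M"
  by (rule measurable_compose[OF _ borel_measurable_continuous_onI[OF continuous_duhamel_kernel[OF assms]]])

lemma duhamel_kernel_bounded:
  assumes e: "e > 0" shows "\<exists>C\<ge>0. \<forall>\<tau>. cmod (duhamel_kernel e \<tau>) \<le> C"
proof (intro exI conjI allI)
  fix \<tau>
  let ?C = "(LINT \<xi>|lborel. exp (- (e * \<xi>\<^sup>2))) / (2 * pi)"
  have "cmod (gauss_integral (Complex e \<tau>)) \<le> (LINT \<xi>|lborel. cmod (gauss_symbol (Complex e \<tau>) \<xi>))"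
    unfolding gauss_integral_def by (rule integral_norm_bound)
  then show "cmod (duhamel_kernel e \<tau>) \<le> ?C"
    by (simp add: duhamel_kernel_gauss_integral norm_divide divide_right_mono)
  show "0 \<le> ?C" by simp
qed

lemma duhamel_kernel_square:
  assumes e: "e > 0" shows "(duhamel_kernel e \<tau>)\<^sup>2 = 1 / (4 * of_real pi * Complex e \<tau>)"
  using gauss_integral_square[of "Complex e \<tau>"] e
  by (simp add: duhamel_kernel_gauss_integral power_divide power2_eq_square field_simps)

text \<open>
  With \<open>k\<close> the Duhamel kernel and \<open>\<rho> = |e + i \<tau>|\<close>, the square of the left side is \<open>2 |k|\<^sup>2 + 2 Im (k\<^sup>2)\<close>, and
  \<open>k\<^sup>2 = 1 / (4 \<pi> (e + i \<tau>))\<close>. This equals \<open>(\<rho> - \<tau>) / (2 \<pi> \<rho>\<^sup>2)\<close>, and \<open>\<rho> - \<tau> \<le> e\<close>.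
\<close>

lemma duhamel_kernel_error:
  assumes e: "e > 0" and \<tau>: "\<tau> > 0"
  shows "cmod (- \<i> * duhamel_kernel e \<tau> + duhamel_kernel e (- \<tau>)) \<le> sqrt (cauchy e \<tau>)"
proof (rule real_le_rsqrt)
  let ?k = "duhamel_kernel e \<tau>" and ?z = "Complex e \<tau>"
  define \<rho> where "\<rho> = cmod ?z"
  have \<rho>2: "\<rho>\<^sup>2 = e\<^sup>2 + \<tau>\<^sup>2" by (simp add: \<rho>_def cmod_power2)
  have \<rho>0: "\<rho> > 0" using e by (simp add: \<rho>_def complex_eq_iff)
  have "(cmod (- \<i> * ?k + cnj ?k))\<^sup>2 = 2 * (cmod ?k)\<^sup>2 + 2 * Im (?k\<^sup>2)"
    unfolding cmod_power2 by (simp add: power2_eq_square algebra_simps)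
  also have "(cmod ?k)\<^sup>2 = 1 / (4 * pi * \<rho>)"
    unfolding norm_power[symmetric] duhamel_kernel_square[OF e] by (simp add: norm_divide norm_mult \<rho>_def)
  also have "Im (?k\<^sup>2) = - \<tau> / (4 * pi * \<rho>\<^sup>2)"
  proof -
    have "1 / (4 * of_real pi * ?z) = of_real (1 / (4 * pi)) * inverse ?z" by (simp add: field_simps)
    then show ?thesis unfolding duhamel_kernel_square[OF e] by (simp add: \<rho>2)
  qed
  also have "2 * (1 / (4 * pi * \<rho>)) + 2 * (- \<tau> / (4 * pi * \<rho>\<^sup>2)) = (\<rho> - \<tau>) / (2 * pi * \<rho>\<^sup>2)"
    using \<rho>0 by (simp add: field_simps power2_eq_square)
  also have "\<dots> \<le> e / (2 * pi * \<rho>\<^sup>2)"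
  proof (rule divide_right_mono)
    have "\<rho> \<le> \<bar>e\<bar> + \<bar>\<tau>\<bar>" using cmod_le[of ?z] by (simp add: \<rho>_def)
    then show "\<rho> - \<tau> \<le> e" using e \<tau> by simp
  qed simp
  also have "\<dots> = cauchy e \<tau>" by (simp add: cauchy_def \<rho>2)
  finally show "(cmod (- \<i> * duhamel_kernel e \<tau> + duhamel_kernel e (- \<tau>)))\<^sup>2 \<le> cauchy e \<tau>" by (simp only: cnj_duhamel_kernel)
qed

lemma lebesgue_prod_integrable:
  fixes f g :: "real \<Rightarrow> complex"
  assumes f: "integrable lebesgue f" and g: "integrable lebesgue g"
  shows "integrable (lebesgue \<Otimes>\<^sub>M lebesgue) (\<lambda>p. f (fst p) * g (snd p))"
    and "(LINT p|(lebesgue \<Otimes>\<^sub>M lebesgue). f (fst p) * g (snd p)) = (LINT s|lebesgue. f s) * (LINT t|lebesgue. g t)"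
proof -
  have [measurable]: "f \<in> borel_measurable lebesgue" "g \<in> borel_measurable lebesgue" using f g by auto
  show i: "integrable (lebesgue \<Otimes>\<^sub>M lebesgue) (\<lambda>p. f (fst p) * g (snd p))"
    by (rule leb_pair.Fubini_integrable) (use f g in \<open>simp_all add: norm_mult\<close>)
  show "(LINT p|(lebesgue \<Otimes>\<^sub>M lebesgue). f (fst p) * g (snd p)) = (LINT s|lebesgue. f s) * (LINT t|lebesgue. g t)"
    using leb_pair.integral_fst'[OF i] by simp
qed

lemma bounded_mult_integrable:
  fixes f g :: "'a \<Rightarrow> complex"
  assumes "integrable M f" and [measurable]: "g \<in> borel_measurable M" and "\<And>x. cmod (g x) \<le> C"
  shows "integrable M (\<lambda>x. g x * f x)"
proof (rule Bochner_Integration.integrable_bound)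
  show "integrable M (\<lambda>x. of_real C * f x)" using assms(1) by (rule integrable_mult_right)
  have [measurable]: "f \<in> borel_measurable M" using assms(1) by auto
  show "(\<lambda>x. g x * f x) \<in> borel_measurable M" by measurable
  show "AE x in M. cmod (g x * f x) \<le> cmod (of_real C * f x)"
  proof (rule AE_I2)
    fix x
    have "cmod (g x) \<le> \<bar>C\<bar>" using assms(3)[of x] by linarith
    then show "cmod (g x * f x) \<le> cmod (of_real C * f x)" by (simp add: norm_mult mult_right_mono)
  qed
qed

text \<open>
  The kernel is a superposition of the characters \<open>exp (- i (s - t) \<xi>\<^sup>2)\<close> with the positive weights
  \<open>exp (- e \<xi>\<^sup>2)\<close>, so the quadratic form is an integral of squares of absolute values.
\<close>

lemma duhamel_kernel_posdef:
  assumes F: "integrable lebesgue F" and e: "e > 0"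
  shows "0 \<le> Re (LINT p|(lebesgue \<Otimes>\<^sub>M lebesgue). duhamel_kernel e (fst p - snd p) * (F (fst p) * cnj (F (snd p))))"
proof -
  let ?P = "lebesgue \<Otimes>\<^sub>M lebesgue :: (real \<times> real) measure"
  have [measurable]: "F \<in> borel_measurable lebesgue" using F by auto
  interpret P: pair_sigma_finite ?P "lborel :: real measure"
    by (intro pair_sigma_finite.intro leb_pair.sigma_finite_measure_axioms sigma_finite_lborel)
  define W where "W p = F (fst p) * cnj (F (snd p))" for p
  have W: "integrable ?P W" unfolding W_def[abs_def]
    by (intro lebesgue_prod_integrable F integrable_cnj)
  have [measurable]: "W \<in> borel_measurable ?P" using W by auto
  define h where "h p \<xi> = cis (- ((fst p - snd p) * \<xi>\<^sup>2)) * gauss_symbol (of_real e) \<xi> * W p" for p :: "real \<times> real" and \<xi> :: real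
  have ge: "integrable lborel (gauss_symbol (of_real e))" using e by (intro integrable_gauss_symbol) simp
  have hi: "integrable (?P \<Otimes>\<^sub>M lborel) (\<lambda>(p, \<xi>). h p \<xi>)"
  proof (rule P.Fubini_integrable)
    have [measurable]: "(\<lambda>x. fst (fst x)) \<in> borel_measurable (?P \<Otimes>\<^sub>M lborel)" "(\<lambda>x. snd (fst x)) \<in> borel_measurable (?P \<Otimes>\<^sub>M lborel)"
      using measurable_compose[OF measurable_fst leb_fst] measurable_compose[OF measurable_fst leb_snd] by auto
    show "(\<lambda>(p, \<xi>). h p \<xi>) \<in> borel_measurable (?P \<Otimes>\<^sub>M lborel)"
      unfolding h_def split_beta' by measurable
    have "(\<lambda>p. LINT \<xi>|lborel. norm (case (p, \<xi>) of (p, \<xi>) \<Rightarrow> h p \<xi>)) = (\<lambda>p. (LINT \<xi>|lborel. exp (- (e * \<xi>\<^sup>2))) * norm (W p))"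
      by (simp add: h_def norm_mult)
    then show "integrable ?P (\<lambda>p. LINT \<xi>|lborel. norm (case (p, \<xi>) of (p, \<xi>) \<Rightarrow> h p \<xi>))"
      using W by simp
    show "AE p in ?P. integrable lborel (\<lambda>\<xi>. case (p, \<xi>) of (p, \<xi>) \<Rightarrow> h p \<xi>)"
      unfolding h_def prod.case
      by (intro AE_I2 integrable_mult_left integrable_cis_mult ge) measurable
  qed
  have duhamel_kernel_h: "duhamel_kernel e (fst p - snd p) * (F (fst p) * cnj (F (snd p))) = 1 / (2 * of_real pi) * (LINT \<xi>|lborel. h p \<xi>)" for p
  proof -
    have "(LINT \<xi>|lborel. h p \<xi>) = (LINT \<xi>|lborel. gauss_symbol (of_real e + \<i> * of_real (fst p - snd p)) \<xi>) * W p"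
      unfolding h_def gauss_symbol_shift by (rule integral_mult_left_zero)
    then show ?thesis by (simp add: duhamel_kernel_def heat_kernel_0 gauss_integral_def W_def)
  qed
  have slice: "(LINT p|?P. h p \<xi>) = of_real (exp (- e * \<xi>\<^sup>2) * (cmod (LINT s|lebesgue. cis (- (s * \<xi>\<^sup>2)) * F s))\<^sup>2)" for \<xi>
  proof -
    let ?f = "\<lambda>s. cis (- (s * \<xi>\<^sup>2)) * F s"
    have fi: "integrable lebesgue ?f" by (intro integrable_cis_mult F) measurable
    have "(LINT p|?P. h p \<xi>) = (LINT p|?P. gauss_symbol (of_real e) \<xi> * (?f (fst p) * cnj (?f (snd p))))"
    proof (intro Bochner_Integration.integral_cong refl)
      fix p :: "real \<times> real"
      have "cis (- ((fst p - snd p) * \<xi>\<^sup>2)) = cis (- (fst p * \<xi>\<^sup>2)) * cis (snd p * \<xi>\<^sup>2)"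
        by (simp add: cis_mult algebra_simps)
      then show "h p \<xi> = gauss_symbol (of_real e) \<xi> * (?f (fst p) * cnj (?f (snd p)))"
        by (simp add: h_def W_def cis_cnj mult_ac)
    qed
    also have "\<dots> = gauss_symbol (of_real e) \<xi> * ((LINT s|lebesgue. ?f s) * (LINT t|lebesgue. cnj (?f t)))"
      by (simp only: integral_mult_right_zero lebesgue_prod_integrable(2)[OF fi integrable_cnj[OF fi]])
    also have "(LINT t|lebesgue. cnj (?f t)) = cnj (LINT t|lebesgue. ?f t)" by (rule Bochner_Integration.integral_cnj)
    finally show ?thesis by (simp only: complex_norm_square[symmetric] gauss_symbol_of_real of_real_mult)
  qed
  have "(LINT p|?P. duhamel_kernel e (fst p - snd p) * (F (fst p) * cnj (F (snd p)))) = 1 / (2 * of_real pi) * (LINT p|?P. LINT \<xi>|lborel. h p \<xi>)"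
    unfolding duhamel_kernel_h by (rule integral_mult_right_zero)
  also have "(LINT p|?P. LINT \<xi>|lborel. h p \<xi>) = (LINT \<xi>|lborel. LINT p|?P. h p \<xi>)"
    by (rule P.Fubini_integral[OF hi, symmetric])
  also have "\<dots> = of_real (LINT \<xi>|lborel. exp (- e * \<xi>\<^sup>2) * (cmod (LINT s|lebesgue. cis (- (s * \<xi>\<^sup>2)) * F s))\<^sup>2)"
    unfolding slice by (rule integral_complex_of_real)
  also have "1 / (2 * of_real pi) * \<dots> = of_real (1 / (2 * pi) * (LINT \<xi>|lborel. exp (- e * \<xi>\<^sup>2) * (cmod (LINT s|lebesgue. cis (- (s * \<xi>\<^sup>2)) * F s))\<^sup>2))"
    by simp
  finally show ?thesis by (simp add: Bochner_Integration.integral_nonneg)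
qed

lemma AE_pair_neq: "AE p in (lebesgue \<Otimes>\<^sub>M lebesgue :: (real \<times> real) measure). fst p \<noteq> snd p"
proof (rule leb_pair.AE_pair_measure)
  show "{p \<in> space (lebesgue \<Otimes>\<^sub>M lebesgue :: (real \<times> real) measure). fst p \<noteq> snd p} \<in> sets (lebesgue \<Otimes>\<^sub>M lebesgue)"
    by measurable
  show "AE s in lebesgue. AE t in lebesgue. fst (s, t) \<noteq> snd (s, t :: real)"
  proof (rule AE_I2)
    fix s :: real
    have "AE t in lborel. t \<noteq> s" by (rule AE_lborel_singleton)
    then have "AE t in lebesgue. t \<noteq> s" by (rule AE_completion)
    then show "AE t in lebesgue. fst (s, t) \<noteq> snd (s, t)" by eventually_elim auto
  qed
qed

text \<open>
  Below, \<open>K\<close> is the Hermitian kernel restricted to \<open>s < t\<close> and \<open>K'\<close> its mirror image; together they give the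
  positive definite form, so the integral of \<open>K\<close> has nonnegative real part. The function \<open>E\<close> is the error made by
  replacing \<open>- i\<close> times the Duhamel kernel by \<open>- K\<close>.
\<close>

lemma duhamel_dissipation:
  assumes F: "integrable lebesgue F" and e: "e > 0"
  defines "H \<equiv> \<lambda>p. (of_bool (fst p < snd p) * duhamel_kernel e (snd p - fst p)) * (F (fst p) * cnj (F (snd p)))"
  shows "integrable (lebesgue \<Otimes>\<^sub>M lebesgue) H"
    and "ennreal (Re (- \<i> * (LINT p|(lebesgue \<Otimes>\<^sub>M lebesgue). H p))) \<le>
      (\<integral>\<^sup>+ p. ennreal (of_bool (fst p < snd p) * sqrt (cauchy e (snd p - fst p)) * (cmod (F (fst p)) * cmod (F (snd p)))) \<partial>(lebesgue \<Otimes>\<^sub>M lebesgue))"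
proof -
  let ?P = "lebesgue \<Otimes>\<^sub>M lebesgue :: (real \<times> real) measure"
  note [measurable] = duhamel_kernel_measurable[OF e]
  have [measurable]: "F \<in> borel_measurable lebesgue" using F by auto
  obtain C where C: "C \<ge> 0" "\<And>\<tau>. cmod (duhamel_kernel e \<tau>) \<le> C" using duhamel_kernel_bounded[OF e] by blast
  define W where "W p = F (fst p) * cnj (F (snd p))" for p
  have W: "integrable ?P W" unfolding W_def[abs_def]
    by (intro lebesgue_prod_integrable F integrable_cnj)
  have ii: "integrable ?P (\<lambda>p. (of_bool (Q p) * duhamel_kernel e (f p)) * W p)"
    if [measurable]: "Measurable.pred ?P Q" "f \<in> borel_measurable ?P" for Q f
  proof (rule bounded_mult_integrable[OF W])
    show "cmod (of_bool (Q p) * duhamel_kernel e (f p)) \<le> C" for p using C by (cases "Q p") auto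
  qed measurable
  show iH: "integrable ?P H" unfolding H_def W_def[symmetric] by (rule ii) measurable
  define K where "K p = (of_bool (fst p < snd p) * duhamel_kernel e (fst p - snd p)) * W p" for p
  define K' where "K' p = (of_bool (snd p < fst p) * duhamel_kernel e (fst p - snd p)) * W p" for p
  have iK: "integrable ?P K" "integrable ?P K'" unfolding K_def[abs_def] K'_def[abs_def] by (rule ii; measurable)+
  have "cnj (LINT p|?P. K p) = (LINT p|?P. cnj (K p))" by (rule Bochner_Integration.integral_cnj[symmetric])
  also have "\<dots> = (LINT p|?P. K' (snd p, fst p))"
    by (intro Bochner_Integration.integral_cong refl) (simp add: K_def K'_def W_def cnj_duhamel_kernel mult_ac)
  also have "\<dots> = (LINT p|?P. K' p)"
    using leb_pair.integral_product_swap[of K'] iK(2) by (simp add: split_beta')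
  finally have "(LINT p|?P. K p) + cnj (LINT p|?P. K p) = (LINT p|?P. K p + K' p)"
    using iK by simp
  also have "\<dots> = (LINT p|?P. duhamel_kernel e (fst p - snd p) * (F (fst p) * cnj (F (snd p))))"
  proof (rule integral_cong_AE)
    show "AE p in ?P. K p + K' p = duhamel_kernel e (fst p - snd p) * (F (fst p) * cnj (F (snd p)))"
      using AE_pair_neq by eventually_elim (auto simp: K_def K'_def W_def)
  qed (use iK in \<open>auto intro: borel_measurable_add\<close>)
  finally have eq: "(LINT p|?P. K p) + cnj (LINT p|?P. K p) = (LINT p|?P. duhamel_kernel e (fst p - snd p) * (F (fst p) * cnj (F (snd p))))" .
  have "2 * Re (LINT p|?P. K p) = Re ((LINT p|?P. K p) + cnj (LINT p|?P. K p))"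
    by (simp only: plus_complex.sel cnj.sel mult_2)
  then have pos: "0 \<le> Re (LINT p|?P. K p)"
    unfolding eq using duhamel_kernel_posdef[OF F e] by linarith
  define E where "E p = - \<i> * H p + K p" for p
  have E: "E p = of_bool (fst p < snd p) * (- \<i> * duhamel_kernel e (snd p - fst p) + duhamel_kernel e (- (snd p - fst p))) * W p" for p
    by (simp add: E_def H_def K_def W_def algebra_simps)
  have iE: "integrable ?P E" unfolding E_def[abs_def] by (intro Bochner_Integration.integrable_add integrable_mult_right iH iK)
  have "(LINT p|?P. E p) = - \<i> * (LINT p|?P. H p) + (LINT p|?P. K p)"
    unfolding E_def[abs_def] using iH iK(1) by (simp add: Bochner_Integration.integral_diff)
  then have "Re (- \<i> * (LINT p|?P. H p)) \<le> Re (LINT p|?P. E p)" using pos by simp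
  also have "\<dots> \<le> cmod (LINT p|?P. E p)" by (rule complex_Re_le_cmod)
  finally have "ennreal (Re (- \<i> * (LINT p|?P. H p))) \<le> ennreal (cmod (LINT p|?P. E p))" by (rule ennreal_leI)
  also have "\<dots> \<le> (\<integral>\<^sup>+ p. ennreal (cmod (E p)) \<partial>?P)" by (rule integral_norm_bound_ennreal[OF iE])
  also have "\<dots> \<le> (\<integral>\<^sup>+ p. ennreal (of_bool (fst p < snd p) * sqrt (cauchy e (snd p - fst p)) * (cmod (F (fst p)) * cmod (F (snd p)))) \<partial>?P)"
  proof (intro nn_integral_mono ennreal_leI)
    fix p
    show "cmod (E p) \<le> of_bool (fst p < snd p) * sqrt (cauchy e (snd p - fst p)) * (cmod (F (fst p)) * cmod (F (snd p)))"
    proof (cases "fst p < snd p")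
      case True
      have "cmod (- \<i> * duhamel_kernel e (snd p - fst p) + duhamel_kernel e (- (snd p - fst p))) * cmod (W p) \<le> sqrt (cauchy e (snd p - fst p)) * cmod (W p)"
        by (intro mult_right_mono duhamel_kernel_error e) (use True in auto)
      then show ?thesis using True unfolding E by (simp add: norm_mult W_def)
    qed (simp add: E)
  qed
  finally show "ennreal (Re (- \<i> * (LINT p|?P. H p))) \<le>
      (\<integral>\<^sup>+ p. ennreal (of_bool (fst p < snd p) * sqrt (cauchy e (snd p - fst p)) * (cmod (F (fst p)) * cmod (F (snd p)))) \<partial>?P)" .
qed

section \<open>The trace estimate for forward times\<close>

lemma young_quartic:
  fixes g x :: real
  shows "4 * (g * x ^ 3) \<le> g ^ 4 + 3 * x ^ 4"
proof -
  have "0 \<le> (g - x)\<^sup>2 * ((g + x)\<^sup>2 + 2 * x\<^sup>2)" by (intro mult_nonneg_nonneg) auto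
  also have "\<dots> = g ^ 4 + 3 * x ^ 4 - 4 * (g * x ^ 3)"
    by (simp add: power2_eq_square power3_eq_cube power4_eq_xxxx algebra_simps)
  finally show ?thesis by simp
qed

lemma norm_cubic: "cmod (cubic w) = cmod w ^ 3"
  by (simp add: cubic_def norm_mult norm_power power3_eq_cube power2_eq_square)

lemma cubic_cnj_mult: "w * cnj (cubic w) = of_real (cmod w ^ 4)"
proof -
  have "w * cnj (cubic w) = of_real ((cmod w)\<^sup>2) * (w * cnj w)" by (simp add: cubic_def mult_ac)
  also have "\<dots> = of_real ((cmod w)\<^sup>2 * (cmod w)\<^sup>2)" by (simp only: complex_norm_square[symmetric] of_real_mult)
  finally show ?thesis by (simp add: power2_eq_square power4_eq_xxxx mult.assoc)
qed

text \<open>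
  Finiteness of the integral of \<open>|q|\<^sup>4\<close> is what permits the absorption.
\<close>

lemma absorb_quartic:
  fixes q :: "real \<Rightarrow> complex" and g :: "real \<Rightarrow> ennreal"
  assumes [measurable]: "q \<in> borel_measurable lebesgue" "g \<in> borel_measurable lebesgue"
    and fin: "(\<integral>\<^sup>+ t. ennreal (cmod (q t) ^ 4) \<partial>lebesgue) < \<infinity>"
    and le: "(\<integral>\<^sup>+ t. ennreal (cmod (q t) ^ 4) \<partial>lebesgue) \<le> (\<integral>\<^sup>+ t. g t * ennreal (cmod (q t) ^ 3) \<partial>lebesgue)"
  shows "(\<integral>\<^sup>+ t. ennreal (cmod (q t) ^ 4) \<partial>lebesgue) \<le> (\<integral>\<^sup>+ t. g t ^ 4 \<partial>lebesgue)"
proof -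
  let ?a = "\<integral>\<^sup>+ t. ennreal (cmod (q t) ^ 4) \<partial>lebesgue" and ?G = "\<integral>\<^sup>+ t. g t ^ 4 \<partial>lebesgue"
  have "4 * ?a \<le> 4 * (\<integral>\<^sup>+ t. g t * ennreal (cmod (q t) ^ 3) \<partial>lebesgue)" by (intro mult_left_mono le) simp
  also have "\<dots> = (\<integral>\<^sup>+ t. 4 * (g t * ennreal (cmod (q t) ^ 3)) \<partial>lebesgue)" by (rule nn_integral_cmult[symmetric]) measurable
  also have "\<dots> \<le> (\<integral>\<^sup>+ t. g t ^ 4 + 3 * ennreal (cmod (q t) ^ 4) \<partial>lebesgue)"
  proof (rule nn_integral_mono)
    fix t
    show "4 * (g t * ennreal (cmod (q t) ^ 3)) \<le> g t ^ 4 + 3 * ennreal (cmod (q t) ^ 4)"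
    proof (cases "g t")
      case (real r)
      then have "4 * (g t * ennreal (cmod (q t) ^ 3)) = ennreal (4 * (r * cmod (q t) ^ 3))"
        by (simp add: ennreal_mult)
      also have "\<dots> \<le> ennreal (r ^ 4 + 3 * cmod (q t) ^ 4)" by (intro ennreal_leI young_quartic)
      also have "\<dots> = g t ^ 4 + 3 * ennreal (cmod (q t) ^ 4)"
        using real by (simp add: ennreal_mult ennreal_power)
      finally show ?thesis .
    qed (simp add: power4_eq_xxxx ennreal_top_mult)
  qed
  also have "\<dots> = ?G + 3 * ?a" by (simp add: nn_integral_add nn_integral_cmult)
  finally have "4 * ?a \<le> ?G + 3 * ?a" .
  show ?thesis
  proof (cases ?G)
    case (real r)
    obtain b where b: "?a = ennreal b" "0 \<le> b" using fin by (cases ?a) auto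
    have "ennreal (4 * b) \<le> ennreal (r + 3 * b)"
      using \<open>4 * ?a \<le> ?G + 3 * ?a\<close> real b by (simp add: ennreal_mult)
    then have "4 * b \<le> r + 3 * b" using real b by (subst (asm) ennreal_le_iff) auto
    then have "b \<le> r" by simp
    then show ?thesis using real b by (simp add: ennreal_leI)
  qed simp
qed

text \<open>
  The scalar core of the proof, for forward times. Here \<open>q\<close> is the trace of the solution, \<open>U n\<close> and \<open>A n\<close> are the
  averages of the solution and of the free evolution against the heat kernel at time \<open>1 / (n + 1)\<close>, and the
  equation for \<open>U n\<close> is tested with \<open>cnj (cubic (q t))\<close>. The free evolution enters through a bound \<open>G\<close> on its averages, in
  place of its trace.
\<close>

lemma trace_estimate_half_line:
  fixes q :: "real \<Rightarrow> complex" and U A :: "nat \<Rightarrow> real \<Rightarrow> complex" and B :: "real \<Rightarrow> real" and G :: "real \<Rightarrow> ennreal"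
  assumes q [measurable]: "q \<in> borel_measurable lebesgue" and supp: "\<And>t. t \<notin> {0..T} \<Longrightarrow> q t = 0"
    and B [measurable]: "B \<in> borel_measurable lebesgue" and B4: "(\<integral>\<^sup>+ t. ennreal (\<bar>B t\<bar> ^ 4) * indicator {0..T} t \<partial>lebesgue) < \<infinity>"
    and UB: "\<And>n. AE t in lebesgue. t \<in> {0..T} \<longrightarrow> cmod (U n t) \<le> B t"
    and Uq: "AE t in lebesgue. t \<in> {0..T} \<longrightarrow> (\<lambda>n. U n t) \<longlonglongrightarrow> q t"
    and A [measurable]: "\<And>n. A n \<in> borel_measurable lebesgue"
    and AG: "\<And>n t. t \<in> {0..T} \<Longrightarrow> ennreal (cmod (A n t)) \<le> G t"
    and eq: "\<And>n t. t \<in> {0..T} \<Longrightarrow> U n t = A n t -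
        \<i> * (LINT s|lebesgue. of_bool (s < t) * duhamel_kernel (1 / Suc n) (t - s) * cubic (q s))"
  shows "(\<integral>\<^sup>+ t. ennreal (cmod (q t) ^ 4) \<partial>lebesgue) \<le> (\<integral>\<^sup>+ t. G t ^ 4 * indicator {0..T} t \<partial>lebesgue)"
proof -
  let ?P = "lebesgue \<Otimes>\<^sub>M lebesgue :: (real \<times> real) measure"
  \<comment> \<open>The trace inherits the bound of its approximations, so all integrands are dominated by \<open>b = B\<^sup>4\<close>.\<close>
  have qB: "AE t in lebesgue. cmod (q t) \<le> indicator {0..T} t * \<bar>B t\<bar>"
  proof -
    have "AE t in lebesgue. \<forall>n. t \<in> {0..T} \<longrightarrow> cmod (U n t) \<le> B t" using UB by (subst AE_all_countable) auto
    with Uq show ?thesis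
    proof eventually_elim
      fix t assume U: "t \<in> {0..T} \<longrightarrow> (\<lambda>n. U n t) \<longlonglongrightarrow> q t" "\<forall>n. t \<in> {0..T} \<longrightarrow> cmod (U n t) \<le> B t"
      show "cmod (q t) \<le> indicator {0..T} t * \<bar>B t\<bar>"
      proof (cases "t \<in> {0..T}")
        case True
        with U have "(\<lambda>n. cmod (U n t)) \<longlonglongrightarrow> cmod (q t)" "\<And>n. cmod (U n t) \<le> B t" by (auto intro: tendsto_norm)
        then have "cmod (q t) \<le> B t" by (intro LIMSEQ_le_const2[of _ _ "B t"]) auto
        then show ?thesis using True by simp
      qed (simp add: supp)
    qed
  qed
  define b where "b t = (indicator {0..T} t * \<bar>B t\<bar>) ^ 4" for t
  have b: "integrable lebesgue b"
  proof (rule integrableI_bounded)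
    show "b \<in> borel_measurable lebesgue" unfolding b_def by measurable
    have "(\<integral>\<^sup>+ t. ennreal (norm (b t)) \<partial>lebesgue) = (\<integral>\<^sup>+ t. ennreal (\<bar>B t\<bar> ^ 4) * indicator {0..T} t \<partial>lebesgue)"
      unfolding b_def by (intro nn_integral_cong) (auto split: split_indicator)
    then show "(\<integral>\<^sup>+ t. ennreal (norm (b t)) \<partial>lebesgue) < \<infinity>" using B4 by simp
  qed
  have q4i: "integrable lebesgue (\<lambda>t. cmod (q t) ^ 4)"
  proof (rule Bochner_Integration.integrable_bound[OF b])
    show "AE t in lebesgue. norm (cmod (q t) ^ 4) \<le> norm (b t)"
      using qB by eventually_elim (auto simp: b_def intro!: power_mono)
  qed measurable
  define a where "a = (LINT t|lebesgue. cmod (q t) ^ 4)"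
  have a: "(\<integral>\<^sup>+ t. ennreal (cmod (q t) ^ 4) \<partial>lebesgue) = ennreal a"
    unfolding a_def by (rule nn_integral_eq_integral[OF q4i]) simp
  define F where "F t = cubic (q t)" for t
  have Fm [measurable]: "F \<in> borel_measurable lebesgue" unfolding F_def cubic_def by measurable
  have F: "integrable lebesgue F"
  proof (rule Bochner_Integration.integrable_bound)
    have "integrable lebesgue (indicator {0..T} :: real \<Rightarrow> real)" by (cases "0 \<le> T") auto
    then show "integrable lebesgue (\<lambda>t. indicator {0..T} t + cmod (q t) ^ 4)"
      by (intro Bochner_Integration.integrable_add q4i)
    show "AE t in lebesgue. cmod (F t) \<le> norm (indicator {0..T} t + cmod (q t) ^ 4)"
    proof (rule AE_I2)
      fix t
      show "cmod (F t) \<le> norm (indicator {0..T} t + cmod (q t) ^ 4)"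
      proof (cases "t \<in> {0..T}")
        case True
        have "4 * cmod (q t) ^ 3 \<le> 1 + 3 * cmod (q t) ^ 4" using young_quartic[of 1 "cmod (q t)"] by simp
        moreover have "0 \<le> cmod (q t) ^ 4" by simp
        ultimately have "cmod (q t) ^ 3 \<le> 1 + cmod (q t) ^ 4" by linarith
        then show ?thesis using True by (simp add: F_def norm_cubic)
      qed (simp add: F_def norm_cubic supp)
    qed
  qed measurable
  define e where "e n = 1 / real (Suc n)" for n
  have e: "e n > 0" for n by (simp add: e_def)
  define H where "H n p = (of_bool (fst p < snd p) * duhamel_kernel (e n) (snd p - fst p)) * (F (fst p) * cnj (F (snd p)))" for n p
  have iH: "integrable ?P (H n)" for n unfolding H_def[abs_def] by (rule duhamel_dissipation(1)[OF F e])
  define V where "V n t = (LINT s|lebesgue. H n (s, t))" for n t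
  have iV: "integrable lebesgue (V n)" and V: "(LINT t|lebesgue. V n t) = (LINT p|?P. H n p)" for n
    using leb_pair.integrable_snd[of "\<lambda>s t. H n (s, t)"] leb_pair.integral_snd[of "\<lambda>s t. H n (s, t)"] iH[of n]
    by (auto simp: V_def[abs_def])
  have eqF: "U n t * cnj (F t) = A n t * cnj (F t) - \<i> * V n t" for n t
  proof (cases "t \<in> {0..T}")
    case True
    have "V n t = (LINT s|lebesgue. (of_bool (s < t) * duhamel_kernel (e n) (t - s) * cubic (q s)) * cnj (F t))"
      unfolding V_def by (intro Bochner_Integration.integral_cong refl) (simp add: H_def F_def mult_ac)
    also have "\<dots> = (LINT s|lebesgue. of_bool (s < t) * duhamel_kernel (e n) (t - s) * cubic (q s)) * cnj (F t)"
      by (rule integral_mult_left_zero)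
    finally show ?thesis unfolding eq[OF True, of n] e_def[symmetric] by (simp only: left_diff_distrib mult.assoc)
  next
    case False
    then show ?thesis by (simp add: V_def H_def F_def cubic_def supp)
  qed
  have Um [measurable]: "(\<lambda>t. U n t * cnj (F t)) \<in> borel_measurable lebesgue" for n
    unfolding eqF using iV[of n] by measurable
  have UFb: "AE t in lebesgue. cmod (U n t * cnj (F t)) \<le> b t" for n
    using UB[of n] qB
  proof eventually_elim
    fix t assume UB: "t \<in> {0..T} \<longrightarrow> cmod (U n t) \<le> B t" and qB: "cmod (q t) \<le> indicator {0..T} t * \<bar>B t\<bar>"
    show "cmod (U n t * cnj (F t)) \<le> b t"
    proof (cases "t \<in> {0..T}")
      case True
      then have "cmod (U n t) * cmod (q t) ^ 3 \<le> \<bar>B t\<bar> * \<bar>B t\<bar> ^ 3"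
        using UB qB by (intro mult_mono power_mono) auto
      also have "\<dots> = b t" using True by (simp add: b_def power4_eq_xxxx power3_eq_cube)
      finally show ?thesis by (simp add: norm_mult F_def norm_cubic)
    qed (simp add: F_def cubic_def supp b_def)
  qed
  have iU: "integrable lebesgue (\<lambda>t. U n t * cnj (F t))" for n
  proof (rule Bochner_Integration.integrable_bound[OF b Um])
    show "AE t in lebesgue. cmod (U n t * cnj (F t)) \<le> norm (b t)"
      using UFb[of n] by eventually_elim simp
  qed
  have lim: "(\<lambda>n. LINT t|lebesgue. U n t * cnj (F t)) \<longlonglongrightarrow> (LINT t|lebesgue. of_real (cmod (q t) ^ 4))"
  proof (rule integral_dominated_convergence[where w = b])
    show "AE t in lebesgue. (\<lambda>n. U n t * cnj (F t)) \<longlonglongrightarrow> of_real (cmod (q t) ^ 4)"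
      using Uq
    proof eventually_elim
      fix t assume "t \<in> {0..T} \<longrightarrow> (\<lambda>n. U n t) \<longlonglongrightarrow> q t"
      then have "(\<lambda>n. U n t * cnj (F t)) \<longlonglongrightarrow> q t * cnj (F t)"
        by (cases "t \<in> {0..T}") (auto intro!: tendsto_intros simp: F_def cubic_def supp)
      then show "(\<lambda>n. U n t * cnj (F t)) \<longlonglongrightarrow> of_real (cmod (q t) ^ 4)"
        by (simp only: F_def cubic_cnj_mult)
    qed
  qed (use b UFb Um in \<open>auto\<close>)
  then have "(\<lambda>n. Re (LINT t|lebesgue. U n t * cnj (F t))) \<longlonglongrightarrow> Re (of_real a)"
    unfolding integral_complex_of_real a_def[symmetric] by (rule tendsto_Re)
  then have limRe: "(\<lambda>n. ennreal (Re (LINT t|lebesgue. U n t * cnj (F t)))) \<longlonglongrightarrow> ennreal a"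
    by (intro tendsto_ennrealI) simp
  define g where "g t = indicator {0..T} t * (SUP n. ennreal (cmod (A n t)))" for t
  have gm [measurable]: "g \<in> borel_measurable lebesgue" unfolding g_def by measurable
  define E where "E n = (\<integral>\<^sup>+ p. ennreal (of_bool (fst p < snd p) * sqrt (cauchy (e n) (snd p - fst p)) * (cmod (q (fst p)) ^ 3 * cmod (q (snd p)) ^ 3)) \<partial>?P)" for n
  have E0: "E \<longlonglongrightarrow> 0"
    unfolding E_def[abs_def] e_def
    by (rule kernel_error_tendsto_0[of "\<lambda>t. cmod (q t)" T]) (use a supp in auto)
  have le: "ennreal (Re (LINT t|lebesgue. U n t * cnj (F t))) \<le> (\<integral>\<^sup>+ t. g t * ennreal (cmod (q t) ^ 3) \<partial>lebesgue) + E n" for n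
  proof -
    have iA: "integrable lebesgue (\<lambda>t. A n t * cnj (F t))"
    proof -
      have "integrable lebesgue (\<lambda>t. U n t * cnj (F t) + \<i> * V n t)"
        by (intro Bochner_Integration.integrable_add iU integrable_mult_right iV)
      then show ?thesis by (simp add: eqF)
    qed
    have "(LINT t|lebesgue. U n t * cnj (F t)) = (LINT t|lebesgue. A n t * cnj (F t)) - \<i> * (LINT p|?P. H n p)"
      unfolding eqF using iA iV[of n] by (simp add: V)
    then have "Re (LINT t|lebesgue. U n t * cnj (F t)) = Re (LINT t|lebesgue. A n t * cnj (F t)) + Re (- \<i> * (LINT p|?P. H n p))"
      by simp
    also have "\<dots> \<le> cmod (LINT t|lebesgue. A n t * cnj (F t)) + max 0 (Re (- \<i> * (LINT p|?P. H n p)))"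
      by (intro add_mono complex_Re_le_cmod) simp
    finally have "ennreal (Re (LINT t|lebesgue. U n t * cnj (F t))) \<le> ennreal (cmod (LINT t|lebesgue. A n t * cnj (F t)) + max 0 (Re (- \<i> * (LINT p|?P. H n p))))"
      by (rule ennreal_leI)
    also have "\<dots> = ennreal (cmod (LINT t|lebesgue. A n t * cnj (F t))) + ennreal (Re (- \<i> * (LINT p|?P. H n p)))"
      by (simp add: ennreal_max_0)
    also have "\<dots> \<le> (\<integral>\<^sup>+ t. g t * ennreal (cmod (q t) ^ 3) \<partial>lebesgue) + E n"
    proof (rule add_mono)
      have "ennreal (cmod (LINT t|lebesgue. A n t * cnj (F t))) \<le> (\<integral>\<^sup>+ t. ennreal (cmod (A n t * cnj (F t))) \<partial>lebesgue)"
        by (rule integral_norm_bound_ennreal[OF iA])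
      also have "\<dots> \<le> (\<integral>\<^sup>+ t. g t * ennreal (cmod (q t) ^ 3) \<partial>lebesgue)"
      proof (rule nn_integral_mono)
        fix t
        show "ennreal (cmod (A n t * cnj (F t))) \<le> g t * ennreal (cmod (q t) ^ 3)"
        proof (cases "t \<in> {0..T}")
          case True
          then have "ennreal (cmod (A n t)) \<le> g t" by (auto simp: g_def intro: SUP_upper)
          then show ?thesis by (simp add: norm_mult F_def norm_cubic ennreal_mult mult_right_mono)
        qed (simp add: F_def cubic_def supp)
      qed
      finally show "ennreal (cmod (LINT t|lebesgue. A n t * cnj (F t))) \<le> (\<integral>\<^sup>+ t. g t * ennreal (cmod (q t) ^ 3) \<partial>lebesgue)" .
      show "ennreal (Re (- \<i> * (LINT p|?P. H n p))) \<le> E n"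
        using duhamel_dissipation(2)[OF F e, of n] unfolding H_def[abs_def] E_def F_def norm_cubic .
    qed
    finally show ?thesis .
  qed
  have "(\<lambda>n. (\<integral>\<^sup>+ t. g t * ennreal (cmod (q t) ^ 3) \<partial>lebesgue) + E n) \<longlonglongrightarrow> (\<integral>\<^sup>+ t. g t * ennreal (cmod (q t) ^ 3) \<partial>lebesgue) + 0"
    by (intro tendsto_add tendsto_const E0)
  from tendsto_le[OF _ this limRe]
  have "ennreal a \<le> (\<integral>\<^sup>+ t. g t * ennreal (cmod (q t) ^ 3) \<partial>lebesgue)"
    using le by (simp add: always_eventually)
  then have "(\<integral>\<^sup>+ t. ennreal (cmod (q t) ^ 4) \<partial>lebesgue) \<le> (\<integral>\<^sup>+ t. g t ^ 4 \<partial>lebesgue)"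
    by (intro absorb_quartic) (simp_all add: a)
  also have "\<dots> \<le> (\<integral>\<^sup>+ t. G t ^ 4 * indicator {0..T} t \<partial>lebesgue)"
  proof (rule nn_integral_mono)
    fix t
    have "(SUP n. ennreal (cmod (A n t))) \<le> G t" if "t \<in> {0..T}" using AG[OF that] by (intro SUP_least)
    then show "g t ^ 4 \<le> G t ^ 4 * indicator {0..T} t"
      by (auto simp: g_def intro!: power_mono split: split_indicator)
  qed
  finally show ?thesis .
qed

section \<open>Both time directions and exhaustion of the interval\<close>

text \<open>
  Completeness of the Lebesgue measure.
\<close>

lemma lebesgue_measurable_AE_eq:
  fixes f g :: "real \<Rightarrow> 'a::topological_space"
  assumes g: "g \<in> borel_measurable lebesgue" and eq: "AE x in lebesgue. f x = g x"
  shows "f \<in> borel_measurable lebesgue"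
proof (rule measurableI)
  fix A :: "'a set" assume A: "A \<in> sets borel"
  show "f -` A \<inter> space lebesgue \<in> sets lebesgue"
  proof (rule completion.in_sets_AE)
    show "g -` A \<inter> space lebesgue \<in> sets lebesgue" using g A by (rule measurable_sets)
    show "AE x in lebesgue. (x \<in> g -` A \<inter> space lebesgue) = (x \<in> f -` A \<inter> space lebesgue)"
      using eq by eventually_elim auto
  qed auto
qed auto

lemma lebesgue_uminus_measurable: "uminus \<in> measurable lebesgue (lebesgue :: real measure)"
  using lebesgue_affine_measurable[of "\<lambda>_. -1 :: real" "0 :: real"] by (simp add: Basis_real_def)

lemma nn_integral_lebesgue_uminus:
  assumes f: "f \<in> borel_measurable lebesgue"
  shows "(\<integral>\<^sup>+ x. f (- x) \<partial>lebesgue) = (\<integral>\<^sup>+ x. f x \<partial>(lebesgue :: real measure))"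
proof -
  have "(\<integral>\<^sup>+ x. f x \<partial>(lebesgue :: real measure)) = (\<integral>\<^sup>+ x. f x \<partial>density (distr lebesgue lebesgue (\<lambda>x. 0 + (-1) * x)) (\<lambda>_. ennreal \<bar>-1\<bar>))"
    by (subst lebesgue_real_affine[of "-1" 0]) simp_all
  also have "\<dots> = (\<integral>\<^sup>+ x. f (- x) \<partial>lebesgue)"
    using f lebesgue_uminus_measurable by (simp add: nn_integral_density nn_integral_distr)
  finally show ?thesis ..
qed

lemma AE_lebesgue_uminus:
  assumes "AE x in (lebesgue :: real measure). P x" shows "AE x in lebesgue. P (- x)"
proof -
  from assms have "AE x in lborel. P x" by (simp add: AE_completion_iff)
  then obtain N where N: "N \<in> null_sets lborel" "{x \<in> space lborel. \<not> P x} \<subseteq> N" by (rule AE_E3) auto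
  have "AE x in lborel. x \<notin> N" using N(1) by (rule AE_not_in)
  then have "AE x in lborel. 0 + (-1) * x \<notin> N"
    using N(1) by (intro AE_borel_affine) (auto simp: null_sets_def)
  then have "AE x in lborel. P (- x)" using N(2) by (auto elim!: eventually_mono)
  then show ?thesis by (rule AE_completion)
qed

text \<open>
  Strong measurability with values in \<open>C\<^sub>x\<close> passes to every sequentially continuous function of the
  representative, here the value at \<open>0\<close> and the norm.
\<close>

lemma L4Cx_trace:
  assumes u: "u \<in> L4Cx {a..b}"
  shows L4Cx_in_Cx: "AE t in lebesgue. t \<in> {a..b} \<longrightarrow> in_Cx (u t)"
    and L4Cx_value_measurable: "(\<lambda>t. indicator {a..b} t *\<^sub>R Cx_value (u t) 0) \<in> borel_measurable lebesgue"
    and L4Cx_norm_measurable: "(\<lambda>t. indicator {a..b} t *\<^sub>R norm (Cx_rep (u t))) \<in> borel_measurable lebesgue"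
    and L4Cx_norm_finite: "(\<integral>\<^sup>+ t. ennreal (norm (Cx_rep (u t)) ^ 4) * indicator {a..b} t \<partial>lebesgue) < \<infinity>"
proof -
  have J: "{a..b} \<inter> space lebesgue \<in> sets lebesgue" by simp
  from u have "AE t in lebesgue_on {a..b}. in_Cx (u t)" by (simp add: L4Cx_def strongly_measurable_Cx_def)
  then show in_Cx: "AE t in lebesgue. t \<in> {a..b} \<longrightarrow> in_Cx (u t)" by (simp add: AE_restrict_space_iff)
  from u obtain S :: "nat \<Rightarrow> real \<Rightarrow> (real \<Rightarrow>\<^sub>C complex)"
    where S: "\<And>n. simple_function (lebesgue_on {a..b}) (S n)"
      and lim: "AE t in lebesgue_on {a..b}. (\<lambda>n. S n t) \<longlonglongrightarrow> Cx_rep (u t)"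
    unfolding L4Cx_def strongly_measurable_Cx_def by auto
  have meas: "(\<lambda>t. indicator {a..b} t *\<^sub>R h (Cx_rep (u t))) \<in> borel_measurable lebesgue"
    if h: "\<And>X x. X \<longlonglongrightarrow> x \<Longrightarrow> (\<lambda>n. h (X n)) \<longlonglongrightarrow> h x" for h :: "(real \<Rightarrow>\<^sub>C complex) \<Rightarrow> 'b::{banach, second_countable_topology}"
  proof -
    define s where "s n t = indicator {a..b} t *\<^sub>R h (S n t)" for n t
    have "(\<lambda>t. h (S n t)) \<in> borel_measurable (lebesgue_on {a..b})" for n
      by (rule borel_measurable_simple_function[OF simple_function_compose1[OF S]])
    then have [measurable]: "s n \<in> borel_measurable lebesgue" for n
      unfolding s_def[abs_def] by (simp add: borel_measurable_restrict_space_iff)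
    have "(\<lambda>t. lim (\<lambda>n. s n t)) \<in> borel_measurable lebesgue" by (rule borel_measurable_lim_metric) simp
    moreover have "AE t in lebesgue. indicator {a..b} t *\<^sub>R h (Cx_rep (u t)) = lim (\<lambda>n. s n t)"
      using lim unfolding AE_restrict_space_iff[OF J]
    proof eventually_elim
      fix t assume t: "t \<in> {a..b} \<longrightarrow> (\<lambda>n. S n t) \<longlonglongrightarrow> Cx_rep (u t)"
      have "(\<lambda>n. s n t) \<longlonglongrightarrow> indicator {a..b} t *\<^sub>R h (Cx_rep (u t))"
      proof (cases "t \<in> {a..b}")
        case True
        then show ?thesis unfolding s_def using t by (intro tendsto_intros h) simp
      qed (simp add: s_def)
      from limI[OF this] show "indicator {a..b} t *\<^sub>R h (Cx_rep (u t)) = lim (\<lambda>n. s n t)" by simp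
    qed
    ultimately show ?thesis by (rule lebesgue_measurable_AE_eq)
  qed
  show "(\<lambda>t. indicator {a..b} t *\<^sub>R Cx_value (u t) 0) \<in> borel_measurable lebesgue"
    unfolding Cx_value_def
  proof (rule meas)
    fix X :: "nat \<Rightarrow> (real \<Rightarrow>\<^sub>C complex)" and x assume "X \<longlonglongrightarrow> x"
    then have "(\<lambda>n. dist (X n) x) \<longlonglongrightarrow> 0" by (rule tendsto_dist_iff[THEN iffD1])
    then have "(\<lambda>n. dist (apply_bcontfun (X n) 0) (apply_bcontfun x 0)) \<longlonglongrightarrow> 0"
      by (rule Lim_null_comparison[rotated]) (simp add: dist_bounded)
    then show "(\<lambda>n. apply_bcontfun (X n) 0) \<longlonglongrightarrow> apply_bcontfun x 0" by (rule tendsto_dist_iff[THEN iffD2])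
  qed
  show "(\<lambda>t. indicator {a..b} t *\<^sub>R norm (Cx_rep (u t))) \<in> borel_measurable lebesgue"
    by (rule meas) (rule tendsto_norm)
  have "(\<integral>\<^sup>+ t. ennreal (norm (Cx_rep (u t)) ^ 4) * indicator {a..b} t \<partial>lebesgue) = L4Cx_norm_pow4 {a..b} u"
    unfolding L4Cx_norm_pow4_def nn_integral_restrict_space[OF J]
    by (rule nn_integral_cong_AE, use in_Cx in eventually_elim)
       (auto simp: Cx_norm_def ennreal_power split: split_indicator)
  then show "(\<integral>\<^sup>+ t. ennreal (norm (Cx_rep (u t)) ^ 4) * indicator {a..b} t \<partial>lebesgue) < \<infinity>"
    using u by (simp add: L4Cx_def)
qed

lemma norm_Cx_rep_ge:
  assumes "u \<in> L2" "in_Cx u" "e > 0"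
  shows "cmod (LINT x|lebesgue. u x * heat_kernel (of_real e) x) \<le> norm (Cx_rep u)"
  using norm_integral_heat_kernel_le_Cx_norm[of u e] assms by (simp add: Cx_norm_def)

text \<open>
  The average of the free evolution of \<open>f\<close> against the heat kernel at time \<open>1 / (n + 1)\<close>, with the group moved
  onto the kernel.
\<close>

definition free_average :: "(real \<Rightarrow> complex) \<Rightarrow> nat \<Rightarrow> real \<Rightarrow> complex" where
  "free_average f n t = (LINT x|lebesgue. f x * heat_kernel (of_real (1 / Suc n) + \<i> * of_real t) x)"

lemma free_average_measurable:
  assumes f: "f \<in> L2" shows "free_average f n \<in> borel_measurable lebesgue"
proof -
  let ?e = "of_real (1 / Suc n) :: complex"
  have e: "Re (?e + \<i> * of_real t) > 0" for t by simp
  have [measurable]: "fourier_L2 f \<in> borel_measurable lebesgue" "gauss_symbol ?e \<in> borel_measurable lebesgue"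
    using L2_measurable[OF fourier_L2_in_L2[OF f]] by (auto intro: borel_imp_leb)
  have eq: "free_average f n = (\<lambda>t. of_real (1 / (2 * pi)) * (LINT \<xi>|lebesgue. fourier_L2 f \<xi> * (cis (- (t * \<xi>\<^sup>2)) * gauss_symbol ?e \<xi>)))"
    unfolding free_average_def[abs_def] integral_mult_heat_kernel[OF f e] gauss_symbol_shift ..
  have "(\<lambda>t. LINT \<xi>|lebesgue. fourier_L2 f \<xi> * (cis (- (t * \<xi>\<^sup>2)) * gauss_symbol ?e \<xi>)) \<in> borel_measurable lebesgue"
    by (rule leb.borel_measurable_lebesgue_integral) (simp add: split_beta')
  then show ?thesis unfolding eq by (intro borel_measurable_times borel_measurable_const)
qed

lemma free_average_le:
  assumes f: "f \<in> L2" shows "ennreal (cmod (free_average f n t)) \<le> Cx_norm (schrodinger_group t f)"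
proof -
  have "free_average f n t = (LINT x|lebesgue. schrodinger_group t f x * heat_kernel (of_real (1 / Suc n)) x)"
    unfolding free_average_def by (rule schrodinger_group_adjoint[OF f, symmetric]) simp
  then show ?thesis using norm_integral_heat_kernel_le_Cx_norm[OF schrodinger_group_L2[OF f], of "1 / Suc n"] by simp
qed

text \<open>
  A substitute for the trace of the free evolution: measurable in time, and bounded by \<open>Cx_norm\<close> at every
  single time, also where the evolution is not in \<open>C\<^sub>x\<close>. Its integrals can therefore be split, reflected
  and added before it is replaced by \<open>Cx_norm\<close>.
\<close>

definition free_sup :: "(real \<Rightarrow> complex) \<Rightarrow> real \<Rightarrow> ennreal" where
  "free_sup f t = (SUP n. ennreal (cmod (free_average f n t)))"

lemma free_sup_measurable: "f \<in> L2 \<Longrightarrow> free_sup f \<in> borel_measurable lebesgue"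
  unfolding free_sup_def[abs_def] by (intro borel_measurable_SUP) (auto intro!: measurable_compose[OF free_average_measurable])

lemma free_sup_le: "f \<in> L2 \<Longrightarrow> free_sup f t \<le> Cx_norm (schrodinger_group t f)"
  unfolding free_sup_def by (intro SUP_least free_average_le)

context
  fixes I :: "real set" and \<psi>0 :: "real \<Rightarrow> complex" and \<psi> :: "real \<Rightarrow> real \<Rightarrow> complex"
  assumes I: "is_interval I" "0 \<in> I" and \<psi>0: "\<psi>0 \<in> L2" and sol: "strong_solution I \<psi>"
    and init: "AE x in lebesgue. \<psi> 0 x = \<psi>0 x"
begin

lemma interval_subset: "a \<in> I \<Longrightarrow> b \<in> I \<Longrightarrow> {a..b} \<subseteq> I"
  by (rule subsetI, rule mem_is_interval_1_I[OF I(1), of a b]) auto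

lemma solution_L2: "t \<in> I \<Longrightarrow> \<psi> t \<in> L2"
  using sol by (auto simp: strong_solution_def C_L2_def)

lemma solution_L4Cx: "a \<le> b \<Longrightarrow> {a..b} \<subseteq> I \<Longrightarrow> \<psi> \<in> L4Cx {a..b}"
  using sol by (auto simp: strong_solution_def L4Cx_loc_def)

text \<open>
  For \<open>0 \<le> t \<le> b\<close> the Duhamel formula is already in the form that the scalar estimate expects.
\<close>

lemma forward_estimate:
  assumes b: "b \<in> I" "0 \<le> b"
  shows "(\<integral>\<^sup>+ t. ennreal (cmod (Cx_value (\<psi> t) 0) ^ 4) * indicator {0..b} t \<partial>lebesgue)
    \<le> (\<integral>\<^sup>+ t. free_sup \<psi>0 t ^ 4 * indicator {0..b} t \<partial>lebesgue)"
proof -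
  have sub: "{0..b} \<subseteq> I" using I b by (intro interval_subset)
  note u = solution_L4Cx[OF b(2) sub]
  define q where "q t = indicator {0..b} t *\<^sub>R Cx_value (\<psi> t) 0" for t
  have "(\<integral>\<^sup>+ t. ennreal (cmod (q t) ^ 4) \<partial>lebesgue) \<le> (\<integral>\<^sup>+ t. free_sup \<psi>0 t ^ 4 * indicator {0..b} t \<partial>lebesgue)"
  proof (rule trace_estimate_half_line)
    let ?U = "\<lambda>n t. LINT x|lebesgue. \<psi> t x * heat_kernel (of_real (1 / Suc n)) x"
    let ?B = "\<lambda>t. indicator {0..b} t *\<^sub>R norm (Cx_rep (\<psi> t))"
    show "q \<in> borel_measurable lebesgue" unfolding q_def[abs_def] by (rule L4Cx_value_measurable[OF u])
    show "?B \<in> borel_measurable lebesgue" by (rule L4Cx_norm_measurable[OF u])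
    have "(\<integral>\<^sup>+ t. ennreal (\<bar>?B t\<bar> ^ 4) * indicator {0..b} t \<partial>lebesgue) = (\<integral>\<^sup>+ t. ennreal (norm (Cx_rep (\<psi> t)) ^ 4) * indicator {0..b} t \<partial>lebesgue)"
      by (intro nn_integral_cong) (auto split: split_indicator)
    then show "(\<integral>\<^sup>+ t. ennreal (\<bar>?B t\<bar> ^ 4) * indicator {0..b} t \<partial>lebesgue) < \<infinity>" using L4Cx_norm_finite[OF u] by simp
    show "AE t in lebesgue. t \<in> {0..b} \<longrightarrow> cmod (?U n t) \<le> ?B t" for n
      using L4Cx_in_Cx[OF u]
    proof eventually_elim
      fix t assume "t \<in> {0..b} \<longrightarrow> in_Cx (\<psi> t)"
      then show "t \<in> {0..b} \<longrightarrow> cmod (?U n t) \<le> ?B t"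
        using norm_Cx_rep_ge[OF solution_L2, of t "1 / Suc n"] sub by auto
    qed
    show "AE t in lebesgue. t \<in> {0..b} \<longrightarrow> (\<lambda>n. ?U n t) \<longlonglongrightarrow> q t"
      using L4Cx_in_Cx[OF u]
    proof eventually_elim
      fix t assume "t \<in> {0..b} \<longrightarrow> in_Cx (\<psi> t)"
      then show "t \<in> {0..b} \<longrightarrow> (\<lambda>n. ?U n t) \<longlonglongrightarrow> q t"
        using integral_heat_kernel_tendsto_Cx_value[OF L2_measurable[OF solution_L2], of t] sub by (auto simp: q_def)
    qed
    show "free_average \<psi>0 n \<in> borel_measurable lebesgue" for n by (rule free_average_measurable[OF \<psi>0])
    show "ennreal (cmod (free_average \<psi>0 n t)) \<le> free_sup \<psi>0 t" for n t
      unfolding free_sup_def by (rule SUP_upper) simp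
    show "?U n t = free_average \<psi>0 n t - \<i> * (LINT s|lebesgue. of_bool (s < t) * duhamel_kernel (1 / Suc n) (t - s) * cubic (q s))"
      if t: "t \<in> {0..b}" for n t
    proof -
      have "(of_bool (s < t) - of_bool (s < 0)) * (heat_kernel (of_real (1 / Suc n) + \<i> * of_real (t - s)) 0 * cubic (Cx_value (\<psi> s) 0))
          = of_bool (s < t) * duhamel_kernel (1 / Suc n) (t - s) * cubic (q s)" for s
        using t by (auto simp: q_def duhamel_kernel_def cubic_def)
      then show ?thesis
        using duhamel_formula_heat_kernel(2)[OF I(2) \<psi>0 sol init, of "1 / Suc n" t] t sub by (auto simp: free_average_def)
    qed
  qed (simp add: q_def)
  moreover have "ennreal (cmod (q t) ^ 4) = ennreal (cmod (Cx_value (\<psi> t) 0) ^ 4) * indicator {0..b} t" for t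
    by (auto simp: q_def split: split_indicator)
  ultimately show ?thesis by simp
qed

text \<open>
  Conjugation and time reversal turn the Duhamel formula on \<open>a..0\<close> into the same forward equation for
  \<open>cnj (\<psi> (- t))\<close>.
\<close>

lemma backward_estimate:
  assumes a: "a \<in> I" "a \<le> 0"
  shows "(\<integral>\<^sup>+ t. ennreal (cmod (Cx_value (\<psi> t) 0) ^ 4) * indicator {a..0} t \<partial>lebesgue)
    \<le> (\<integral>\<^sup>+ t. free_sup \<psi>0 t ^ 4 * indicator {a..0} t \<partial>lebesgue)"
proof -
  have sub: "{a..0} \<subseteq> I" using I a by (intro interval_subset)
  note u = solution_L4Cx[OF a(2) sub]
  have ind: "indicator {a..0} (- t) = indicator {0..-a} t" for t :: real by (auto split: split_indicator)
  define q where "q t = indicator {0..-a} t *\<^sub>R cnj (Cx_value (\<psi> (- t)) 0)" for t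
  have "(\<lambda>t. indicator {a..0} (- t) *\<^sub>R Cx_value (\<psi> (- t)) 0) \<in> borel_measurable lebesgue"
    using measurable_compose[OF lebesgue_uminus_measurable L4Cx_value_measurable[OF u]] .
  then have "(\<lambda>t. cnj (indicator {a..0} (- t) *\<^sub>R Cx_value (\<psi> (- t)) 0)) \<in> borel_measurable lebesgue"
    by (rule borel_measurable_cnj)
  then have qm [measurable]: "q \<in> borel_measurable lebesgue" unfolding q_def[abs_def] by (simp add: ind)
  have inCx: "AE t in lebesgue. t \<in> {0..-a} \<longrightarrow> in_Cx (\<psi> (- t))"
    using AE_lebesgue_uminus[OF L4Cx_in_Cx[OF u]] by eventually_elim auto
  have "(\<integral>\<^sup>+ t. ennreal (cmod (q t) ^ 4) \<partial>lebesgue) \<le> (\<integral>\<^sup>+ t. free_sup \<psi>0 (- t) ^ 4 * indicator {0..-a} t \<partial>lebesgue)"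
  proof (rule trace_estimate_half_line)
    let ?U = "\<lambda>n t. cnj (LINT x|lebesgue. \<psi> (- t) x * heat_kernel (of_real (1 / Suc n)) x)"
    let ?B = "\<lambda>t. indicator {0..-a} t *\<^sub>R norm (Cx_rep (\<psi> (- t)))"
    show "q \<in> borel_measurable lebesgue" by (rule qm)
    show "?B \<in> borel_measurable lebesgue"
      using measurable_compose[OF lebesgue_uminus_measurable L4Cx_norm_measurable[OF u]] by (simp add: ind)
    show "(\<integral>\<^sup>+ t. ennreal (\<bar>?B t\<bar> ^ 4) * indicator {0..-a} t \<partial>lebesgue) < \<infinity>"
    proof -
      let ?f = "\<lambda>t. ennreal (\<bar>indicator {a..0} t *\<^sub>R norm (Cx_rep (\<psi> t))\<bar> ^ 4) * indicator {a..0} t"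
      have "?f \<in> borel_measurable lebesgue"
        using L4Cx_norm_measurable[OF u] by measurable
      from nn_integral_lebesgue_uminus[OF this]
      have "(\<integral>\<^sup>+ t. ennreal (\<bar>?B t\<bar> ^ 4) * indicator {0..-a} t \<partial>lebesgue) = (\<integral>\<^sup>+ t. ?f t \<partial>lebesgue)"
        by (simp only: ind)
      also have "\<dots> = (\<integral>\<^sup>+ t. ennreal (norm (Cx_rep (\<psi> t)) ^ 4) * indicator {a..0} t \<partial>lebesgue)"
        by (intro nn_integral_cong) (auto split: split_indicator)
      finally show ?thesis using L4Cx_norm_finite[OF u] by simp
    qed
    show "AE t in lebesgue. t \<in> {0..-a} \<longrightarrow> cmod (?U n t) \<le> ?B t" for n
      using inCx
    proof eventually_elim
      fix t assume "t \<in> {0..-a} \<longrightarrow> in_Cx (\<psi> (- t))"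
      then show "t \<in> {0..-a} \<longrightarrow> cmod (?U n t) \<le> ?B t"
        using norm_Cx_rep_ge[OF solution_L2, of "- t" "1 / Suc n"] subsetD[OF sub, of "- t"] by auto
    qed
    show "AE t in lebesgue. t \<in> {0..-a} \<longrightarrow> (\<lambda>n. ?U n t) \<longlonglongrightarrow> q t"
      using inCx
    proof eventually_elim
      fix t assume t: "t \<in> {0..-a} \<longrightarrow> in_Cx (\<psi> (- t))"
      show "t \<in> {0..-a} \<longrightarrow> (\<lambda>n. ?U n t) \<longlonglongrightarrow> q t"
      proof
        assume t': "t \<in> {0..-a}"
        then have "- t \<in> I" using sub by auto
        from tendsto_cnj[OF integral_heat_kernel_tendsto_Cx_value[OF L2_measurable[OF solution_L2[OF this]]]] t t'
        show "(\<lambda>n. ?U n t) \<longlonglongrightarrow> q t" by (simp add: q_def)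
      qed
    qed
    show "(\<lambda>t. cnj (free_average \<psi>0 n (- t))) \<in> borel_measurable lebesgue" for n
      by (intro borel_measurable_cnj measurable_compose[OF lebesgue_uminus_measurable] free_average_measurable \<psi>0)
    show "ennreal (cmod (cnj (free_average \<psi>0 n (- t)))) \<le> free_sup \<psi>0 (- t)" for n t
      unfolding free_sup_def complex_mod_cnj by (rule SUP_upper) simp
    show "?U n t = cnj (free_average \<psi>0 n (- t)) - \<i> * (LINT s|lebesgue. of_bool (s < t) * duhamel_kernel (1 / Suc n) (t - s) * cubic (q s))"
      if t: "t \<in> {0..-a}" for n t
    proof -
      let ?K = "\<lambda>s. (of_bool (s < - t) - of_bool (s < 0)) * (heat_kernel (of_real (1 / Suc n) + \<i> * of_real (- t - s)) 0 * cubic (Cx_value (\<psi> s) 0))"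
      let ?L = "\<lambda>s. of_bool (0 < s \<and> s \<le> t) * duhamel_kernel (1 / Suc n) (t - s) * cubic (q s)"
      note [measurable] = duhamel_kernel_measurable[of "1 / Suc n"]
      have "- t \<in> I" using t sub by auto
      \<comment> \<open>After reflection the half-open interval of integration is closed at the other end, a change on two points.\<close>
      have L: "(LINT s|lebesgue. ?L s) = (LINT s|lebesgue. of_bool (s < t) * duhamel_kernel (1 / Suc n) (t - s) * cubic (q s))"
      proof (rule integral_cong_AE)
        have ne: "AE s in lebesgue. s \<noteq> c" for c :: real by (intro AE_completion AE_lborel_singleton)
        show "AE s in lebesgue. ?L s = of_bool (s < t) * duhamel_kernel (1 / Suc n) (t - s) * cubic (q s)"
          using ne[of 0] ne[of t]
        proof eventually_elim
          fix s assume "s \<noteq> 0" "s \<noteq> t"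
          then show "?L s = of_bool (s < t) * duhamel_kernel (1 / Suc n) (t - s) * cubic (q s)"
            by (cases "0 \<le> s") (auto simp: q_def cubic_def)
        qed
      qed (unfold cubic_def, measurable)
      have "(LINT s|lebesgue. ?K s) = (LINT s|lebesgue. ?K (0 + -1 * s))"
        using lebesgue_integral_real_affine[of "-1" ?K 0] by simp
      then have "cnj (LINT s|lebesgue. ?K s) = cnj (LINT s|lebesgue. ?K (0 + -1 * s))" by (rule arg_cong)
      also have "\<dots> = (LINT s|lebesgue. cnj (?K (0 + -1 * s)))" by (rule Bochner_Integration.integral_cnj[symmetric])
      also have "\<dots> = (LINT s|lebesgue. - ?L s)"
      proof (intro Bochner_Integration.integral_cong refl)
        fix s
        have "cnj (heat_kernel (of_real (1 / Suc n) + \<i> * of_real (- t - - s)) 0) = duhamel_kernel (1 / Suc n) (t - s)"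
          using cnj_duhamel_kernel[of "1 / Suc n" "- t - - s"] by (simp add: duhamel_kernel_def)
        then show "cnj (?K (0 + -1 * s)) = - ?L s"
          using t by (auto simp: q_def cubic_def)
      qed
      also have "\<dots> = - (LINT s|lebesgue. ?L s)" by (rule Bochner_Integration.integral_minus)
      finally have "cnj (LINT s|lebesgue. ?K s) = - (LINT s|lebesgue. of_bool (s < t) * duhamel_kernel (1 / Suc n) (t - s) * cubic (q s))"
        unfolding L .
      moreover have "(LINT x|lebesgue. \<psi> (- t) x * heat_kernel (of_real (1 / Suc n)) x) = free_average \<psi>0 n (- t) - \<i> * (LINT s|lebesgue. ?K s)"
        unfolding free_average_def by (rule duhamel_formula_heat_kernel(2)[OF I(2) \<psi>0 sol init _ \<open>- t \<in> I\<close>]) simp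
      ultimately show ?thesis by simp
    qed
  qed (simp_all add: q_def)
  moreover have "(\<integral>\<^sup>+ t. free_sup \<psi>0 (- t) ^ 4 * indicator {0..-a} t \<partial>lebesgue) = (\<integral>\<^sup>+ t. free_sup \<psi>0 t ^ 4 * indicator {a..0} t \<partial>lebesgue)"
  proof -
    have "(\<lambda>t. free_sup \<psi>0 t ^ 4 * indicator {a..0} t) \<in> borel_measurable lebesgue"
      using free_sup_measurable[OF \<psi>0] by measurable
    from nn_integral_lebesgue_uminus[OF this] show ?thesis by (simp only: ind)
  qed
  moreover have "(\<integral>\<^sup>+ t. ennreal (cmod (q t) ^ 4) \<partial>lebesgue) = (\<integral>\<^sup>+ t. ennreal (cmod (Cx_value (\<psi> t) 0) ^ 4) * indicator {a..0} t \<partial>lebesgue)"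
  proof -
    let ?f = "\<lambda>t. ennreal (cmod (indicator {a..0} t *\<^sub>R Cx_value (\<psi> t) 0) ^ 4)"
    have "?f \<in> borel_measurable lebesgue" using L4Cx_value_measurable[OF u] by measurable
    from nn_integral_lebesgue_uminus[OF this]
    have "(\<integral>\<^sup>+ t. ennreal (cmod (q t) ^ 4) \<partial>lebesgue) = (\<integral>\<^sup>+ t. ?f t \<partial>lebesgue)"
      by (simp add: q_def ind)
    also have "\<dots> = (\<integral>\<^sup>+ t. ennreal (cmod (Cx_value (\<psi> t) 0) ^ 4) * indicator {a..0} t \<partial>lebesgue)"
      by (intro nn_integral_cong) (auto split: split_indicator)
    finally show ?thesis .
  qed
  ultimately show ?thesis by simp
qed

lemma two_sided_estimate:
  assumes ab: "a \<in> I" "b \<in> I" "a \<le> 0" "0 \<le> b"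
  shows "(\<integral>\<^sup>+ t. ennreal (cmod (Cx_value (\<psi> t) 0) ^ 4) * indicator {a..b} t \<partial>lebesgue)
    \<le> (\<integral>\<^sup>+ t. free_sup \<psi>0 t ^ 4 * indicator {a..b} t \<partial>lebesgue)"
proof -
  have sub: "{a..0} \<subseteq> I" "{0..b} \<subseteq> I" using interval_subset[of a 0] interval_subset[of 0 b] I ab by auto
  have m: "(\<lambda>t. ennreal (cmod (Cx_value (\<psi> t) 0) ^ 4) * indicator {c..d} t) \<in> borel_measurable lebesgue"
    if "c \<le> d" "{c..d} \<subseteq> I" for c d
  proof -
    have "(\<lambda>t. ennreal (cmod (indicator {c..d} t *\<^sub>R Cx_value (\<psi> t) 0) ^ 4)) \<in> borel_measurable lebesgue"
      using L4Cx_value_measurable[OF solution_L4Cx[OF that]] by measurable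
    moreover have "ennreal (cmod (indicator {c..d} t *\<^sub>R Cx_value (\<psi> t) 0) ^ 4) = ennreal (cmod (Cx_value (\<psi> t) 0) ^ 4) * indicator {c..d} t" for t
      by (auto split: split_indicator)
    ultimately show ?thesis by (simp only:)
  qed
  have mg: "(\<lambda>t. free_sup \<psi>0 t ^ 4 * indicator {c..d} t) \<in> borel_measurable lebesgue" for c d
    using free_sup_measurable[OF \<psi>0] by measurable
  have "(\<integral>\<^sup>+ t. ennreal (cmod (Cx_value (\<psi> t) 0) ^ 4) * indicator {a..b} t \<partial>lebesgue)
      \<le> (\<integral>\<^sup>+ t. ennreal (cmod (Cx_value (\<psi> t) 0) ^ 4) * indicator {a..0} t + ennreal (cmod (Cx_value (\<psi> t) 0) ^ 4) * indicator {0..b} t \<partial>lebesgue)"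
    by (intro nn_integral_mono) (auto split: split_indicator)
  also have "\<dots> = (\<integral>\<^sup>+ t. ennreal (cmod (Cx_value (\<psi> t) 0) ^ 4) * indicator {a..0} t \<partial>lebesgue)
      + (\<integral>\<^sup>+ t. ennreal (cmod (Cx_value (\<psi> t) 0) ^ 4) * indicator {0..b} t \<partial>lebesgue)"
    by (rule nn_integral_add; rule m; fact)
  also have "\<dots> \<le> (\<integral>\<^sup>+ t. free_sup \<psi>0 t ^ 4 * indicator {a..0} t \<partial>lebesgue) + (\<integral>\<^sup>+ t. free_sup \<psi>0 t ^ 4 * indicator {0..b} t \<partial>lebesgue)"
    by (intro add_mono backward_estimate forward_estimate ab)
  also have "\<dots> = (\<integral>\<^sup>+ t. free_sup \<psi>0 t ^ 4 * indicator {a..0} t + free_sup \<psi>0 t ^ 4 * indicator {0..b} t \<partial>lebesgue)"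
    by (rule nn_integral_add[symmetric]; rule mg)
  also have "\<dots> = (\<integral>\<^sup>+ t. free_sup \<psi>0 t ^ 4 * indicator {a..b} t \<partial>lebesgue)"
  proof (rule nn_integral_cong_AE)
    have "AE t in lebesgue. t \<noteq> (0::real)" by (intro AE_completion AE_lborel_singleton)
    then show "AE t in lebesgue. free_sup \<psi>0 t ^ 4 * indicator {a..0} t + free_sup \<psi>0 t ^ 4 * indicator {0..b} t = free_sup \<psi>0 t ^ 4 * indicator {a..b} t"
      by eventually_elim (use ab in \<open>auto split: split_indicator\<close>)
  qed
  finally show ?thesis .
qed

lemma compact_estimate:
  assumes C: "compact C" "C \<subseteq> I"
  shows "(\<lambda>t. ennreal (cmod (Cx_value (\<psi> t) 0) ^ 4) * indicator C t) \<in> borel_measurable lebesgue"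
    and "(\<integral>\<^sup>+ t. ennreal (cmod (Cx_value (\<psi> t) 0) ^ 4) * indicator C t \<partial>lebesgue)
      \<le> (\<integral>\<^sup>+ t. free_sup \<psi>0 t ^ 4 * indicator I t \<partial>lebesgue)"
proof -
  have comp: "compact (insert 0 C)" "insert 0 C \<noteq> {}" using C by auto
  obtain a where a: "a \<in> insert 0 C" "\<forall>x\<in>insert 0 C. a \<le> x" using compact_attains_inf[OF comp] by blast
  obtain b where b: "b \<in> insert 0 C" "\<forall>x\<in>insert 0 C. x \<le> b" using compact_attains_sup[OF comp] by blast
  have ab: "a \<in> I" "b \<in> I" "a \<le> 0" "0 \<le> b" using a b C I by auto
  have C_sub: "C \<subseteq> {a..b}" using a(2) b(2) by auto
  have sub: "{a..b} \<subseteq> I" using ab by (intro interval_subset)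
  have Cm: "C \<in> sets lebesgue" using C by (intro sets_completionI_sets) (simp add: compact_imp_closed)
  have [measurable]: "(\<lambda>t. indicator {a..b} t *\<^sub>R Cx_value (\<psi> t) 0) \<in> borel_measurable lebesgue"
    using ab sub by (intro L4Cx_value_measurable solution_L4Cx) auto
  have eq: "ennreal (cmod (Cx_value (\<psi> t) 0) ^ 4) * indicator C t
      = ennreal (cmod (indicator {a..b} t *\<^sub>R Cx_value (\<psi> t) 0) ^ 4) * indicator C t" for t
    using C_sub by (auto split: split_indicator)
  show "(\<lambda>t. ennreal (cmod (Cx_value (\<psi> t) 0) ^ 4) * indicator C t) \<in> borel_measurable lebesgue"
    unfolding eq using Cm by measurable
  have "(\<integral>\<^sup>+ t. ennreal (cmod (Cx_value (\<psi> t) 0) ^ 4) * indicator C t \<partial>lebesgue)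
      \<le> (\<integral>\<^sup>+ t. ennreal (cmod (Cx_value (\<psi> t) 0) ^ 4) * indicator {a..b} t \<partial>lebesgue)"
    using C_sub by (intro nn_integral_mono) (auto split: split_indicator)
  also have "\<dots> \<le> (\<integral>\<^sup>+ t. free_sup \<psi>0 t ^ 4 * indicator {a..b} t \<partial>lebesgue)"
    by (rule two_sided_estimate) fact+
  also have "\<dots> \<le> (\<integral>\<^sup>+ t. free_sup \<psi>0 t ^ 4 * indicator I t \<partial>lebesgue)"
    using sub by (intro nn_integral_mono) (auto split: split_indicator)
  finally show "(\<integral>\<^sup>+ t. ennreal (cmod (Cx_value (\<psi> t) 0) ^ 4) * indicator C t \<partial>lebesgue)
      \<le> (\<integral>\<^sup>+ t. free_sup \<psi>0 t ^ 4 * indicator I t \<partial>lebesgue)" .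
qed

end

theorem proposition3p1:
  fixes I :: "real set" and \<psi>0 :: "real \<Rightarrow> complex" and \<psi> :: "real \<Rightarrow> real \<Rightarrow> complex"
  assumes "open I" and "is_interval I" and "0 \<in> I"
    and "\<psi>0 \<in> L2"
    and "strong_solution I \<psi>"
    and "AE x in lebesgue. \<psi> 0 x = \<psi>0 x"
  shows "(\<integral>\<^sup>+ t. ennreal ((cmod (Cx_value (\<psi> t) 0))^4) \<partial>lebesgue_on I)
           \<le> L4Cx_norm_pow4 I (\<lambda>t. schrodinger_group t \<psi>0)"
proof -
  note estimate = compact_estimate[OF assms(2-6)]
  have Im: "I \<inter> space lebesgue \<in> sets lebesgue" using \<open>open I\<close> by (simp add: sets_completionI_sets)
  obtain C where C: "\<And>n. compact (C n)" "\<And>n. C n \<subseteq> I" "\<And>n. C n \<subseteq> interior (C (Suc n))" "\<Union> (range C) = I"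
    using open_Union_compact_subsets[OF \<open>open I\<close>] by metis
  have "incseq C" using C(3) interior_subset by (intro incseq_SucI) blast
  let ?f = "\<lambda>t. ennreal (cmod (Cx_value (\<psi> t) 0) ^ 4)"
  have "(\<integral>\<^sup>+ t. ?f t \<partial>lebesgue_on I) = (\<integral>\<^sup>+ t. ?f t * indicator I t \<partial>lebesgue)"
    by (rule nn_integral_restrict_space[OF Im])
  also have "\<dots> = (\<integral>\<^sup>+ t. (SUP n. ?f t * indicator (C n) t) \<partial>lebesgue)"
  proof (rule nn_integral_cong)
    fix t
    have "(SUP n. indicator (C n) t :: ennreal) = indicator I t"
      unfolding C(4)[symmetric] by (rule LIMSEQ_unique[OF LIMSEQ_SUP LIMSEQ_indicator_incseq[OF \<open>incseq C\<close>]])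
         (use \<open>incseq C\<close> in \<open>auto simp: incseq_def split: split_indicator\<close>)
    then show "?f t * indicator I t = (SUP n. ?f t * indicator (C n) t)"
      by (simp only: SUP_mult_left_ennreal[symmetric])
  qed
  also have "\<dots> = (SUP n. \<integral>\<^sup>+ t. ?f t * indicator (C n) t \<partial>lebesgue)"
  proof (rule nn_integral_monotone_convergence_SUP)
    show "incseq (\<lambda>n t. ?f t * indicator (C n) t)"
      using \<open>incseq C\<close> by (auto simp: incseq_def le_fun_def split: split_indicator)
    show "(\<lambda>t. ?f t * indicator (C n) t) \<in> borel_measurable lebesgue" for n by (rule estimate(1)[OF C(1,2)])
  qed
  also have "\<dots> \<le> (\<integral>\<^sup>+ t. free_sup \<psi>0 t ^ 4 * indicator I t \<partial>lebesgue)"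
    by (intro SUP_least estimate(2)[OF C(1,2)])
  also have "\<dots> \<le> (\<integral>\<^sup>+ t. (Cx_norm (schrodinger_group t \<psi>0)) ^ 4 * indicator I t \<partial>lebesgue)"
    by (intro nn_integral_mono mult_right_mono power_mono free_sup_le assms) auto
  also have "\<dots> = L4Cx_norm_pow4 I (\<lambda>t. schrodinger_group t \<psi>0)"
    unfolding L4Cx_norm_pow4_def by (rule nn_integral_restrict_space[OF Im, symmetric])
  finally show ?thesis .
qed

end
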